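(* In the setting below, let $i\neq j$, put $m=1-(\alpha_i|\alpha_j)$ and fix a sign $\epsilon\in\{+,-\}$. Then, as formal series in $w,z_1,\dots,z_m$ with coefficients in $\mathrm{End}(\mathcal F)$, $$\sum_{\sigma\in S_m}\sum_{r=0}^{m}(-1)^r\begin{bmatrix} m\\ r\end{bmatrix}X_i^{\epsilon}(z_{\sigma(1)})\cdots X_i^{\epsilon}(z_{\sigma(r)})\,X_j^{\epsilon}(w)\,X_i^{\epsilon}(z_{\sigma(r+1)})\cdots X_i^{\epsilon}(z_{\sigma(m)})=0.$$
   Context: Let $A=(a_{ij})_{i,j=1}^l$ be a symmetric generalized Cartan matrix ($a_{ii}=2$, $a_{ij}=a_{ji}\in\mathbb Z_{\le0}$ for $i\ne j$). Let $Q=\bigoplus_{i=1}^l\mathbb Z\alpha_i$ carry the symmetric bilinear form with $(\alpha_i|\alpha_j)=a_{ij}$. Fix $q\in\mathbb C^\times$, not a root of unity, and a square root $q^{1/2}$; write $[n]=\frac{q^n-q^{-n}}{q-q^{-1}}$, $[n]!=[1]\cdots[n]$, $\begin{bmatrix} m\\ r\end{bmatrix}=\frac{[m]!}{[r]![m-r]!}$. Fock space: $\mathcal F=S\otimes\mathbb C\{Q\}$. Here $S$ is the polynomial algebra in the indeterminates $a_i(-n)$ ($1\le i\le l$, $n\ge1$); $a_i(-n)$ acts on $S$ by multiplication and, for $n>0$, $a_i(n)$ acts as the derivation of $S$ with $a_i(n)\cdot a_j(-m)=\delta_{nm}\frac{[(\alpha_i|\alpha_j)n][n]}{n}$, so that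 $[a_i(m),a_j(n)]=\delta_{m+n,0}\frac{[(\alpha_i|\alpha_j)m][m]}{m}$ for $m,n\neq0$. $\mathbb C\{Q\}$ is the twisted group algebra with basis $e^\beta$ ($\beta\in Q$) and product $e^\alpha e^\beta=\varepsilon(\alpha,\beta)e^{\alpha+\beta}$, where $\varepsilon:Q\times Q\to\{\pm1\}$ is bimultiplicative with $\varepsilon(\alpha,\beta)\varepsilon(\beta,\alpha)^{-1}=(-1)^{(\alpha|\beta)}$, so $e^\alpha e^\beta=(-1)^{(\alpha|\beta)}e^\beta e^\alpha$. On $\mathcal F$, $e^\alpha$ acts by left multiplication on the second factor, $a_i(0)(u\otimes e^\beta)=(\alpha_i|\beta)\,u\otimes e^\beta$, and $z^{\pm a_i(0)}(u\otimes e^\beta)=z^{\pm(\alpha_i|\beta)}u\otimes e^\beta$. Vertex operators: with $E^{\pm}_{-}(i,z)=\exp\big(\pm\sum_{n\ge1}\frac{a_i(-n)}{[n]}q^{\mp n/2}z^n\big)$ and $E^{\pm}_{+}(i,z)=\exp\big(\mp\sum_{n\ge1}\frac{a_i(n)}{[n]}q^{\mp n/2}z^{-n}\big)$, set $X_i^{\pm}(z)=E^{\pm}_-(i,z)E^{\pm}_+(i,z)\,e^{\pm\alpha_i}z^{\pm a_i(0)}=\sum_{n\in\mathbb Z}X_i^{\pm}(n)z^{-n-1}$. The symmetric group $S_m$ permutes the variables $z_1,\dots,z_m$; products of vertex operators are the well-defined formal series obtained by composing operators on $\mathcal F$. *)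

theory Defs
  imports Complex_Main "HOL-Library.Poly_Mapping" "HOL-Combinatorics.Permutations"
begin

text \<open>Index set of the Cartan matrix: a finite type 'n (so l = CARD('n)).
  Root lattice Q = functions 'n => int (beta = sum_k beta k alpha_k).
  S = polynomial algebra: variable (k, t) stands for a_k(-(t+1)).
  Fock space F = S (x) C{Q}, represented as finitely supported maps Q => S
  (the value at beta is the S-component of e^beta).\<close>

type_synonym 'n mono = "('n \<times> nat) \<Rightarrow>\<^sub>0 nat"
type_synonym 'n poly = "'n mono \<Rightarrow>\<^sub>0 complex"
type_synonym 'n lat = "'n \<Rightarrow> int"
type_synonym 'n fock = "'n lat \<Rightarrow>\<^sub>0 'n poly"

definition qnum :: "complex \<Rightarrow> int \<Rightarrow> complex" where
  "qnum q k = (q powi k - q powi (-k)) / (q - inverse q)"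

definition qfact :: "complex \<Rightarrow> nat \<Rightarrow> complex" where
  "qfact q n = (\<Prod>k=1..n. qnum q (int k))"

definition qbinom :: "complex \<Rightarrow> nat \<Rightarrow> nat \<Rightarrow> complex" where
  "qbinom q m r = qfact q m / (qfact q r * qfact q (m - r))"

definition sroot :: "'n \<Rightarrow> 'n lat" where
  "sroot i = (\<lambda>k. if k = i then 1 else 0)"

definition bform :: "('n::finite \<Rightarrow> 'n \<Rightarrow> int) \<Rightarrow> 'n lat \<Rightarrow> 'n lat \<Rightarrow> int" where
  "bform A \<beta> \<gamma> = (\<Sum>a\<in>UNIV. \<Sum>b\<in>UNIV. \<beta> a * A a b * \<gamma> b)"

definition sc :: "complex \<Rightarrow> 'n poly" where
  "sc c = Poly_Mapping.single 0 c"

definition scaleF :: "complex \<Rightarrow> 'n fock \<Rightarrow> 'n fock" where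
  "scaleF c v = Poly_Mapping.map (\<lambda>u. sc c * u) v"

definition avar :: "'n \<Rightarrow> nat \<Rightarrow> 'n poly" where
  "avar i n = Poly_Mapping.single (Poly_Mapping.single (i, n - 1) 1) 1"

text \<open>a_i(n), n >= 1: the derivation of S with
  a_i(n) a_j(-m) = delta_{nm} [(alpha_i|alpha_j) n][n]/n\<close>
definition ader :: "('n::finite \<Rightarrow> 'n \<Rightarrow> int) \<Rightarrow> complex \<Rightarrow> 'n \<Rightarrow> nat \<Rightarrow> 'n poly \<Rightarrow> 'n poly" where
  "ader A q i n u = (\<Sum>\<mu>\<in>Poly_Mapping.keys u. \<Sum>j\<in>UNIV.
      Poly_Mapping.single (\<mu> - Poly_Mapping.single (j, n - 1) 1)
        (Poly_Mapping.lookup u \<mu> * of_nat (Poly_Mapping.lookup \<mu> (j, n - 1))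
          * (qnum q (A i j * int n) * qnum q (int n) / of_nat n)))"

text \<open>compositions of k: the coefficient of z^k in exp(sum_{n>=1} g_n z^n)
  is sum over compositions (n_1,...,n_N) of k of g_{n_1}...g_{n_N}/N!\<close>
definition comps :: "nat \<Rightarrow> nat list set" where
  "comps k = {ns. (\<forall>x\<in>set ns. 0 < x) \<and> sum_list ns = k}"

text \<open>coefficient of z^a in E^sgn_-(i,z) (a multiplication operator, given as element of S)\<close>
definition em_coeff :: "complex \<Rightarrow> complex \<Rightarrow> int \<Rightarrow> 'n \<Rightarrow> nat \<Rightarrow> 'n poly" where
  "em_coeff q sq sg i a = (\<Sum>ns\<in>comps a. sc (1 / fact (length ns)) *
      prod_list (map (\<lambda>n. sc (of_int sg * sq powi (- sg * int n) / qnum q (int n)) * avar i n) ns))"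

text \<open>coefficient of z^(-b) in E^sgn_+(i,z), applied to u\<close>
definition ep_coeff :: "('n::finite \<Rightarrow> 'n \<Rightarrow> int) \<Rightarrow> complex \<Rightarrow> complex \<Rightarrow> int \<Rightarrow> 'n \<Rightarrow> nat \<Rightarrow> 'n poly \<Rightarrow> 'n poly" where
  "ep_coeff A q sq sg i b u = (\<Sum>ns\<in>comps b. sc (1 / fact (length ns)) *
      foldr (\<lambda>n f. (\<lambda>x. sc (- of_int sg * sq powi (- sg * int n) / qnum q (int n)) * ader A q i n x) \<circ> f) ns id u)"

text \<open>X_i^sg(n) applied to u (x) e^beta.
  X(z)(u (x) e^beta) = eps(sg alpha_i, beta) z^s E_-(z) E_+(z) u (x) e^(beta + sg alpha_i),
  s = sg (alpha_i|beta); coefficient of z^(-n-1): sum over b with a = b - s - n - 1 >= 0.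
  Only the finitely many b with nonzero E_+ coefficient contribute.\<close>
definition X_basis :: "('n::finite \<Rightarrow> 'n \<Rightarrow> int) \<Rightarrow> ('n lat \<Rightarrow> 'n lat \<Rightarrow> complex) \<Rightarrow> complex \<Rightarrow> complex
    \<Rightarrow> int \<Rightarrow> 'n \<Rightarrow> int \<Rightarrow> 'n lat \<Rightarrow> 'n poly \<Rightarrow> 'n fock" where
  "X_basis A \<epsilon> q sq sg i n \<beta> u =
     (let s = sg * bform A (sroot i) \<beta> in
      Poly_Mapping.single (\<lambda>k. \<beta> k + sg * sroot i k)
       (\<Sum>b\<in>{b. ep_coeff A q sq sg i b u \<noteq> 0 \<and> int b - s - n - 1 \<ge> 0}.
          sc (\<epsilon> (\<lambda>k. sg * sroot i k) \<beta>) * em_coeff q sq sg i (nat (int b - s - n - 1))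
            * ep_coeff A q sq sg i b u))"

definition X_mode :: "('n::finite \<Rightarrow> 'n \<Rightarrow> int) \<Rightarrow> ('n lat \<Rightarrow> 'n lat \<Rightarrow> complex) \<Rightarrow> complex \<Rightarrow> complex
    \<Rightarrow> int \<Rightarrow> 'n \<Rightarrow> int \<Rightarrow> 'n fock \<Rightarrow> 'n fock" where
  "X_mode A \<epsilon> q sq sg i n v =
     (\<Sum>\<beta>\<in>Poly_Mapping.keys v. X_basis A \<epsilon> q sq sg i n \<beta> (Poly_Mapping.lookup v \<beta>))"

text \<open>Formal series in variables indexed by nat with coefficients in End(F):
  a map from exponent vectors (nat => int) to operators. The product
  X_{i_1}(y_1) ... X_{i_k}(y_k) (distinct variables y_t) has coefficient
  X_{i_1}(-d(y_1)-1) o ... o X_{i_k}(-d(y_k)-1) at the monomial prod_y y^(d y)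
  (and 0 if d involves other variables).\<close>
definition vo_series :: "('n::finite \<Rightarrow> 'n \<Rightarrow> int) \<Rightarrow> ('n lat \<Rightarrow> 'n lat \<Rightarrow> complex) \<Rightarrow> complex \<Rightarrow> complex
    \<Rightarrow> int \<Rightarrow> ('n \<times> nat) list \<Rightarrow> (nat \<Rightarrow> int) \<Rightarrow> 'n fock \<Rightarrow> 'n fock" where
  "vo_series A \<epsilon> q sq sg ops d =
     (if (\<forall>y. y \<notin> snd ` set ops \<longrightarrow> d y = 0)
      then foldr (\<lambda>(i, y) f. X_mode A \<epsilon> q sq sg i (- d y - 1) \<circ> f) ops id
      else (\<lambda>_. 0))"

end

theory Submission
  imports "Jordan_Normal_Form.Determinant" "HOL-Computational_Algebra.Formal_Power_Series"
    "HOL-Library.Function_Algebras" Defs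
begin

text \<open>
  Moving all annihilation parts to the right turns every product of the vertex operators into the same
  normally ordered product, multiplied by contraction factors (with \<open>q\<close> replaced by its inverse for the
  sign \<open>-\<close>): the polynomial \<open>(z_s - z_t) (z_s - q^(-2) z_t)\<close> for each pair of variables of \<open>X_i\<close> and, for
  the pair \<open>z, w\<close>, the expansion \<open>u\<close> (in \<open>w/z\<close>) or \<open>v\<close> (in \<open>z/w\<close>) of the inverse of a product of \<open>m - 1\<close>
  linear factors. As \<open>u\<close> and \<open>v\<close> are expanded in different regions, an identity of rational functions
  would not suffice. Instead, for arbitrary elements \<open>z_t, u_t, v_t\<close> of a commutative ring, the sum
  over permutations and \<open>r\<close> equals, up to a factor not involving \<open>u\<close> and \<open>v\<close>, the determinant of the matrix with
  entries \<open>z_t^(m-1-k) (v_t - q^(m-1-2k) u_t)\<close>. By the q-binomial theorem a combination of its columns has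
  the form \<open>(polynomial) v - (polynomial) u = 1 - 1 = 0\<close>, whatever the region of expansion. To stay inside a
  commutative ring, the series are truncated at order \<open>K\<close>; the error terms do not contribute to a given
  coefficient when \<open>K\<close> is large.
\<close>

section \<open>The symmetrized sum as a determinant\<close>

text \<open>The determinant identity rests on Pascal's rule: for a fixed order it splits the
  alternating sum into a part whose last factor is a \<open>v\<close> and a part whose first factor
  is a \<open>u\<close>. Once the variable \<open>z_i\<close> in that place is fixed, the same sum
  remains for the other variables, with every \<open>u\<close> divided by \<open>q\<close>. Deleting
  row \<open>i\<close> and the first column of the matrix has the same effect, so the induction is a
  Laplace expansion along the first column. The truncated series satisfy the column relation only up
  to an error. In row \<open>t\<close> it consists of monomials \<open>z_t^n w^(-n)\<close> with
  \<open>|n| > K\<close>. The cofactor multiplying it contains no series in \<open>z_t\<close>, so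
  nothing brings this exponent back near zero; together with a lower bound for the total degree,
  this pushes some variable out of the support of the normally ordered product. The lattice part
  contributes a sign \<open>(-1)^(m-1)\<close> for each \<open>X_i\<close> standing left of
  \<open>X_j\<close>; it is absorbed in \<open>u\<close>.\<close>

fun qb :: "'a::comm_ring_1 \<Rightarrow> 'a \<Rightarrow> nat \<Rightarrow> nat \<Rightarrow> 'a" where
  "qb q q' m 0 = 1"
| "qb q q' 0 (Suc r) = 0"
| "qb q q' (Suc m) (Suc r) = q' ^ Suc r * qb q q' m (Suc r) + q ^ (m - r) * qb q q' m r"

lemma qb_eq_0: "m < r \<Longrightarrow> qb q q' m r = 0"
proof (induction m arbitrary: r)
  case 0 then show ?case by (cases r) auto
next
  case (Suc m) then show ?case by (cases r) auto
qed

definition serre_sum :: "'a::comm_ring_1 \<Rightarrow> 'a \<Rightarrow> nat \<Rightarrow> (nat \<Rightarrow> 'a) \<Rightarrow> (nat \<Rightarrow> 'a) \<Rightarrow> 'a" where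
  "serre_sum q q' m u v =
     (\<Sum>r\<le>m. (- 1) ^ r * qb q q' m r * (\<Prod>s<r. u s) * (\<Prod>s\<in>{r..<m}. v s))"

text \<open>Pascal's rule splits the sum. The factor \<open>q'^r\<close> of the first part is spread
  over the \<open>r\<close> factors \<open>u\<close>; the second part is rescaled alike because
  \<open>q^(m-r) = q^m q'^r\<close>. As \<open>qb\<close> is defined by this rule and not by
  factorials, no division is required in the ring.\<close>

lemma serre_sum_Suc:
  assumes "q * q' = 1"
  shows "serre_sum q q' (Suc m) u v =
    v m * serre_sum q q' m (\<lambda>s. q' * u s) v
    - q ^ m * u 0 * serre_sum q q' m (\<lambda>s. q' * u (Suc s)) (\<lambda>s. v (Suc s))"
proof -
  let ?t = "\<lambda>r. (\<Prod>s<r. u s) * (\<Prod>s\<in>{r..<Suc m}. v s)"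
  have "serre_sum q q' (Suc m) u v = ?t 0 + (\<Sum>r\<le>m. (- 1) ^ Suc r * qb q q' (Suc m) (Suc r) * ?t (Suc r))"
    unfolding serre_sum_def by (subst sum.atMost_Suc_shift) (simp add: mult.assoc)
  also have "\<dots> = (?t 0 + (\<Sum>r\<le>m. (- 1) ^ Suc r * (q' ^ Suc r * qb q q' m (Suc r)) * ?t (Suc r)))
      - (\<Sum>r\<le>m. (- 1) ^ r * (q ^ (m - r) * qb q q' m r) * ?t (Suc r))"
    by (simp add: algebra_simps sum.distrib sum_subtractf sum_negf)
  also have "?t 0 + (\<Sum>r\<le>m. (- 1) ^ Suc r * (q' ^ Suc r * qb q q' m (Suc r)) * ?t (Suc r))
      = (\<Sum>r\<le>Suc m. (- 1) ^ r * (q' ^ r * qb q q' m r) * ?t r)"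
    by (subst sum.atMost_Suc_shift) simp
  also have "\<dots> = (\<Sum>r\<le>m. (- 1) ^ r * (q' ^ r * qb q q' m r) * ?t r)"
    by (simp add: qb_eq_0)
  also have "\<dots> = v m * serre_sum q q' m (\<lambda>s. q' * u s) v"
    unfolding serre_sum_def sum_distrib_left
    by (intro sum.cong) (simp_all add: prod.distrib algebra_simps prod.atLeastLessThan_Suc)
  also have "(\<Sum>r\<le>m. (- 1) ^ r * (q ^ (m - r) * qb q q' m r) * ?t (Suc r))
      = q ^ m * u 0 * serre_sum q q' m (\<lambda>s. q' * u (Suc s)) (\<lambda>s. v (Suc s))"
    unfolding serre_sum_def sum_distrib_left
  proof (intro sum.cong refl)
    fix r assume "r \<in> {..m}"
    then have "q ^ m * q' ^ r = q ^ (m - r) * (q * q') ^ r"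
      by (simp add: power_mult_distrib flip: power_add mult.assoc)
    then have q: "q ^ (m - r) = q ^ m * q' ^ r" by (simp add: assms)
    have "(\<Prod>s<Suc r. u s) = u 0 * (\<Prod>s<r. u (Suc s))" by (rule prod.lessThan_Suc_shift)
    moreover have "(\<Prod>s\<in>{Suc r..<Suc m}. v s) = (\<Prod>s\<in>{r..<m}. v (Suc s))"
      by (rule prod.shift_bounds_Suc_ivl)
    ultimately show "(- 1) ^ r * (q ^ (m - r) * qb q q' m r) * ?t (Suc r) =
         q ^ m * u 0 * ((- 1) ^ r * qb q q' m r * (\<Prod>s<r. q' * u (Suc s)) * (\<Prod>s = r..<m. v (Suc s)))"
      by (simp only: q prod.distrib) (simp add: algebra_simps)
  qed
  finally show ?thesis .
qed

section \<open>Pair products, Vandermonde factors and sums over permutations\<close>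

definition pairprod :: "(nat \<Rightarrow> nat \<Rightarrow> 'a::comm_monoid_mult) \<Rightarrow> nat \<Rightarrow> 'a" where
  "pairprod g m = (\<Prod>t<m. \<Prod>s<t. g s t)"

lemma pairprod_Suc: "pairprod g (Suc m) = (\<Prod>s<m. g s m) * pairprod g m"
  by (simp add: pairprod_def mult.commute)

lemma pairprod_Suc': "pairprod g (Suc m) = (\<Prod>t<m. g 0 (Suc t)) * pairprod (\<lambda>s t. g (Suc s) (Suc t)) m"
  unfolding pairprod_def
  by (subst prod.lessThan_Suc_shift) (simp add: prod.lessThan_Suc_shift prod.distrib del: prod.lessThan_Suc)

lemma pairprod_cong: "(\<And>s t. s < t \<Longrightarrow> t < m \<Longrightarrow> g s t = h s t) \<Longrightarrow> pairprod g m = pairprod h m"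
  unfolding pairprod_def by (auto intro!: prod.cong)

lemma prod_insert_index:
  fixes f :: "nat \<Rightarrow> 'a::comm_monoid_mult"
  assumes "i < Suc m"
  shows "(\<Prod>s<Suc m. f s) = f i * (\<Prod>j<m. f (insert_index i j))"
proof -
  have inj: "inj_on (insert_index i) {0..<m}" by (auto simp: inj_on_def insert_index_def split: if_splits)
  have "(\<Prod>s\<in>{0..<Suc m} - {i}. f s) = (\<Prod>j<m. f (insert_index i j))"
    using prod.reindex[OF inj, of f] insert_index_image[OF assms] by (simp add: atLeast0LessThan o_def)
  moreover have "(\<Prod>s<Suc m. f s) = f i * (\<Prod>s\<in>{0..<Suc m} - {i}. f s)"
    using assms by (subst prod.remove[of _ i]) (auto simp: atLeast0LessThan)
  ultimately show ?thesis by simp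
qed

text \<open>The pairs containing \<open>i\<close> are pulled out with \<open>z i\<close> in front;
  the \<open>i\<close> pairs in which it stood second change sign.\<close>

lemma vandermonde_insert_index:
  fixes z :: "nat \<Rightarrow> 'a::comm_ring_1"
  assumes "i < Suc m"
  shows "pairprod (\<lambda>s t. z s - z t) (Suc m) =
    (- 1) ^ i * (\<Prod>j<m. z i - z (insert_index i j)) *
      pairprod (\<lambda>s t. z (insert_index i s) - z (insert_index i t)) m"
  using assms
proof (induction m)
  case 0 then show ?case by (simp add: pairprod_def)
next
  case (Suc m)
  show ?case
  proof (cases "i = Suc m")
    case True
    have "(\<Prod>s<Suc m. z s - z i) = (\<Prod>s<Suc m. (-1) * (z i - z s))" by (intro prod.cong) auto
    also have "\<dots> = (-1) ^ i * (\<Prod>s<Suc m. z i - z s)"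
      by (subst prod.distrib) (simp add: True)
    finally have 1: "(\<Prod>s<Suc m. z s - z i) = (-1) ^ i * (\<Prod>s<Suc m. z i - z s)" .
    have 2: "(\<Prod>j<Suc m. z i - z (insert_index i j)) = (\<Prod>s<Suc m. z i - z s)"
      by (intro prod.cong) (auto simp: True)
    have 3: "pairprod (\<lambda>s t. z (insert_index i s) - z (insert_index i t)) (Suc m) = pairprod (\<lambda>s t. z s - z t) (Suc m)"
      by (intro pairprod_cong) (auto simp: True)
    show ?thesis unfolding 2 3 pairprod_Suc[of _ "Suc m"]
      unfolding 1[symmetric] by (simp add: True)
  next
    case False
    then have i: "i < Suc m" using Suc.prems by simp
    have 1: "(\<Prod>s<Suc m. z s - z (Suc m)) = (z i - z (Suc m)) * (\<Prod>j<m. z (insert_index i j) - z (Suc m))"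
      by (rule prod_insert_index[OF i])
    have 2: "insert_index i m = Suc m" using i by (simp add: insert_index_def)
    show ?thesis
      unfolding pairprod_Suc[of "\<lambda>s t. z s - z t" "Suc m"] Suc.IH[OF i] 1
        pairprod_Suc[of "\<lambda>s t. z (insert_index i s) - z (insert_index i t)" m]
      by (simp add: 2 mult_ac)
  qed
qed

text \<open>Permutations are grouped by their value at \<open>k\<close>. The determinant identity
  uses the last position \<open>k = m\<close> for \<open>v\<close> and the first position
  \<open>k = 0\<close> for \<open>u\<close>.\<close>

lemma sum_permutes_Suc:
  fixes G :: "(nat \<Rightarrow> nat) \<Rightarrow> 'a::comm_monoid_add"
  assumes "k < Suc m"
  shows "(\<Sum>\<sigma> | \<sigma> permutes {..<Suc m}. G \<sigma>) =
    (\<Sum>i<Suc m. \<Sum>\<tau> | \<tau> permutes {..<m}. G (permutation_insert k i \<tau>))"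
proof -
  have fin: "finite {\<sigma>. \<sigma> permutes {..<Suc m}}" by (rule finite_permutations) simp
  have "(\<Sum>\<sigma> | \<sigma> permutes {..<Suc m}. G \<sigma>) =
     (\<Sum>i<Suc m. \<Sum>\<sigma>\<in>{\<sigma>\<in>{\<sigma>. \<sigma> permutes {..<Suc m}}. \<sigma> k = i}. G \<sigma>)"
    using fin assms by (intro sum.group[symmetric]) (auto dest: permutes_in_image)
  also have "\<dots> = (\<Sum>i<Suc m. \<Sum>\<tau> | \<tau> permutes {..<m}. G (permutation_insert k i \<tau>))"
  proof (rule sum.cong[OF refl])
    fix i assume i: "i \<in> {..<Suc m}"
    have "{\<sigma>\<in>{\<sigma>. \<sigma> permutes {..<Suc m}}. \<sigma> k = i} = permutation_insert k i ` {\<tau>. \<tau> permutes {..<m}}"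
      using permutation_fix[OF assms, of i] i by (simp add: lessThan_atLeast0)
    moreover have "inj_on (permutation_insert k i) {\<tau>. \<tau> permutes {..<m}}"
      using permutation_insert_inj_on[OF assms, of i] i by (simp add: lessThan_atLeast0)
    ultimately show "(\<Sum>\<sigma>\<in>{\<sigma>\<in>{\<sigma>. \<sigma> permutes {..<Suc m}}. \<sigma> k = i}. G \<sigma>) =
        (\<Sum>\<tau> | \<tau> permutes {..<m}. G (permutation_insert k i \<tau>))"
      by (simp add: sum.reindex)
  qed
  finally show ?thesis .
qed

text \<open>The \<open>l = 0\<close> summand vanishes, so the truncated exponent \<open>l - 1\<close> is harmless.\<close>
lemma poly_mult_root_eq_sum:
  fixes S :: "'a::comm_ring_1 Polynomial.poly"
  assumes "degree S < N"
  shows "poly S (y * z) = (\<Sum>l\<le>N. coeff ([:- z, 1:] * S) l * z ^ (l - 1) * (\<Sum>n<l. y ^ n))"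
proof -
  have c: "coeff ([:- z, 1:] * S) (Suc l) = coeff S l - z * coeff S (Suc l)" for l
    by simp
  have N: "coeff S N = 0" using assms by (simp add: coeff_eq_0)
  \<comment> \<open>For \<open>P = (X - z) S\<close> this is the divided difference
    \<open>(P(y z) - P(z)) / (y z - z)\<close> written without division: each
    \<open>coeff P l\<close> meets \<open>z^(l-1)\<close> times a geometric sum in
    \<open>y\<close>.\<close>
  have "(\<Sum>l\<le>N. coeff ([:- z, 1:] * S) l * z ^ (l - 1) * (\<Sum>n<l. y ^ n))
      = (\<Sum>l<N. (coeff S l - z * coeff S (Suc l)) * z ^ l * (\<Sum>n<Suc l. y ^ n))"
    by (cases N) (simp_all add: sum.atMost_Suc_shift lessThan_Suc_atMost c del: sum.atMost_Suc sum.lessThan_Suc)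
  also have "\<dots> = (\<Sum>l<N. coeff S l * z ^ l * (\<Sum>n<Suc l. y ^ n)) -
      (\<Sum>l<N. coeff S (Suc l) * z ^ Suc l * (\<Sum>n<Suc l. y ^ n))"
    by (simp add: algebra_simps sum_subtractf)
  also have "(\<Sum>l<N. coeff S (Suc l) * z ^ Suc l * (\<Sum>n<Suc l. y ^ n)) =
      (\<Sum>l<Suc N. coeff S l * z ^ l * (\<Sum>n<l. y ^ n))"
    by (subst sum.lessThan_Suc_shift) simp
  also have "\<dots> = (\<Sum>l<N. coeff S l * z ^ l * (\<Sum>n<l. y ^ n))" by (simp add: N)
  also have "(\<Sum>l<N. coeff S l * z ^ l * (\<Sum>n<Suc l. y ^ n)) - \<dots> = (\<Sum>l<N. coeff S l * (y * z) ^ l)"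
    by (simp add: algebra_simps sum.distrib power_mult_distrib)
  also have "\<dots> = poly S (y * z)"
    unfolding poly_altdef using assms
    by (intro sum.mono_neutral_right) (auto simp: coeff_eq_0)
  finally show ?thesis by simp
qed

definition serre_mat :: "'a::comm_ring_1 \<Rightarrow> 'a \<Rightarrow> nat \<Rightarrow> (nat \<Rightarrow> 'a) \<Rightarrow> (nat \<Rightarrow> 'a) \<Rightarrow> (nat \<Rightarrow> 'a) \<Rightarrow> 'a mat" where
  "serre_mat q q' m z u v =
     mat m m (\<lambda>(t, k). z t ^ (m - 1 - k) * (v t - q ^ (m - 1) * q' ^ (2 * k) * u t))"

text \<open>Column \<open>k\<close> of the minor is column \<open>k + 1\<close> of the large matrix,
  and \<open>q^(m-2(k+1)) = q^(m-1-2k) q'\<close>: this is the rescaling of \<open>u\<close> in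
  \<open>serre_sum_Suc\<close>.\<close>

lemma serre_mat_delete:
  assumes "q * q' = 1" and "i < Suc m"
  shows "mat_delete (serre_mat q q' (Suc m) z u v) i 0 =
    serre_mat q q' m (\<lambda>t. z (insert_index i t)) (\<lambda>t. q' * u (insert_index i t)) (\<lambda>t. v (insert_index i t))"
proof (rule eq_matI, goal_cases)
  case (1 t k)
  then obtain n where m: "m = Suc n" by (cases m) (auto simp: serre_mat_def)
  have "q ^ m * q' ^ (2 * Suc k) = (q * q') * (q ^ n * q' ^ (2 * k) * q')"
    by (simp add: m mult_ac)
  then have "q ^ m * q' ^ (2 * Suc k) = q ^ n * q' ^ (2 * k) * q'" by (simp add: assms)
  then have e: "x - q ^ m * q' ^ (2 * Suc k) * y = x - q ^ n * q' ^ (2 * k) * (q' * y)" for x y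
    by (simp only: mult.assoc)
  have "mat_delete (serre_mat q q' (Suc m) z u v) i 0 $$ (t, k) =
      z (insert_index i t) ^ (m - Suc k) * (v (insert_index i t) - q ^ m * q' ^ (2 * Suc k) * u (insert_index i t))"
    using 1 assms(2) by (auto simp: serre_mat_def mat_delete_def insert_index_def)
  then show ?case unfolding e using 1 by (simp add: serre_mat_def m)
qed (auto simp: serre_mat_def)

text \<open>Used twice: to single out one column in the determinant identity, and to turn a relation
  between the columns into a formula for the determinant.\<close>

lemma cofactor_col_orthogonal:
  assumes "A \<in> carrier_mat (Suc m) (Suc m)" and "k < Suc m"
  shows "(\<Sum>i<Suc m. A $$ (i, k) * cofactor A i 0) = (if k = 0 then det A else 0)"
proof -
  have "(adj_mat A * A) $$ (0, k) = (\<Sum>i<Suc m. cofactor A i 0 * A $$ (i, k))"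
    using assms by (simp add: adj_mat_def scalar_prod_def lessThan_atLeast0)
  moreover have "adj_mat A * A = det A \<cdot>\<^sub>m 1\<^sub>m (Suc m)" by (rule adj_mat(3)[OF assms(1)])
  ultimately have "(\<Sum>i<Suc m. cofactor A i 0 * A $$ (i, k)) = (if k = 0 then det A else 0)"
    using assms(2) by (auto simp del: sum.lessThan_Suc split: if_splits)
  then show ?thesis by (simp only: mult.commute)
qed

text \<open>The left side is what \<open>z i\<close> contributes in last minus first position once
  the common factors \<open>z i - z j\<close> are removed. Both products are, up to a power of
  \<open>q\<close>, values of the polynomial with roots \<open>z j\<close>,
  \<open>j \<noteq> i\<close>, at \<open>q'^2 z i\<close> and \<open>q^2 z i\<close>. On the right
  \<open>coeff P l\<close> does not depend on \<open>i\<close>, and for \<open>l > 0\<close> the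
  last factor is the entry of \<open>serre_mat\<close> in row \<open>i\<close> and column
  \<open>m + 1 - l\<close>.\<close>

lemma serre_bracket:
  fixes q q' :: "'a::comm_ring_1" and z u v :: "nat \<Rightarrow> 'a"
  assumes q: "q * q' = 1" and i: "i < Suc m"
  defines "P \<equiv> \<Prod>j<Suc m. [:- z j, 1:]"
  shows "(\<Prod>j<m. q'\<^sup>2 * z i - z (insert_index i j)) * v i
       - q ^ m * (\<Prod>j<m. z i - q'\<^sup>2 * z (insert_index i j)) * u i =
    (\<Sum>l\<le>Suc m. coeff P l * (\<Sum>n<l. (q'\<^sup>2) ^ n) * (z i ^ (l - 1) * (v i - q ^ m * q' ^ (2 * (Suc m - l)) * u i)))"
proof -
  define S where "S = (\<Prod>j<m. [:- z (insert_index i j), 1:])"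
  have P: "P = [:- z i, 1:] * S" unfolding P_def S_def by (rule prod_insert_index[OF i])
  have deg: "degree S < Suc m"
    unfolding S_def less_Suc_eq_le by (rule order.trans[OF degree_prod_sum_le]) (auto intro!: sum_le_card_Max[THEN order.trans] simp: degree_pCons_eq_if)
  have pS: "poly S x = (\<Prod>j<m. x - z (insert_index i j))" for x
    unfolding S_def by (simp add: poly_prod)
  have qq: "q ^ n * q' ^ n = 1" for n using q by (metis power_mult_distrib power_one)
  have qq2: "q\<^sup>2 * q'\<^sup>2 = 1" by (rule qq)
  have "(\<Prod>j<m. z i - q'\<^sup>2 * z (insert_index i j)) = (\<Prod>j<m. q'\<^sup>2 * (q\<^sup>2 * z i - z (insert_index i j)))"
    using qq2 by (intro prod.cong) (simp_all add: algebra_simps)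
  also have "\<dots> = (q'\<^sup>2) ^ m * poly S (q\<^sup>2 * z i)" by (simp add: prod.distrib pS)
  finally have 1: "(\<Prod>j<m. z i - q'\<^sup>2 * z (insert_index i j)) = (q'\<^sup>2) ^ m * poly S (q\<^sup>2 * z i)" .
  \<comment> \<open>The geometric sums in \<open>q^2\<close> and \<open>q'^2\<close> differ by
    reversal and a power of \<open>q'\<close>; so both products expand with the same q-integers, and
    the power left over is the one in column \<open>Suc m - l\<close>.\<close>
  have geo: "(q'\<^sup>2) ^ m * (\<Sum>n<l. (q\<^sup>2) ^ n) = q' ^ (2 * (Suc m - l)) * (\<Sum>n<l. (q'\<^sup>2) ^ n)" if "l \<le> Suc m" for l
  proof -
    have "(q'\<^sup>2) ^ m * (\<Sum>n<l. (q\<^sup>2) ^ n) = (\<Sum>n<l. (q'\<^sup>2) ^ (m - n))"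
      unfolding sum_distrib_left
    proof (intro sum.cong refl)
      fix n assume "n \<in> {..<l}"
      then have "(q'\<^sup>2) ^ m = (q'\<^sup>2) ^ (m - n) * (q'\<^sup>2) ^ n" using that by (simp flip: power_add)
      then have "(q'\<^sup>2) ^ m * (q\<^sup>2) ^ n = (q'\<^sup>2) ^ (m - n) * (q\<^sup>2 * q'\<^sup>2) ^ n"
        by (simp add: power_mult_distrib mult_ac)
      then show "(q'\<^sup>2) ^ m * (q\<^sup>2) ^ n = (q'\<^sup>2) ^ (m - n)" by (simp add: qq2)
    qed
    also have "\<dots> = (\<Sum>n<l. (q'\<^sup>2) ^ (m - (l - Suc n)))" by (rule sum.nat_diff_reindex[symmetric])
    also have "\<dots> = (\<Sum>n<l. (q'\<^sup>2) ^ (Suc m - l) * (q'\<^sup>2) ^ n)"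
      using that by (intro sum.cong refl) (simp flip: power_add)
    finally show ?thesis by (simp add: sum_distrib_left power_mult)
  qed
  have 2: "(q'\<^sup>2) ^ m * poly S (q\<^sup>2 * z i) =
      (\<Sum>l\<le>Suc m. coeff P l * z i ^ (l - 1) * (q' ^ (2 * (Suc m - l)) * (\<Sum>n<l. (q'\<^sup>2) ^ n)))"
    unfolding poly_mult_root_eq_sum[OF deg] P[symmetric] sum_distrib_left[of "(q'\<^sup>2) ^ m"]
    using geo by (intro sum.cong refl) (simp add: mult.left_commute[of "(q'\<^sup>2) ^ m"])
  have "(\<Prod>j<m. q'\<^sup>2 * z i - z (insert_index i j)) * v i
       - q ^ m * (\<Prod>j<m. z i - q'\<^sup>2 * z (insert_index i j)) * u i = 
     (\<Sum>l\<le>Suc m. coeff P l * z i ^ (l - 1) * (\<Sum>n<l. (q'\<^sup>2) ^ n)) * v i -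
     q ^ m * (\<Sum>l\<le>Suc m. coeff P l * z i ^ (l - 1) * (q' ^ (2 * (Suc m - l)) * (\<Sum>n<l. (q'\<^sup>2) ^ n))) * u i"
    unfolding 1 2 unfolding pS[symmetric] poly_mult_root_eq_sum[OF deg] P[symmetric] ..
  also have "\<dots> = (\<Sum>l\<le>Suc m. coeff P l * (\<Sum>n<l. (q'\<^sup>2) ^ n) * (z i ^ (l - 1) * (v i - q ^ m * q' ^ (2 * (Suc m - l)) * u i)))"
    unfolding sum_distrib_left[of "q ^ m"] sum_distrib_right[of _ _ "v i"] sum_distrib_right[of _ _ "u i"] sum_subtractf[symmetric]
    by (intro sum.cong refl) (simp add: algebra_simps)
  finally show ?thesis .
qed

lemma lead_coeff_prod_linear: "coeff (\<Prod>j<n. [:- z j, 1:]) n = (1::'a::comm_ring_1)"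
proof (induction n)
  case (Suc n)
  have "degree (\<Prod>j<n. [:- z j, 1:]) \<le> n"
    by (rule order.trans[OF degree_prod_sum_le]) (auto intro!: sum_le_card_Max[THEN order.trans] simp: degree_pCons_eq_if)
  then have "coeff (\<Prod>j<n. [:- z j, 1:]) (Suc n) = 0" by (simp add: coeff_eq_0)
  then show ?case using Suc by (simp add: mult.commute[of "prod _ _"])
qed simp

text \<open>After \<open>serre_bracket\<close> the sum over \<open>i\<close> pairs columns of the
  matrix with the cofactors of its first column. Only the first column survives; it comes with the
  leading coefficient 1 of \<open>P\<close> and with the q-integer that is the new factor of the
  product.\<close>

theorem serre_symmetrization_eq_det:
  fixes q q' :: "'a::comm_ring_1"
  assumes q: "q * q' = 1"
  shows "(\<Sum>\<sigma> | \<sigma> permutes {..<m}.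
      pairprod (\<lambda>s t. (z (\<sigma> s) - z (\<sigma> t)) * (z (\<sigma> s) - q'\<^sup>2 * z (\<sigma> t))) m *
      serre_sum q q' m (\<lambda>s. u (\<sigma> s)) (\<lambda>s. v (\<sigma> s))) =
    pairprod (\<lambda>s t. z s - z t) m * (\<Prod>l<m. \<Sum>n<Suc l. (q'\<^sup>2) ^ n) * det (serre_mat q q' m z u v)"
proof (induction m arbitrary: z u v)
  case 0
  show ?case by (simp add: pairprod_def serre_sum_def serre_mat_def)
next
  case (Suc m)
  define g where "g = (\<lambda>x y. (x - y) * (x - q'\<^sup>2 * y))"
  define ins :: "nat \<Rightarrow> nat \<Rightarrow> nat" where "ins = insert_index"
  let ?V = "pairprod (\<lambda>s t. z s - z t) (Suc m)"
  let ?V' = "\<lambda>i. pairprod (\<lambda>s t. z (ins i s) - z (ins i t)) m"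
  let ?pf = "\<Prod>l<m. \<Sum>n<Suc l. (q'\<^sup>2) ^ n"
  let ?A = "serre_mat q q' (Suc m) z u v"
  let ?D = "\<lambda>i. det (mat_delete ?A i 0)"
  define P where "P = (\<Prod>j<Suc m. [:- z j, 1:])"
  have A: "?A \<in> carrier_mat (Suc m) (Suc m)" by (simp add: serre_mat_def)
  have swap: "(a * S) * (b * p * D) = c * p * (S * (e * D))" if "a * b = c * e" for a b c e S p D :: 'a
  proof -
    have "(a * S) * (b * p * D) = (a * b) * (p * S * D)" by (simp only: mult_ac)
    then show ?thesis by (simp only: that mult_ac)
  qed
  have IH: "(\<Sum>\<tau> | \<tau> permutes {..<m}. pairprod (\<lambda>s t. g (z (ins i (\<tau> s))) (z (ins i (\<tau> t)))) m *
      serre_sum q q' m (\<lambda>s. q' * u (ins i (\<tau> s))) (\<lambda>s. v (ins i (\<tau> s)))) = ?V' i * ?pf * ?D i" if "i < Suc m" for i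
    using Suc.IH[of "\<lambda>s. z (ins i s)" "\<lambda>s. q' * u (ins i s)" "\<lambda>s. v (ins i s)"]
    unfolding serre_mat_delete[OF q that] g_def ins_def .
  \<comment> \<open>The pair product is factored differently in the two parts: the last index is
    split off beside \<open>v\<close>, the first one beside \<open>u\<close>.\<close>
  have "(\<Sum>\<sigma> | \<sigma> permutes {..<Suc m}. pairprod (\<lambda>s t. g (z (\<sigma> s)) (z (\<sigma> t))) (Suc m) *
      serre_sum q q' (Suc m) (\<lambda>s. u (\<sigma> s)) (\<lambda>s. v (\<sigma> s))) =
    (\<Sum>\<sigma> | \<sigma> permutes {..<Suc m}. (\<Prod>s<m. g (z (\<sigma> s)) (z (\<sigma> m))) * pairprod (\<lambda>s t. g (z (\<sigma> s)) (z (\<sigma> t))) m *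
        (v (\<sigma> m) * serre_sum q q' m (\<lambda>s. q' * u (\<sigma> s)) (\<lambda>s. v (\<sigma> s)))) -
    (\<Sum>\<sigma> | \<sigma> permutes {..<Suc m}. (\<Prod>t<m. g (z (\<sigma> 0)) (z (\<sigma> (Suc t)))) * pairprod (\<lambda>s t. g (z (\<sigma> (Suc s))) (z (\<sigma> (Suc t)))) m *
        (q ^ m * u (\<sigma> 0) * serre_sum q q' m (\<lambda>s. q' * u (\<sigma> (Suc s))) (\<lambda>s. v (\<sigma> (Suc s)))))"
    unfolding serre_sum_Suc[OF q] right_diff_distrib sum_subtractf
    by (intro arg_cong2[where f = "(-)"] sum.cong refl arg_cong2[where f = "(*)"] pairprod_Suc pairprod_Suc')
  also have "(\<Sum>\<sigma> | \<sigma> permutes {..<Suc m}. (\<Prod>s<m. g (z (\<sigma> s)) (z (\<sigma> m))) * pairprod (\<lambda>s t. g (z (\<sigma> s)) (z (\<sigma> t))) m *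
        (v (\<sigma> m) * serre_sum q q' m (\<lambda>s. q' * u (\<sigma> s)) (\<lambda>s. v (\<sigma> s)))) =
     (\<Sum>i<Suc m. \<Sum>\<tau> | \<tau> permutes {..<m}. (\<Prod>s<m. g (z (ins i s)) (z i)) * v i *
        (pairprod (\<lambda>s t. g (z (ins i (\<tau> s))) (z (ins i (\<tau> t)))) m *
        serre_sum q q' m (\<lambda>s. q' * u (ins i (\<tau> s))) (\<lambda>s. v (ins i (\<tau> s)))))"
    (is "?L = (\<Sum>i<Suc m. \<Sum>\<tau> | \<tau> permutes {..<m}. ?R i \<tau>)")
  proof -
    have 1: "permutation_insert m i \<tau> s = ins i (\<tau> s)" if "s < m" for i \<tau> s
      using that by (simp add: permutation_insert_expand insert_index_def ins_def)
    \<comment> \<open>This product depends only on the set of the remaining variables, not on their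
      order.\<close>
    have 2: "(\<Prod>s<m. g (z (ins i (\<tau> s))) (z i)) = (\<Prod>s<m. g (z (ins i s)) (z i))" if "\<tau> permutes {..<m}" for i \<tau>
      using prod.permute[OF that, of "\<lambda>s. g (z (ins i s)) (z i)"] by (simp add: o_def)
    have 3: "pairprod (\<lambda>s t. g (z (permutation_insert m i \<tau> s)) (z (permutation_insert m i \<tau> t))) m =
       pairprod (\<lambda>s t. g (z (ins i (\<tau> s))) (z (ins i (\<tau> t)))) m" for i \<tau>
      by (intro pairprod_cong) (simp add: 1)
    have 4: "serre_sum q q' m (\<lambda>s. q' * u (permutation_insert m i \<tau> s)) (\<lambda>s. v (permutation_insert m i \<tau> s)) =
       serre_sum q q' m (\<lambda>s. q' * u (ins i (\<tau> s))) (\<lambda>s. v (ins i (\<tau> s)))" for i \<tau>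
      unfolding serre_sum_def by (intro sum.cong refl arg_cong2[where f = "(*)"] prod.cong) (auto simp: 1)
    show ?thesis
      by (subst sum_permutes_Suc[of m]) (auto intro!: sum.cong simp: 3 4 1 2 mult_ac)
  qed
  also have "(\<Sum>\<sigma> | \<sigma> permutes {..<Suc m}. (\<Prod>t<m. g (z (\<sigma> 0)) (z (\<sigma> (Suc t)))) * pairprod (\<lambda>s t. g (z (\<sigma> (Suc s))) (z (\<sigma> (Suc t)))) m *
        (q ^ m * u (\<sigma> 0) * serre_sum q q' m (\<lambda>s. q' * u (\<sigma> (Suc s))) (\<lambda>s. v (\<sigma> (Suc s))))) =
     (\<Sum>i<Suc m. \<Sum>\<tau> | \<tau> permutes {..<m}. (\<Prod>s<m. g (z i) (z (ins i s))) * (q ^ m * u i) *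
        (pairprod (\<lambda>s t. g (z (ins i (\<tau> s))) (z (ins i (\<tau> t)))) m *
        serre_sum q q' m (\<lambda>s. q' * u (ins i (\<tau> s))) (\<lambda>s. v (ins i (\<tau> s)))))"
  proof -
    have 1: "permutation_insert 0 i \<tau> (Suc s) = ins i (\<tau> s)" for i \<tau> s
      by (simp add: permutation_insert_expand insert_index_def ins_def)
    have 2: "(\<Prod>s<m. g (z i) (z (ins i (\<tau> s)))) = (\<Prod>s<m. g (z i) (z (ins i s)))" if "\<tau> permutes {..<m}" for i \<tau>
      using prod.permute[OF that, of "\<lambda>s. g (z i) (z (ins i s))"] by (simp add: o_def)
    show ?thesis
      by (subst sum_permutes_Suc[of 0]) (auto intro!: sum.cong simp: 1 2 mult_ac)
  qed
  also have "(\<Sum>i<Suc m. \<Sum>\<tau> | \<tau> permutes {..<m}. (\<Prod>s<m. g (z (ins i s)) (z i)) * v i *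
        (pairprod (\<lambda>s t. g (z (ins i (\<tau> s))) (z (ins i (\<tau> t)))) m *
        serre_sum q q' m (\<lambda>s. q' * u (ins i (\<tau> s))) (\<lambda>s. v (ins i (\<tau> s))))) - 
     (\<Sum>i<Suc m. \<Sum>\<tau> | \<tau> permutes {..<m}. (\<Prod>s<m. g (z i) (z (ins i s))) * (q ^ m * u i) *
        (pairprod (\<lambda>s t. g (z (ins i (\<tau> s))) (z (ins i (\<tau> t)))) m *
        serre_sum q q' m (\<lambda>s. q' * u (ins i (\<tau> s))) (\<lambda>s. v (ins i (\<tau> s))))) =
     (\<Sum>i<Suc m. ((\<Prod>s<m. g (z (ins i s)) (z i)) * v i - (\<Prod>s<m. g (z i) (z (ins i s))) * (q ^ m * u i)) * (?V' i * ?pf * ?D i))"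
    unfolding sum_subtractf[symmetric] sum_distrib_left[symmetric]
    by (intro sum.cong refl) (simp add: IH left_diff_distrib)
  also have "\<dots> = (\<Sum>i<Suc m. ?V * ?pf * ((\<Sum>l\<le>Suc m. coeff P l * (\<Sum>n<l. (q'\<^sup>2) ^ n) * (z i ^ (l - 1) * (v i - q ^ m * q' ^ (2 * (Suc m - l)) * u i))) * cofactor ?A i 0))"
  proof (intro sum.cong refl)
    fix i assume "i \<in> {..<Suc m}"
    then have i: "i < Suc m" by simp
    let ?d = "\<Prod>j<m. z i - z (ins i j)"
    \<comment> \<open>Both linear factors of \<open>g\<close> change sign, so the signs
      cancel.\<close>
    have "(\<Prod>s<m. g (z (ins i s)) (z i)) = (\<Prod>s<m. (z i - z (ins i s)) * (q'\<^sup>2 * z i - z (ins i s)))"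
      by (intro prod.cong) (simp_all add: g_def algebra_simps)
    then have 1: "(\<Prod>s<m. g (z (ins i s)) (z i)) = ?d * (\<Prod>j<m. q'\<^sup>2 * z i - z (ins i j))" by (simp add: prod.distrib)
    have 2: "(\<Prod>s<m. g (z i) (z (ins i s))) = ?d * (\<Prod>j<m. z i - q'\<^sup>2 * z (ins i j))"
      by (simp add: prod.distrib g_def)
    have 3: "?V = (- 1) ^ i * ?d * ?V' i" unfolding ins_def by (rule vandermonde_insert_index[OF i])
    have "((\<Prod>s<m. g (z (ins i s)) (z i)) * v i - (\<Prod>s<m. g (z i) (z (ins i s))) * (q ^ m * u i)) =
      ?d * ((\<Prod>j<m. q'\<^sup>2 * z i - z (ins i j)) * v i - q ^ m * (\<Prod>j<m. z i - q'\<^sup>2 * z (ins i j)) * u i)"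
      unfolding 1 2 by (simp add: algebra_simps)
    also have "\<dots> = ?d * (\<Sum>l\<le>Suc m. coeff P l * (\<Sum>n<l. (q'\<^sup>2) ^ n) * (z i ^ (l - 1) * (v i - q ^ m * q' ^ (2 * (Suc m - l)) * u i)))"
      unfolding ins_def P_def by (subst serre_bracket[OF q i]) (rule refl)
    finally have 4: "((\<Prod>s<m. g (z (ins i s)) (z i)) * v i - (\<Prod>s<m. g (z i) (z (ins i s))) * (q ^ m * u i)) = 
       ?d * (\<Sum>l\<le>Suc m. coeff P l * (\<Sum>n<l. (q'\<^sup>2) ^ n) * (z i ^ (l - 1) * (v i - q ^ m * q' ^ (2 * (Suc m - l)) * u i)))" .
    have "?V * (- 1) ^ i = ?d * ?V' i * ((-1) ^ i * (-1) ^ i)" by (simp add: 3 mult_ac)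
    then have 5: "?d * ?V' i = ?V * (- 1) ^ i" by (simp flip: power_mult_distrib)
    show "((\<Prod>s<m. g (z (ins i s)) (z i)) * v i - (\<Prod>s<m. g (z i) (z (ins i s))) * (q ^ m * u i)) * (?V' i * ?pf * ?D i) = 
       ?V * ?pf * ((\<Sum>l\<le>Suc m. coeff P l * (\<Sum>n<l. (q'\<^sup>2) ^ n) * (z i ^ (l - 1) * (v i - q ^ m * q' ^ (2 * (Suc m - l)) * u i))) * cofactor ?A i 0)"
      unfolding 4 cofactor_def using swap[OF 5] by simp
  qed
  also have "\<dots> = ?V * ?pf * (\<Sum>l\<le>Suc m. coeff P l * (\<Sum>n<l. (q'\<^sup>2) ^ n) *
      (\<Sum>i<Suc m. z i ^ (l - 1) * (v i - q ^ m * q' ^ (2 * (Suc m - l)) * u i) * cofactor ?A i 0))"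
    unfolding sum_distrib_left[symmetric] sum_distrib_right
    by (subst sum.swap) (simp only: sum_distrib_left mult.assoc)
  also have "(\<Sum>l\<le>Suc m. coeff P l * (\<Sum>n<l. (q'\<^sup>2) ^ n) *
      (\<Sum>i<Suc m. z i ^ (l - 1) * (v i - q ^ m * q' ^ (2 * (Suc m - l)) * u i) * cofactor ?A i 0)) =
      (\<Sum>l\<le>Suc m. if l = Suc m then (\<Sum>n<l. (q'\<^sup>2) ^ n) * det ?A else 0)"
  proof (intro sum.cong refl)
    fix l assume l: "l \<in> {..Suc m}"
    show "coeff P l * (\<Sum>n<l. (q'\<^sup>2) ^ n) *
      (\<Sum>i<Suc m. z i ^ (l - 1) * (v i - q ^ m * q' ^ (2 * (Suc m - l)) * u i) * cofactor ?A i 0) =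
      (if l = Suc m then (\<Sum>n<l. (q'\<^sup>2) ^ n) * det ?A else 0)"
    proof (cases l)
      case (Suc l')
      then have k: "Suc m - l < Suc m" and e: "m - (Suc m - l) = l - 1" using l by auto
      have "(\<Sum>i<Suc m. z i ^ (l - 1) * (v i - q ^ m * q' ^ (2 * (Suc m - l)) * u i) * cofactor ?A i 0) =
         (\<Sum>i<Suc m. ?A $$ (i, Suc m - l) * cofactor ?A i 0)"
        using k e by (intro sum.cong refl) (simp add: serre_mat_def)
      then show ?thesis using cofactor_col_orthogonal[OF A k] l lead_coeff_prod_linear[of z "Suc m"]
        by (auto simp: P_def)
    qed simp
  qed
  also have "\<dots> = (\<Sum>n<Suc m. (q'\<^sup>2) ^ n) * det ?A" by simp
  finally show ?case unfolding g_def by (simp add: mult_ac)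
qed

section \<open>Contraction series\<close>

text \<open>The contraction of E_+(i,z) with E_-(j,w) is the exponential of the sum of
  \<open>- Q^(-n) [a n] / (n [n]) (w/z)^n\<close> with \<open>a = A i j\<close>; this is the
  derivative of that exponent in \<open>w/z\<close>.\<close>

definition contr_log_deriv :: "complex \<Rightarrow> int \<Rightarrow> complex fps" where
  "contr_log_deriv Q a =
     Abs_fps (\<lambda>n. - (Q powi (- int (Suc n)) * qnum Q (a * int (Suc n)) / qnum Q (int (Suc n))))"

definition contr :: "complex \<Rightarrow> int \<Rightarrow> complex fps" where
  "contr Q a = fps_exp 1 oo fps_integral0 (contr_log_deriv Q a)"

lemma contr_nth_0: "fps_nth (contr Q a) 0 = 1"
  by (simp add: contr_def)

lemma fps_deriv_contr: "fps_deriv (contr Q a) = contr Q a * contr_log_deriv Q a"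
  by (simp add: contr_def fps_compose_deriv fps_deriv_fps_integral)

text \<open>The factors \<open>n\<close> and \<open>1/n\<close> are left uncancelled so that the
  summand has the shape of the one in \<open>expo_rec\<close>; \<open>ep_em\<close> compares the two
  recursions.\<close>

lemma contr_rec:
  "of_nat k * (fps_nth (contr Q a) k) = (\<Sum>n=1..k. of_nat n *
     (- (Q powi (- int n) * qnum Q (a * int n) / qnum Q (int n)) / of_nat n) * (fps_nth (contr Q a) (k - n)))"
proof (cases k)
  case (Suc l)
  have "of_nat k * (fps_nth (contr Q a) k) = fps_nth (fps_deriv (contr Q a)) l" by (simp add: Suc)
  also have "\<dots> = (\<Sum>i=0..l. fps_nth (contr_log_deriv Q a) i * fps_nth (contr Q a) (l - i))"
    by (subst fps_deriv_contr, subst mult.commute) (rule fps_mult_nth)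
  also have "\<dots> = (\<Sum>n=1..k. - (Q powi (- int n) * qnum Q (a * int n) / qnum Q (int n)) * (fps_nth (contr Q a) (k - n)))"
    unfolding Suc One_nat_def sum.shift_bounds_cl_Suc_ivl
    by (intro sum.cong refl) (simp add: contr_log_deriv_def)
  also have "\<dots> = (\<Sum>n=1..k. of_nat n *
     (- (Q powi (- int n) * qnum Q (a * int n) / qnum Q (int n)) / of_nat n) * (fps_nth (contr Q a) (k - n)))"
    by (intro sum.cong refl) auto
  finally show ?thesis .
qed simp

text \<open>The equation \<open>f' = f H\<close> determines each coefficient from the earlier ones,
  since positive integers are invertible.\<close>

lemma fps_eq_if_log_deriv_eq:
  fixes f g H :: "'a::field_char_0 fps"
  assumes "fps_deriv f = f * H" "fps_deriv g = g * H" "fps_nth f 0 = fps_nth g 0"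
  shows "f = g"
proof (rule fps_ext)
  fix n show "fps_nth f n = fps_nth g n"
  proof (induction n rule: less_induct)
    case (less n)
    show ?case
    proof (cases n)
      case (Suc k)
      have "of_nat n * fps_nth f n = fps_nth (f * H) k" "of_nat n * fps_nth g n = fps_nth (g * H) k"
        by (simp_all add: Suc flip: assms)
      moreover have "fps_nth (f * H) k = fps_nth (g * H) k"
        unfolding fps_mult_nth using less Suc by (intro sum.cong) auto
      ultimately have "of_nat n * fps_nth f n = of_nat n * fps_nth g n" by simp
      then show ?thesis by (simp add: Suc del: of_nat_Suc)
    qed (use assms in simp)
  qed
qed

lemma fps_nth_0_prod_linear: "fps_nth (\<Prod>j<(a::nat). 1 - fps_const (r j) * fps_X) 0 = (1 :: 'a::comm_ring_1)"
  by (induction a) simp_all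

text \<open>Logarithmic derivatives add, and that of \<open>1 - r X\<close> is
  \<open>- r / (1 - r X)\<close>, a geometric series.\<close>

lemma fps_deriv_prod_linear:
  fixes r :: "nat \<Rightarrow> 'a::field_char_0"
  shows "fps_deriv (\<Prod>j<a. 1 - fps_const (r j) * fps_X) =
    - (\<Sum>j<a. Abs_fps (\<lambda>n. r j ^ Suc n)) * (\<Prod>j<a. 1 - fps_const (r j) * fps_X)"
proof (induction a)
  case (Suc a)
  let ?A = "Abs_fps (\<lambda>n. r a ^ Suc n)" and ?L = "1 - fps_const (r a) * fps_X"
  let ?P = "\<Prod>j<a. 1 - fps_const (r j) * fps_X" and ?S = "\<Sum>j<a. Abs_fps (\<lambda>n. r j ^ Suc n)"
  have "?A * ?L = ?A - fps_const (r a) * ?A * fps_X" by (simp add: algebra_simps)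
  also have "\<dots> = fps_const (r a)"
  proof (rule fps_ext)
    fix n show "fps_nth (?A - fps_const (r a) * ?A * fps_X) n = fps_nth (fps_const (r a)) n"
      by (cases n) (simp_all del: power_Suc, simp)
  qed
  finally have AL: "?A * ?L = fps_const (r a)" .
  have c: "fps_const (- r a) = - fps_const (r a)" by simp
  have "fps_deriv (?P * ?L) = fps_deriv ?P * ?L + ?P * fps_const (- r a)" by simp
  also have "\<dots> = - ?S * ?P * ?L - ?P * fps_const (r a)"
    unfolding Suc.IH c by (simp del: fps_const_neg)
  also have "\<dots> = - ?S * ?P * ?L - ?P * (?A * ?L)" by (simp only: AL)
  also have "\<dots> = - (?S + ?A) * (?P * ?L)"
  proof -
    have "- S * P * L - P * (A * L) = - (S + A) * (P * L)" for S P L A :: "'a fps"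
      by (simp add: algebra_simps)
    then show ?thesis .
  qed
  finally show ?case by simp
qed simp

section \<open>Quantum numbers and closed forms of the contraction series\<close>

context
  fixes q :: complex
  assumes q0: "q \<noteq> 0" and nonroot: "\<And>n::nat. n > 0 \<Longrightarrow> q ^ n \<noteq> 1"
begin

lemma q_minus_inverse_nonzero: "q - inverse q \<noteq> 0"
  using nonroot[of 2] q0 by (auto simp: power2_eq_square) (metis left_inverse)

lemma qnum_nonzero: "n > 0 \<Longrightarrow> qnum q (int n) \<noteq> 0"
proof
  assume n: "n > 0" and "qnum q (int n) = 0"
  then have "q ^ n = inverse (q ^ n)"
    using q_minus_inverse_nonzero by (simp add: qnum_def power_int_minus)
  then have "q ^ (2 * n) = 1" using q0
    by (metis left_inverse mult_2 power_add power_not_zero)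
  then show False using nonroot[of "2 * n"] n by simp
qed

text \<open>Multiplication by \<open>q^n - q^(-n)\<close> makes the sum telescope.\<close>

lemma qnum_mult_ratio: "n > 0 \<Longrightarrow> qnum q (int a * int n) / qnum q (int n) = (\<Sum>j<a. q powi ((int a - 1 - 2 * int j) * int n))"
proof -
  assume n: "n > 0"
  define f where "f = (\<lambda>j::nat. q powi ((int a - 2 * int j) * int n))"
  have "(q powi int n - q powi (- int n)) * q powi ((int a - 1 - 2 * int j) * int n) = f j - f (Suc j)" for j
  proof -
    let ?e = "(int a - 1 - 2 * int j) * int n"
    have "q powi int n * q powi ?e = q powi (int n + ?e)" "q powi (- int n) * q powi ?e = q powi (- int n + ?e)"
      using q0 by (simp_all only: power_int_add simp_thms)
    moreover have "int n + ?e = (int a - 2 * int j) * int n" "- int n + ?e = (int a - 2 * int (Suc j)) * int n"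
      by (simp_all add: algebra_simps)
    ultimately show ?thesis by (simp only: left_diff_distrib f_def)
  qed
  then have "(q powi int n - q powi (- int n)) * (\<Sum>j<a. q powi ((int a - 1 - 2 * int j) * int n)) = f 0 - f a"
    by (simp add: sum_distrib_left sum_lessThan_telescope')
  also have "\<dots> = q powi (int a * int n) - q powi (- (int a * int n))" by (simp add: f_def)
  finally have "qnum q (int a * int n) = qnum q (int n) * (\<Sum>j<a. q powi ((int a - 1 - 2 * int j) * int n))"
    by (simp add: qnum_def)
  then show ?thesis using qnum_nonzero[OF n] by simp
qed

lemma qnum_uminus: "qnum q (- k) = - qnum q k"
  by (simp add: qnum_def minus_divide_left)

lemma contr_log_deriv_neg:
  "contr_log_deriv q (- int a) = (\<Sum>j<a. Abs_fps (\<lambda>n. (q powi (int a - 2 - 2 * int j)) ^ Suc n))"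
proof (rule fps_ext)
  fix n
  have e: "q powi (- int (Suc n)) * q powi ((int a - 1 - 2 * int j) * int (Suc n)) = (q powi (int a - 2 - 2 * int j)) ^ Suc n" for j
  proof -
    have "(q powi (int a - 2 - 2 * int j)) ^ Suc n = q powi ((int a - 2 - 2 * int j) * int (Suc n))"
      by (rule power_int_power')
    also have "(int a - 2 - 2 * int j) * int (Suc n) = - int (Suc n) + (int a - 1 - 2 * int j) * int (Suc n)"
      by (simp add: algebra_simps)
    finally show ?thesis using q0 by (simp only: power_int_add simp_thms)
  qed
  have "fps_nth (contr_log_deriv q (- int a)) n = q powi (- int (Suc n)) * (qnum q (int a * int (Suc n)) / qnum q (int (Suc n)))"
    by (simp add: contr_log_deriv_def qnum_uminus del: of_nat_Suc)
  also have "\<dots> = (\<Sum>j<a. (q powi (int a - 2 - 2 * int j)) ^ Suc n)"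
    unfolding qnum_mult_ratio[OF zero_less_Suc] sum_distrib_left e ..
  finally show "fps_nth (contr_log_deriv q (- int a)) n = fps_nth (\<Sum>j<a. Abs_fps (\<lambda>n. (q powi (int a - 2 - 2 * int j)) ^ Suc n)) n"
    by (simp add: fps_sum_nth)
qed

lemma contr_log_deriv_pos:
  "contr_log_deriv q (int a) = - (\<Sum>j<a. Abs_fps (\<lambda>n. (q powi (int a - 2 - 2 * int j)) ^ Suc n))"
  by (subst contr_log_deriv_neg[symmetric]) (rule fps_ext, simp add: contr_log_deriv_def qnum_uminus)

text \<open>The two logarithmic derivatives cancel, so the product is constant; uniqueness is
  applied with \<open>H = 0\<close>.\<close>

lemma contr_neg: "contr q (- int a) * (\<Prod>j<a. 1 - fps_const (q powi (int a - 2 - 2 * int j)) * fps_X) = 1"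
  (is "?C * ?P = 1")
proof (rule fps_eq_if_log_deriv_eq)
  show "fps_deriv (?C * ?P) = ?C * ?P * 0"
    by (simp add: fps_deriv_contr fps_deriv_prod_linear contr_log_deriv_neg)
qed (simp_all add: contr_nth_0 fps_nth_0_prod_linear)

lemma contr_pos: "contr q (int a) = (\<Prod>j<a. 1 - fps_const (q powi (int a - 2 - 2 * int j)) * fps_X)"
  (is "_ = ?P")
proof (rule fps_eq_if_log_deriv_eq[OF fps_deriv_contr])
  show "fps_deriv ?P = ?P * contr_log_deriv q (int a)"
    unfolding contr_log_deriv_pos fps_deriv_prod_linear by (rule mult.commute)
qed (simp_all add: contr_nth_0 fps_nth_0_prod_linear)

lemma contr_2_nth: "fps_nth (contr q 2) k = (if k = 0 then 1 else if k = 1 then - (1 + (inverse q)\<^sup>2) else if k = 2 then (inverse q)\<^sup>2 else 0)"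
proof -
  have "contr q 2 = (1 - fps_X) * (1 - fps_const ((inverse q)\<^sup>2) * fps_X)"
    using contr_pos[of 2] by (simp add: numeral_2_eq_2 power_int_minus power_inverse)
  also have "\<dots> = 1 - fps_const (1 + (inverse q)\<^sup>2) * fps_X + fps_const ((inverse q)\<^sup>2) * fps_X\<^sup>2"
    by (simp add: algebra_simps power2_eq_square flip: fps_const_add)
  finally show ?thesis by (simp add: fps_X_power_iff fps_X_nth)
qed

text \<open>The free constant \<open>c\<close> carries the induction: without the first factor, the
  product is the one for \<open>a\<close> with \<open>c\<close> divided by \<open>q\<close>.\<close>

lemma qbinomial_theorem:
  "(\<Prod>j<a. 1 - fps_const (c * q powi (int a - 2 - 2 * int j)) * fps_X) =
    Abs_fps (\<lambda>l. (- c) ^ l * qb q (inverse q) a l * inverse q ^ l)"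
proof (induction a arbitrary: c)
  case 0
  show ?case by (rule fps_ext, case_tac n) auto
next
  case (Suc a)
  have e0: "c * q powi (int (Suc a) - 2 - 2 * int (Suc j)) = c * inverse q * q powi (int a - 2 - 2 * int j)" for j
  proof -
    have "int (Suc a) - 2 - 2 * int (Suc j) = - 1 + (int a - 2 - 2 * int j)" by simp
    then show ?thesis using q0 by (simp only: power_int_add simp_thms mult.assoc power_int_minus power_int_1_right)
  qed
  have "(\<Prod>j<Suc a. 1 - fps_const (c * q powi (int (Suc a) - 2 - 2 * int j)) * fps_X) =
     (1 - fps_const (c * q powi (int a - 1)) * fps_X) * Abs_fps (\<lambda>l. (- (c * inverse q)) ^ l * qb q (inverse q) a l * inverse q ^ l)"
    unfolding Suc.IH[symmetric] prod.lessThan_Suc_shift e0 by simp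
  also have "\<dots> = Abs_fps (\<lambda>l. (- c) ^ l * qb q (inverse q) (Suc a) l * inverse q ^ l)"
  proof (rule fps_ext)
    fix n
    show "fps_nth ((1 - fps_const (c * q powi (int a - 1)) * fps_X) * Abs_fps (\<lambda>l. (- (c * inverse q)) ^ l * qb q (inverse q) a l * inverse q ^ l)) n
      = fps_nth (Abs_fps (\<lambda>l. (- c) ^ l * qb q (inverse q) (Suc a) l * inverse q ^ l)) n"
    proof (cases n)
      case (Suc l)
      \<comment> \<open>For \<open>l > a\<close> the difference \<open>a - l\<close> is truncated,
        but then \<open>qb\<close> vanishes.\<close>
      have e: "q powi (int a - 1) * qb q (inverse q) a l = q ^ (a - l) * q ^ l * inverse q * qb q (inverse q) a l"
      proof (cases "l \<le> a")
        case True
        then have "q ^ (a - l) * q ^ l = q ^ a" by (simp flip: power_add)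
        moreover have "q powi (int a - 1) = q ^ a * inverse q" using q0 by (simp add: power_int_diff divide_inverse)
        ultimately show ?thesis by simp
      qed (simp add: qb_eq_0)
      have qq: "q ^ l * inverse q ^ l = 1" using q0 by (simp add: power_inverse)
      have c: "(- (c * inverse q)) ^ k = (- c) ^ k * inverse q ^ k" for k
        by (metis mult_minus_left power_mult_distrib)
      have "fps_nth (((1 - fps_const (c * q powi (int a - 1)) * fps_X) * Abs_fps (\<lambda>l. (- (c * inverse q)) ^ l * qb q (inverse q) a l * inverse q ^ l))) n
        = (- (c * inverse q)) ^ n * qb q (inverse q) a n * inverse q ^ n
          - c * (q powi (int a - 1) * qb q (inverse q) a l) * (- (c * inverse q)) ^ l * inverse q ^ l"
        by (simp add: left_diff_distrib mult.assoc fps_X_mult_nth Suc del: power_Suc)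
      also have "\<dots> = (- c) ^ n * inverse q ^ n * (inverse q ^ n * qb q (inverse q) a n + q ^ (a - l) * (q ^ l * inverse q ^ l) * qb q (inverse q) a l)"
        unfolding e c by (simp add: Suc algebra_simps)
      also have "\<dots> = (- c) ^ n * qb q (inverse q) (Suc a) n * inverse q ^ n"
        unfolding qq by (simp add: Suc)
      finally show ?thesis by simp
    qed simp
  qed
  finally show ?case .
qed

lemma contr_neg_qb:
  "contr q (- int a) * Abs_fps (\<lambda>l. (- 1) ^ l * qb q (inverse q) a l * inverse q ^ l) = 1"
  using contr_neg[of a] qbinomial_theorem[of 1 a] by simp

lemma qfact_nonzero: "qfact q n \<noteq> 0"
  by (simp add: qfact_def qnum_nonzero)

lemma qfact_Suc: "qfact q (Suc n) = qfact q n * qnum q (int (Suc n))"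
  by (simp add: qfact_def)

lemma qbinom_eq_qb: "r \<le> m \<Longrightarrow> qbinom q m r = qb q (inverse q) m r"
proof (induction m arbitrary: r)
  case 0 then show ?case by (simp add: qbinom_def qfact_def)
next
  case (Suc m)
  show ?case
  proof (cases r)
    case 0 then show ?thesis using qfact_nonzero by (simp add: qbinom_def, simp add: qfact_def)
  next
    case r: (Suc s)
    show ?thesis
    proof (cases "s = m")
      \<comment> \<open>Treated apart because the factorial formula does not give 0 for
        \<open>qbinom q m (Suc m)\<close>: the difference \<open>m - Suc m\<close> is
        truncated.\<close>
      case True
      have "qbinom q (Suc m) (Suc m) = 1" "qbinom q m m = 1"
        using qfact_nonzero by (simp_all add: qbinom_def) (simp_all add: qfact_def)
      then show ?thesis using True r Suc.IH[of m] by (simp add: qb_eq_0)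
    next
      case False
      then have s: "s < m" using Suc.prems r by simp
      have p: "qnum q (int (Suc m)) = inverse q ^ Suc s * qnum q (int (m - s)) + q ^ (m - s) * qnum q (int (Suc s))"
      proof -
        have 1: "inverse q ^ Suc s = q powi (- int (Suc s))" "q ^ (m - s) = q powi (int m - int s)"
          using s by (simp_all only: power_int_minus power_inverse power_int_of_nat of_nat_diff[symmetric] less_imp_le)
        have add: "q powi x * q powi y = q powi (x + y)" for x y
          using q0 by (simp add: power_int_add)
        have "q powi int (Suc m) - q powi (- int (Suc m)) =
            q powi (- int (Suc s)) * (q powi int (m - s) - q powi (- int (m - s))) +
            q powi (int m - int s) * (q powi int (Suc s) - q powi (- int (Suc s)))"
          using s by (simp add: right_diff_distrib add of_nat_diff algebra_simps)
        then show ?thesis unfolding qnum_def 1 by (simp only: add_divide_distrib times_divide_eq_right)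
      qed
      have ms: "m - s = Suc (m - Suc s)" using s by simp
      have "qbinom q (Suc m) (Suc s) = qfact q m * qnum q (int (Suc m)) / (qfact q (Suc s) * qfact q (m - s))"
        by (simp add: qbinom_def qfact_Suc)
      also have "\<dots> = inverse q ^ Suc s * (qfact q m / (qfact q (Suc s) * (qfact q (m - s) / qnum q (int (m - s)))))
          + q ^ (m - s) * (qfact q m / ((qfact q (Suc s) / qnum q (int (Suc s))) * qfact q (m - s)))"
        unfolding p by (simp add: add_divide_distrib algebra_simps del: power_Suc of_nat_Suc)
      also have "qfact q (m - s) / qnum q (int (m - s)) = qfact q (m - Suc s)"
        unfolding ms qfact_Suc using qnum_nonzero[of "Suc (m - Suc s)"] by simp
      also have "qfact q (Suc s) / qnum q (int (Suc s)) = qfact q s"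
        unfolding qfact_Suc using qnum_nonzero[of "Suc s"] by simp
      finally have "qbinom q (Suc m) (Suc s) = inverse q ^ Suc s * qbinom q m (Suc s) + q ^ (m - s) * qbinom q m s"
        by (simp add: qbinom_def)
      then show ?thesis using Suc.IH[of s] Suc.IH[of "Suc s"] s r by simp
    qed
  qed
qed

end

text \<open>Both signs of the vertex operators can therefore share the quantum numbers of
  \<open>q\<close>.\<close>

lemma qnum_inverse: "qnum (inverse q) k = qnum q k"
proof -
  have "inverse q powi k - inverse q powi (- k) = - (q powi k - q powi (- k))"
    by (simp add: power_int_inverse power_int_minus)
  moreover have "inverse q - inverse (inverse q) = - (q - inverse q)" by simp
  ultimately show ?thesis unfolding qnum_def by (simp only: minus_divide_divide)
qed

lemma qbinom_inverse: "qbinom (inverse q) m r = qbinom q m r"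
  by (simp add: qbinom_def qfact_def qnum_inverse)

section \<open>Exponentials of derivations\<close>

lemma poly_mapping_single_induct [case_names single add]:
  assumes "\<And>x c. P (Poly_Mapping.single x c)"
    and "\<And>f g. P f \<Longrightarrow> P g \<Longrightarrow> P (f + g)"
  shows "P f"
proof (induction f rule: update_induct)
  case const
  show ?case using assms(1)[of undefined 0] by simp
next
  case (update f a b)
  have "Poly_Mapping.update a b f = Poly_Mapping.single a b + f"
    using update(1) by (intro poly_mapping_eqI)
      (auto simp: lookup_update lookup_add lookup_single in_keys_iff when_def)
  then show ?case using assms update by simp
qed

lemma sc_0 [simp]: "sc 0 = 0" and sc_1 [simp]: "sc 1 = 1"
  by (simp_all add: sc_def)

lemma sc_add: "sc (a + b) = sc a + sc b"
  by (simp add: sc_def single_add)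

lemma sc_mult: "sc (a * b) = sc a * sc b"
  by (simp add: sc_def mult_single)

lemma sc_uminus: "sc (- a) = - sc a"
  by (simp add: sc_def single_uminus)

lemma sc_sum: "sc (sum f X) = (\<Sum>x\<in>X. sc (f x))"
  by (induction X rule: infinite_finite_induct) (simp_all add: sc_add)

lemma sc_cancel: "c \<noteq> 0 \<Longrightarrow> sc c * x = sc c * y \<longleftrightarrow> x = y"
proof
  assume c: "c \<noteq> 0" and "sc c * x = sc c * y"
  then have "sc (inverse c) * (sc c * x) = sc (inverse c) * (sc c * y)" by simp
  then show "x = y" using c by (simp flip: mult.assoc sc_mult)
qed simp

lemma length_comps_le: "ns \<in> comps k \<Longrightarrow> length ns \<le> k"
proof -
  have "length ns \<le> sum_list ns" if "\<forall>x\<in>set ns. 0 < x" for ns :: "nat list"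
    using that by (induction ns) auto
  then show "ns \<in> comps k \<Longrightarrow> length ns \<le> k" by (auto simp: comps_def)
qed

lemma finite_comps: "finite (comps k)"
proof (rule finite_subset)
  show "comps k \<subseteq> {ns. set ns \<subseteq> {..k} \<and> length ns \<le> k}"
    using length_comps_le by (auto simp: comps_def dest: member_le_sum_list)
qed (rule finite_lists_length_le, simp)

lemma comps_0: "comps 0 = {[]}"
  by (auto simp: comps_def) (metis list.set_intros(1) neq_Nil_conv not_less0)

lemma comps_pos: "k > 0 \<Longrightarrow> comps k = (\<lambda>(n, ns). n # ns) ` (SIGMA n:{1..k}. comps (k - n))"
proof (intro equalityI subsetI)
  fix ns assume k: "k > 0" and ns: "ns \<in> comps k"
  then obtain n ms where "ns = n # ms" by (cases ns) (auto simp: comps_def)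
  with ns show "ns \<in> (\<lambda>(n, ns). n # ns) ` (SIGMA n:{1..k}. comps (k - n))"
    by (auto simp: comps_def intro!: image_eqI[of _ _ "(n, ms)"])
qed (auto simp: comps_def)

lemma mset_rotate: "mset (rotate l xs) = mset xs"
  by (simp add: rotate_drop_take) (metis append_take_drop_id mset_append union_commute)

lemma sum_comps_rotate:
  fixes g :: "nat list \<Rightarrow> 'a::comm_monoid_add"
  shows "(\<Sum>ns\<in>comps k. g (rotate l ns)) = (\<Sum>ns\<in>comps k. g ns)"
proof -
  have inj: "inj_on (rotate l) (comps k)"
    by (auto simp: inj_on_def rotate_def inj_rotate1 intro: injD[OF inj_fn[OF inj_rotate1]] dest!: injD[OF inj_fn[OF inj_rotate1]])
  have "sum_list (rotate l ns) = sum_list ns" for ns :: "nat list"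
    by (metis mset_rotate sum_mset_sum_list)
  then have "rotate l ` comps k \<subseteq> comps k" by (auto simp: comps_def)
  then have "rotate l ` comps k = comps k" by (rule endo_inj_surj[OF finite_comps _ inj])
  then show ?thesis using sum.reindex[OF inj, of g] by simp
qed

text \<open>The coefficient of \<open>z^b\<close> in the exponential of the series with coefficients
  \<open>G n\<close>. Derivations \<open>G n\<close> give E_+, multiplications give E_-, so one
  recursion serves both.\<close>

definition expo :: "(nat \<Rightarrow> 'n poly \<Rightarrow> 'n poly) \<Rightarrow> nat \<Rightarrow> 'n poly \<Rightarrow> 'n poly" where
  "expo G b u = (\<Sum>ns\<in>comps b. sc (1 / fact (length ns)) * foldr G ns u)"

locale commuting_ops =
  fixes G :: "nat \<Rightarrow> 'n poly \<Rightarrow> 'n poly"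
  assumes G_add: "G n (x + y) = G n x + G n y"
    and G_sc: "G n (sc c * x) = sc c * G n x"
    and G_comm: "G n (G m x) = G m (G n x)"
begin

lemma G_0: "G n 0 = 0"
  using G_sc[of n 0 0] by simp

lemma G_sum: "G n (sum f X) = (\<Sum>x\<in>X. G n (f x))"
  by (induction X rule: infinite_finite_induct) (simp_all add: G_add G_0)

lemma foldr_add: "foldr G ns (x + y) = foldr G ns x + foldr G ns y"
  by (induction ns) (simp_all add: G_add)

lemma foldr_sc: "foldr G ns (sc c * x) = sc c * foldr G ns x"
  by (induction ns) (simp_all add: G_sc)

lemma foldr_mset: "mset ns = mset ms \<Longrightarrow> foldr G ns u = foldr G ms u"
proof -
  assume "mset ns = mset ms"
  then have "fold G (rev ns) = fold G (rev ms)"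
    by (intro fold_multiset_equiv) (auto simp: fun_eq_iff G_comm)
  then show ?thesis by (simp add: foldr_conv_fold)
qed

lemma expo_0: "expo G 0 u = u"
  by (simp add: expo_def comps_0)

lemma expo_add: "expo G b (x + y) = expo G b x + expo G b y"
  by (simp add: expo_def foldr_add algebra_simps sum.distrib)

lemma expo_sc: "expo G b (sc c * x) = sc c * expo G b x"
  by (simp add: expo_def foldr_sc sum_distrib_left mult.left_commute)

lemma expo_zero: "expo G b 0 = 0"
  using expo_sc[of b 0 0] by simp

lemma expo_sum: "expo G b (sum f X) = (\<Sum>x\<in>X. expo G b (f x))"
  by (induction X rule: infinite_finite_induct) (simp_all add: expo_add expo_zero)

lemma expo_commute:
  assumes add: "\<And>x y. H (x + y) = H x + H y" and hom: "\<And>c x. H (sc c * x) = sc c * H x"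
    and comm: "\<And>n x. H (G n x) = G n (H x)"
  shows "H (expo G b u) = expo G b (H u)"
proof -
  have "H 0 = 0" using hom[of 0 0] by simp
  then have sum: "H (sum f X) = (\<Sum>x\<in>X. H (f x))" for f and X :: "nat list set"
    by (induction X rule: infinite_finite_induct) (simp_all add: add)
  have "H (foldr G ns u) = foldr G ns (H u)" for ns by (induction ns) (simp_all add: comm)
  then show ?thesis by (simp add: expo_def sum hom)
qed

lemma G_expo: "G n (expo G b u) = expo G b (G n u)"
  by (rule expo_commute) (simp_all add: G_add G_sc G_comm)

text \<open>The coefficient form of \<open>z E'(z) = z g'(z) E(z)\<close> for \<open>E = exp g\<close>; rotating compositions
  replaces the sum of all parts by the length times the first part.\<close>
lemma expo_rec:
  "sc (of_nat b) * expo G b u = (\<Sum>n=1..b. sc (of_nat n) * G n (expo G (b - n) u))"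
proof (cases "b = 0")
  case False
  then have b: "b > 0" by simp
  define T where "T = (\<lambda>ns. foldr G ns u)"
  have T_rotate: "T (rotate l ns) = T ns" for l ns
    unfolding T_def by (rule foldr_mset) (rule mset_rotate)
  define g where "g = (\<lambda>l ns. if l < length ns then sc (of_nat (hd ns) / fact (length ns)) * T ns else 0)"
  have "sc (of_nat b) * expo G b u = (\<Sum>ns\<in>comps b. sc (of_nat (sum_list ns) / fact (length ns)) * T ns)"
    by (auto simp: expo_def T_def sum_distrib_left comps_def sc_mult[symmetric] mult.assoc[symmetric] intro!: sum.cong)
  also have "\<dots> = (\<Sum>ns\<in>comps b. \<Sum>l<b. g l (rotate l ns))"
  proof (intro sum.cong refl)
    fix ns assume ns: "ns \<in> comps b"
    have "of_nat (sum_list ns) / fact (length ns) = (\<Sum>l<length ns. of_nat (ns ! l) / fact (length ns) :: complex)"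
      by (simp add: sum_list_sum_nth atLeast0LessThan sum_divide_distrib)
    then have "sc (of_nat (sum_list ns) / fact (length ns)) * T ns = (\<Sum>l<length ns. sc (of_nat (ns ! l) / fact (length ns)) * T ns)"
      by (simp only: sc_sum sum_distrib_right)
    also have "\<dots> = (\<Sum>l<length ns. g l (rotate l ns))"
      proof (intro sum.cong refl)
      fix l assume l: "l \<in> {..<length ns}"
      then have "ns \<noteq> []" by auto
      from hd_rotate_conv_nth[OF this, of l] l
      show "sc (of_nat (ns ! l) / fact (length ns)) * T ns = g l (rotate l ns)"
        by (simp add: g_def T_rotate)
    qed
    also have "\<dots> = (\<Sum>l<b. g l (rotate l ns))"
      using length_comps_le[OF ns] by (intro sum.mono_neutral_left) (auto simp: g_def)
    finally show "sc (of_nat (sum_list ns) / fact (length ns)) * T ns = (\<Sum>l<b. g l (rotate l ns))" .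
  qed
  also have "\<dots> = (\<Sum>l<b. \<Sum>ns\<in>comps b. g l ns)"
    by (subst sum.swap) (simp only: sum_comps_rotate)
  also have "\<dots> = (\<Sum>ns\<in>comps b. \<Sum>l<b. g l ns)" by (rule sum.swap)
  also have "\<dots> = (\<Sum>ns\<in>comps b. sc (of_nat (hd ns) / fact (length ns - 1)) * T ns)"
  proof (intro sum.cong refl)
    fix ns assume ns: "ns \<in> comps b"
    then have "ns \<noteq> []" using b by (auto simp: comps_def)
    then obtain N where N: "length ns = Suc N" by (cases ns) auto
    have "(\<Sum>l<b. g l ns) = (\<Sum>l<length ns. g l ns)"
      using length_comps_le[OF ns] by (intro sum.mono_neutral_right) (auto simp: g_def)
    also have "\<dots> = (\<Sum>l<length ns. sc (of_nat (hd ns) / fact (length ns))) * T ns"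
      unfolding sum_distrib_right by (intro sum.cong) (auto simp: g_def)
    also have "(\<Sum>l<length ns. sc (of_nat (hd ns) / fact (length ns))) = sc (of_nat (hd ns) / fact (length ns - 1))"
      unfolding sc_sum[symmetric] by (simp add: N del: of_nat_Suc)
    finally show "(\<Sum>l<b. g l ns) = sc (of_nat (hd ns) / fact (length ns - 1)) * T ns" .
  qed
  also have "\<dots> = (\<Sum>(n, ns)\<in>(SIGMA n:{1..b}. comps (b - n)). sc (of_nat n / fact (length ns)) * G n (T ns))"
    unfolding comps_pos[OF b] by (subst sum.reindex) (auto simp: inj_on_def T_def o_def split_beta)
  also have "\<dots> = (\<Sum>n=1..b. sc (of_nat n) * G n (expo G (b - n) u))"
    unfolding expo_def G_sum G_sc
    by (subst sum.Sigma[symmetric])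
       (auto simp: finite_comps T_def sum_distrib_left sc_mult[symmetric] mult.assoc[symmetric])
  finally show ?thesis .
qed simp

text \<open>Exponentials of derivations are multiplicative. By the recursion and the Leibniz rule,
  \<open>b\<close> times the left side is a sum in which the two factors carry the weights
  \<open>k\<close> and \<open>b - k\<close>; these add up to \<open>b\<close>, which is
  cancelled.\<close>

lemma expo_mult:
  assumes leibniz: "\<And>n x y. G n (x * y) = G n x * y + x * G n y"
  shows "expo G b (x * y) = (\<Sum>k\<le>b. expo G k x * expo G (b - k) y)"
proof (induction b rule: less_induct)
  case (less b)
  let ?E = "expo G"
  show ?case
  proof (cases "b = 0")
    case False
    let ?a = "\<lambda>n k. sc (of_nat n) * (G n (?E k x) * ?E (b - n - k) y)"
    let ?b = "\<lambda>n k. sc (of_nat n) * (?E k x * G n (?E (b - n - k) y))"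
    have "sc (of_nat b) * ?E b (x * y) = (\<Sum>n=1..b. sc (of_nat n) * G n (\<Sum>k\<le>b - n. ?E k x * ?E (b - n - k) y))"
      unfolding expo_rec using less by (intro sum.cong refl) auto
    also have "\<dots> = (\<Sum>n=1..b. \<Sum>k\<le>b - n. ?a n k + ?b n k)"
      by (intro sum.cong refl) (simp add: G_sum leibniz sum_distrib_left algebra_simps)
    also have "\<dots> = (\<Sum>n=1..b. \<Sum>k\<le>b - n. ?a n k) + (\<Sum>n=1..b. \<Sum>k\<le>b - n. ?b n k)"
      by (simp add: sum.distrib)
    also have "(\<Sum>n=1..b. \<Sum>k\<le>b - n. ?a n k) = (\<Sum>k\<le>b. \<Sum>n=1..k. ?a n (k - n))"
      unfolding sum.Sigma[OF finite_atLeastAtMost ballI[OF finite_atMost]] sum.Sigma[OF finite_atMost ballI[OF finite_atLeastAtMost]]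
      by (rule sum.reindex_bij_witness[of _ "\<lambda>(k, n). (n, k - n)" "\<lambda>(n, k). (n + k, n)"]) auto
    also have "\<dots> = (\<Sum>k\<le>b. (sc (of_nat k) * ?E k x) * ?E (b - k) y)"
      by (intro sum.cong refl) (simp add: expo_rec sum_distrib_right mult.assoc)
    also have "(\<Sum>n=1..b. \<Sum>k\<le>b - n. ?b n k) = (\<Sum>k\<le>b. \<Sum>n=1..b - k. ?b n k)"
      unfolding sum.Sigma[OF finite_atLeastAtMost ballI[OF finite_atMost]] sum.Sigma[OF finite_atMost ballI[OF finite_atLeastAtMost]]
      by (rule sum.reindex_bij_witness[of _ "\<lambda>(k, n). (n, k)" "\<lambda>(n, k). (k, n)"]) auto
    also have "\<dots> = (\<Sum>k\<le>b. ?E k x * (sc (of_nat (b - k)) * ?E (b - k) y))"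
      unfolding expo_rec by (intro sum.cong refl) (simp add: sum_distrib_left mult_ac diff_commute add.commute)
    also have "(\<Sum>k\<le>b. (sc (of_nat k) * ?E k x) * ?E (b - k) y) + (\<Sum>k\<le>b. ?E k x * (sc (of_nat (b - k)) * ?E (b - k) y))
       = (\<Sum>k\<le>b. sc (of_nat k + of_nat (b - k)) * (?E k x * ?E (b - k) y))"
      unfolding sum.distrib[symmetric] sc_add by (intro sum.cong refl) (simp only: distrib_right distrib_left mult.assoc mult.left_commute)
    also have "\<dots> = sc (of_nat b) * (\<Sum>k\<le>b. ?E k x * ?E (b - k) y)"
      unfolding sum_distrib_left by (intro sum.cong refl) (simp flip: of_nat_add)
    finally show ?thesis using False by (simp add: sc_cancel)
  qed (simp add: expo_0)
qed

lemma expo_const: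
  assumes "\<And>n. G n u = 0" and "b > 0"
  shows "expo G b u = 0"
proof -
  have "sc (of_nat b) * expo G b u = sc (of_nat b) * 0"
    unfolding expo_rec by (simp add: G_expo assms expo_zero)
  then show ?thesis using assms(2) by (subst (asm) sc_cancel) auto
qed

end

section \<open>Partial derivatives and the annihilation operators\<close>

definition pd :: "'n \<times> nat \<Rightarrow> 'n poly \<Rightarrow> 'n poly" where
  "pd x u = (\<Sum>\<mu>\<in>Poly_Mapping.keys u. Poly_Mapping.single (\<mu> - Poly_Mapping.single x 1)
     (Poly_Mapping.lookup u \<mu> * of_nat (Poly_Mapping.lookup \<mu> x)))"

lemma pd_superset:
  assumes "finite F" "Poly_Mapping.keys u \<subseteq> F"
  shows "pd x u = (\<Sum>\<mu>\<in>F. Poly_Mapping.single (\<mu> - Poly_Mapping.single x 1)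
     (Poly_Mapping.lookup u \<mu> * of_nat (Poly_Mapping.lookup \<mu> x)))"
  unfolding pd_def using assms
  by (intro sum.mono_neutral_left) (auto simp: in_keys_iff)

lemma pd_add: "pd x (u + v) = pd x u + pd x v"
proof -
  let ?F = "Poly_Mapping.keys u \<union> Poly_Mapping.keys v"
  show ?thesis
    using keys_add[of u v]
    by (simp add: pd_superset[of ?F] lookup_add distrib_right single_add sum.distrib)
qed

lemma pd_single: "pd x (Poly_Mapping.single \<mu> c) =
    Poly_Mapping.single (\<mu> - Poly_Mapping.single x 1) (c * of_nat (Poly_Mapping.lookup \<mu> x))"
  by (subst pd_superset[of "{\<mu>}"]) auto

lemma pd_0: "pd x 0 = 0"
  by (simp add: pd_def)

lemma pd_mult: "pd x (u * v) = pd x u * v + u * pd x v"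
proof (induction u rule: poly_mapping_single_induct)
  case (single \<mu> c)
  show ?case
  proof (induction v rule: poly_mapping_single_induct)
    case (single \<nu> d)
    let ?e = "Poly_Mapping.single x (Suc 0)"
    have 1: "(a - ?e) + b = (a + b) - ?e" if "Poly_Mapping.lookup a x \<noteq> 0" for a b
      using that by (intro poly_mapping_eqI) (auto simp: lookup_add lookup_minus lookup_single when_def)
    \<comment> \<open>Subtraction of exponents is truncated; where this matters, the coefficient is
      0.\<close>
    have 2: "Poly_Mapping.single (a - ?e + b) (of_nat (Poly_Mapping.lookup a x) * k :: complex) =
        Poly_Mapping.single (a + b - ?e) (of_nat (Poly_Mapping.lookup a x) * k)" for a b k
      by (cases "Poly_Mapping.lookup a x = 0") (simp_all add: 1)
    have "pd x (Poly_Mapping.single \<mu> c * Poly_Mapping.single \<nu> d) =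
        Poly_Mapping.single (\<mu> + \<nu> - ?e) (of_nat (Poly_Mapping.lookup \<mu> x) * (c * d)) +
        Poly_Mapping.single (\<nu> + \<mu> - ?e) (of_nat (Poly_Mapping.lookup \<nu> x) * (c * d))"
      by (simp add: mult_single pd_single lookup_add add.commute[of \<nu>] algebra_simps flip: single_add)
    also have "\<dots> = pd x (Poly_Mapping.single \<mu> c) * Poly_Mapping.single \<nu> d + Poly_Mapping.single \<mu> c * pd x (Poly_Mapping.single \<nu> d)"
      unfolding 2[symmetric] by (simp add: mult_single pd_single mult_ac add.commute)
    finally show ?case .
  next
    case (add f g)
    then show ?case by (simp add: distrib_left pd_add)
  qed
next
  case (add f g)
  then show ?case by (simp add: distrib_right pd_add)
qed

lemma pd_sc: "pd x (sc c * u) = sc c * pd x u"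
  by (simp add: pd_mult sc_def pd_single)

lemma pd_commute: "pd x (pd y u) = pd y (pd x u)"
proof (induction u rule: poly_mapping_single_induct)
  case (single \<mu> c)
  have "\<mu> - Poly_Mapping.single y 1 - Poly_Mapping.single x 1 = \<mu> - Poly_Mapping.single x 1 - Poly_Mapping.single y 1"
    by (intro poly_mapping_eqI) (simp add: lookup_minus diff_right_commute)
  then show ?case
    by (cases "x = y") (simp_all add: pd_single lookup_minus lookup_single mult_ac)
qed (simp add: pd_add)

definition aconst :: "('n \<Rightarrow> 'n \<Rightarrow> int) \<Rightarrow> complex \<Rightarrow> 'n \<Rightarrow> 'n \<Rightarrow> nat \<Rightarrow> complex" where
  "aconst A q i j n = qnum q (A i j * int n) * qnum q (int n) / of_nat n"

lemma ader_eq: "ader A q i n u = (\<Sum>j\<in>UNIV. sc (aconst A q i j n) * pd (j, n - 1) u)"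
proof -
  have "ader A q i n u = (\<Sum>j\<in>UNIV. \<Sum>\<mu>\<in>Poly_Mapping.keys u. 
      Poly_Mapping.single (\<mu> - Poly_Mapping.single (j, n - 1) 1)
        (Poly_Mapping.lookup u \<mu> * of_nat (Poly_Mapping.lookup \<mu> (j, n - 1)) * aconst A q i j n))"
    unfolding ader_def aconst_def by (rule sum.swap)
  also have "\<dots> = (\<Sum>j\<in>UNIV. sc (aconst A q i j n) * pd (j, n - 1) u)"
    unfolding pd_def sum_distrib_left sc_def by (simp add: mult_single mult_ac)
  finally show ?thesis .
qed

lemma ader_add: "ader A q i n (u + v) = ader A q i n u + ader A q i n v"
  by (simp add: ader_eq pd_add distrib_left sum.distrib)

lemma ader_mult: "ader A q i n (u * v) = ader A q i n u * v + u * ader A q i n v"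
  by (simp add: ader_eq pd_mult distrib_left sum.distrib sum_distrib_left sum_distrib_right mult_ac)

lemma ader_sc: "ader A q i n (sc c * u) = sc c * ader A q i n u"
  by (simp add: ader_eq pd_sc sum_distrib_left mult.left_commute)

lemma pd_sum: "pd x (sum f X) = (\<Sum>y\<in>X. pd x (f y))"
  by (induction X rule: infinite_finite_induct) (simp_all add: pd_add pd_0)

lemma ader_commute: "ader A q i n (ader A q j m u) = ader A q j m (ader A q i n u)"
proof -
  have "ader A q i n (ader A q j m u) = (\<Sum>k\<in>UNIV. \<Sum>l\<in>UNIV. sc (aconst A q i k n) * (sc (aconst A q j l m) * pd (k, n - 1) (pd (l, m - 1) u)))"
    by (simp add: ader_eq pd_sum pd_sc sum_distrib_left)
  also have "\<dots> = (\<Sum>l\<in>UNIV. \<Sum>k\<in>UNIV. sc (aconst A q j l m) * (sc (aconst A q i k n) * pd (l, m - 1) (pd (k, n - 1) u)))"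
    by (subst sum.swap) (simp add: mult_ac pd_commute)
  also have "\<dots> = ader A q j m (ader A q i n u)"
    by (simp add: ader_eq pd_sum pd_sc sum_distrib_left)
  finally show ?thesis .
qed

lemma ader_one: "ader A q i n 1 = 0"
  by (simp add: ader_eq pd_single flip: single_one)

lemma ader_avar:
  assumes "n > 0" "m > 0"
  shows "ader A q i n (avar j m) = sc (if n = m then aconst A q i j n else 0)"
proof -
  have e: "(k, n - 1) = (j, m - 1) \<longleftrightarrow> k = j \<and> n = m" for k using assms by auto
  have "sc (aconst A q i k n) * pd (k, n - 1) (avar j m) = (if k = j then sc (if n = m then aconst A q i j n else 0) else 0)" for k
  proof (cases "(k, n - 1) = (j, m - 1)")
    case True
    then have "pd (k, n - 1) (avar j m) = 1" by (simp only: avar_def pd_single) simp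
    then show ?thesis using True e[of k] by simp
  next
    case False
    then have "pd (k, n - 1) (avar j m) = 0"
      unfolding avar_def pd_single by (simp only: lookup_single when_def) auto
    then show ?thesis using False e[of k] by auto
  qed
  then show ?thesis by (simp add: ader_eq)
qed

definition sq_coeff :: "complex \<Rightarrow> complex \<Rightarrow> int \<Rightarrow> nat \<Rightarrow> complex" where
  "sq_coeff q sq sg n = of_int sg * sq powi (- sg * int n) / qnum q (int n)"

lemma foldr_comp_id: "foldr (\<lambda>n f. g n \<circ> f) ns id u = foldr g ns u"
  by (induction ns) simp_all

lemma ep_coeff_eq: "ep_coeff A q sq sg i b = expo (\<lambda>n x. sc (- sq_coeff q sq sg n) * ader A q i n x) b"
  by (simp add: fun_eq_iff ep_coeff_def expo_def foldr_comp_id sq_coeff_def)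

lemma em_coeff_eq: "em_coeff q sq sg i a = expo (\<lambda>n x. sc (sq_coeff q sq sg n) * avar i n * x) a 1"
proof -
  have "prod_list (map f ns) = foldr (\<lambda>n x. f n * x) ns 1" for f :: "nat \<Rightarrow> 'a poly" and ns
    by (induction ns) simp_all
  then show ?thesis by (simp add: em_coeff_def expo_def sq_coeff_def)
qed

interpretation ep: commuting_ops "\<lambda>n x. sc (- sq_coeff q sq sg n) * ader A q i n x" for q sq sg A i
  by unfold_locales (simp_all add: ader_add ader_sc distrib_left ader_commute mult.left_commute)

interpretation em: commuting_ops "\<lambda>n x. sc (sq_coeff q sq sg n) * avar i n * x" for q sq sg i
  by unfold_locales (simp_all add: distrib_left mult.left_commute mult.assoc)

lemma em_coeff_0: "em_coeff q sq sg i 0 = 1"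
  by (simp add: em_coeff_eq em.expo_0)

lemma ader_0: "ader A q i n 0 = 0"
  by (simp add: ader_def)

lemma ader_sum: "ader A q i n (sum f X) = (\<Sum>x\<in>X. ader A q i n (f x))"
  by (induction X rule: infinite_finite_induct) (simp_all add: ader_add ader_0)

lemma ep_coeff_0: "ep_coeff A q sq sg i 0 u = u"
  by (simp add: ep_coeff_eq ep.expo_0)

lemma ep_coeff_add: "ep_coeff A q sq sg i b (u + v) = ep_coeff A q sq sg i b u + ep_coeff A q sq sg i b v"
  by (simp add: ep_coeff_eq ep.expo_add)

lemma ep_coeff_sc: "ep_coeff A q sq sg i b (sc c * u) = sc c * ep_coeff A q sq sg i b u"
  by (simp add: ep_coeff_eq ep.expo_sc)

lemma ep_coeff_zero: "ep_coeff A q sq sg i b 0 = 0"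
  by (simp add: ep_coeff_eq ep.expo_zero)

lemma ep_coeff_sum: "ep_coeff A q sq sg i b (sum f X) = (\<Sum>x\<in>X. ep_coeff A q sq sg i b (f x))"
  by (simp add: ep_coeff_eq ep.expo_sum)

lemma ep_coeff_mult: "ep_coeff A q sq sg i b (u * v) =
    (\<Sum>k\<le>b. ep_coeff A q sq sg i k u * ep_coeff A q sq sg i (b - k) v)"
  unfolding ep_coeff_eq by (rule ep.expo_mult) (simp add: ader_mult algebra_simps)

lemma ep_coeff_commute: "ep_coeff A q sq sg i b (ep_coeff A q sq sg j c u) = ep_coeff A q sq sg j c (ep_coeff A q sq sg i b u)"
proof -
  have 1: "ader A q j n (ep_coeff A q sq sg i b u) = ep_coeff A q sq sg i b (ader A q j n u)" for i j n b u
    unfolding ep_coeff_eq by (rule ep.expo_commute) (simp_all add: ader_add ader_sc ader_commute)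
  show ?thesis
    unfolding ep_coeff_eq[of A q sq sg j]
    by (rule ep.expo_commute) (simp_all add: ep_coeff_add ep_coeff_sc 1)
qed

text \<open>The commutator of \<open>a_i(n)\<close> with the exponent of E_-(j,z) is a scalar times
  \<open>z^n\<close>. In the recursion for \<open>em_coeff\<close> the term \<open>m = n\<close>
  yields the weight \<open>n\<close> from the variable itself, the others yield \<open>a - n\<close>
  by induction, and the total weight \<open>a\<close> is cancelled.\<close>

lemma ader_em_coeff:
  assumes n: "n > 0"
  shows "ader A q i n (em_coeff q sq sg j a) =
    (if n \<le> a then sc (sq_coeff q sq sg n * aconst A q i j n) * em_coeff q sq sg j (a - n) else 0)"
proof (induction a rule: less_induct)
  case (less a)
  let ?e = "em_coeff q sq sg j" and ?h = "sq_coeff q sq sg" and ?D = "ader A q i n"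
  let ?k = "sc (?h n * aconst A q i j n)"
  show ?case
  proof (cases "a = 0")
    case True
    then show ?thesis using n by (simp add: em_coeff_0 ader_one)
  next
    case False
    have rec: "sc (of_nat a) * ?e a = (\<Sum>m=1..a. sc (of_nat m) * (sc (?h m) * avar j m * ?e (a - m)))" for a
      unfolding em_coeff_eq by (rule em.expo_rec)
    have "sc (of_nat a) * ?D (?e a) = (\<Sum>m=1..a. sc (of_nat m) * (sc (?h m) * ?D (avar j m * ?e (a - m))))"
      unfolding ader_sc[symmetric] rec by (simp add: ader_sum ader_sc mult.assoc)
    also have "\<dots> = (\<Sum>m=1..a. (if m = n then sc (of_nat n) * ?k * ?e (a - n) else 0)
        + sc (of_nat m) * (sc (?h m) * avar j m * ?D (?e (a - m))))"
      using n by (intro sum.cong refl) (auto simp: ader_mult ader_avar sc_mult algebra_simps)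
    also have "\<dots> = (if n \<le> a then sc (of_nat n) * ?k * ?e (a - n) else 0) +
        (\<Sum>m=1..a. sc (of_nat m) * (sc (?h m) * avar j m * ?D (?e (a - m))))"
      using n by (simp add: sum.distrib)
    also have "(\<Sum>m=1..a. sc (of_nat m) * (sc (?h m) * avar j m * ?D (?e (a - m)))) =
        (\<Sum>m=1..a. if n \<le> a - m then sc (of_nat m) * (sc (?h m) * avar j m * (?k * ?e (a - m - n))) else 0)"
      using less by (intro sum.cong refl) auto
    also have "\<dots> = (if n \<le> a then ?k * (sc (of_nat (a - n)) * ?e (a - n)) else 0)"
    proof (cases "n \<le> a")
      case True
      have "(\<Sum>m=1..a. if n \<le> a - m then sc (of_nat m) * (sc (?h m) * avar j m * (?k * ?e (a - m - n))) else 0)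
         = (\<Sum>m=1..a - n. ?k * (sc (of_nat m) * (sc (?h m) * avar j m * ?e (a - n - m))))"
        using n by (intro sum.mono_neutral_cong_right) (auto simp: diff_commute add.commute mult_ac)
      then show ?thesis using True by (simp only: rec sum_distrib_left if_True)
    qed (use n in \<open>auto intro!: sum.neutral\<close>)
    also have "(if n \<le> a then sc (of_nat n) * ?k * ?e (a - n) else 0) + (if n \<le> a then ?k * (sc (of_nat (a - n)) * ?e (a - n)) else 0)
        = sc (of_nat a) * (if n \<le> a then ?k * ?e (a - n) else 0)"
    proof (cases "n \<le> a")
      case True
      then have e: "sc (of_nat a) = sc (of_nat n) + sc (of_nat (a - n))" by (simp flip: sc_add of_nat_add)
      show ?thesis unfolding e using True by (simp only: if_True distrib_right mult.assoc mult.left_commute)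
    qed simp
    finally show ?thesis using False by (simp add: sc_cancel)
  qed
qed

section \<open>Contraction of annihilation and creation parts for a fixed sign\<close>

locale vertex_setup =
  fixes A :: "'n::finite \<Rightarrow> 'n \<Rightarrow> int" and q sq :: complex and sg :: int
  assumes q0: "q \<noteq> 0" and nonroot: "\<And>n::nat. n > 0 \<Longrightarrow> q ^ n \<noteq> 1"
    and sq2: "sq\<^sup>2 = q" and sg: "sg = 1 \<or> sg = - 1"
begin

definition Q :: complex where "Q = q powi sg"

lemma Q_cases: "Q = q \<or> Q = inverse q"
  using sg by (auto simp: Q_def power_int_minus)

lemma qnum_Q: "qnum Q k = qnum q k"
  using Q_cases by (auto simp: qnum_inverse)

lemma Q0: "Q \<noteq> 0"
  using Q_cases q0 by auto

lemma Q_nonroot: "n > 0 \<Longrightarrow> Q ^ n \<noteq> 1"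
  using Q_cases nonroot by (auto simp: power_inverse)

abbreviation "ep \<equiv> ep_coeff A q sq sg"
abbreviation "em \<equiv> em_coeff q sq sg"
abbreviation "cc a \<equiv> fps_nth (contr Q a)"

text \<open>The two half-powers of \<open>q\<close> multiply to \<open>Q^(-n)\<close> and the two
  signs cancel, so the sign of the vertex operator survives only in \<open>Q\<close>.\<close>

lemma contraction_coeff:
  assumes "n > 0"
  shows "- sq_coeff q sq sg n * (sq_coeff q sq sg n * aconst A q i j n) =
    - (Q powi (- int n) * qnum Q (A i j * int n) / qnum Q (int n)) / of_nat n"
proof -
  define P N M where "P = sq powi (- sg * int n)" and "N = qnum q (int n)" and "M = qnum q (A i j * int n)"
  have "P\<^sup>2 = sq powi (2 * (sg * - int n))"
    unfolding P_def power_int_power' by (simp add: mult_ac)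
  also have "\<dots> = ((sq powi 2) powi sg) powi (- int n)" by (simp only: power_int_mult)
  also have "sq powi 2 = q" using sq2 by simp
  finally have P: "P * P = Q powi (- int n)" by (simp add: Q_def power2_eq_square)
  have s: "of_int sg * of_int sg = (1::complex)" using sg by auto
  have N: "N \<noteq> 0" unfolding N_def by (rule qnum_nonzero[OF q0 nonroot assms])
  have "- (of_int sg * P / N) * (of_int sg * P / N * (M * N / of_nat n)) =
      - ((of_int sg * of_int sg) * (P * P) * M / N) / of_nat n"
    using N assms by (simp add: field_simps)
  then show ?thesis unfolding s P by (simp add: sq_coeff_def aconst_def qnum_Q P_def N_def M_def)
qed

text \<open>By \<open>expo_rec\<close> and \<open>ader_em_coeff\<close>, the scalar by which E_+
  acts satisfies the recursion \<open>contr_rec\<close>.\<close>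

lemma ep_em: "ep i k (em j a) = (if k \<le> a then sc (cc (A i j) k) * em j (a - k) else 0)"
proof (induction k rule: less_induct)
  case (less k)
  show ?case
  proof (cases "k = 0")
    case True
    then show ?thesis by (simp add: ep_coeff_0 contr_nth_0)
  next
    case False
    let ?w = "\<lambda>n. - (Q powi (- int n) * qnum Q (A i j * int n) / qnum Q (int n)) / of_nat n"
    have "sc (of_nat k) * ep i k (em j a) =
        (\<Sum>n=1..k. sc (of_nat n) * (sc (- sq_coeff q sq sg n) * ader A q i n (ep i (k - n) (em j a))))"
      unfolding ep_coeff_eq by (rule ep.expo_rec)
    also have "\<dots> = (\<Sum>n=1..k. if k \<le> a then sc (of_nat n * ?w n * cc (A i j) (k - n)) * em j (a - k) else 0)"
    proof (intro sum.cong refl)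
      fix n assume n: "n \<in> {1..k}"
      then have n0: "n > 0" by simp
      have IH: "ep i (k - n) (em j a) = (if k - n \<le> a then sc (cc (A i j) (k - n)) * em j (a - (k - n)) else 0)"
        using n by (intro less) auto
      show "sc (of_nat n) * (sc (- sq_coeff q sq sg n) * ader A q i n (ep i (k - n) (em j a))) =
         (if k \<le> a then sc (of_nat n * ?w n * cc (A i j) (k - n)) * em j (a - k) else 0)"
      proof (cases "k \<le> a")
        case True
        have "a - (k - n) - n = a - k" "k - n \<le> a" "n \<le> a - (k - n)" using n True by auto
        then have "ader A q i n (ep i (k - n) (em j a)) =
            sc (cc (A i j) (k - n)) * (sc (sq_coeff q sq sg n * aconst A q i j n) * em j (a - k))"
          by (simp only: IH if_True ader_sc ader_em_coeff[OF n0])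
        then show ?thesis using True
          unfolding contraction_coeff[OF n0, symmetric] by (simp add: sc_mult sc_uminus mult_ac)
      next
        case False
        then have "ader A q i n (ep i (k - n) (em j a)) = 0"
          using n by (auto simp: IH ader_sc ader_0 ader_em_coeff[OF n0])
        then show ?thesis using False by simp
      qed
    qed
    also have "\<dots> = (if k \<le> a then sc (\<Sum>n=1..k. of_nat n * ?w n * cc (A i j) (k - n)) * em j (a - k) else 0)"
      by (simp add: sc_sum sum_distrib_right)
    also have "(\<Sum>n=1..k. of_nat n * ?w n * cc (A i j) (k - n)) = of_nat k * cc (A i j) k"
      by (rule contr_rec[symmetric])
    finally have "sc (of_nat k) * ep i k (em j a) = sc (of_nat k) * (if k \<le> a then sc (cc (A i j) k) * em j (a - k) else 0)"
      by (simp add: sc_mult mult.assoc)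
    then show ?thesis using False by (subst (asm) sc_cancel) simp_all
  qed
qed

text \<open>Uniform in \<open>i\<close>, so that one \<open>D\<close> serves all operators of a
  word.\<close>

definition bnd :: "nat \<Rightarrow> 'n poly \<Rightarrow> bool" where
  "bnd D u \<longleftrightarrow> (\<forall>i b. D < b \<longrightarrow> ep i b u = 0)"

lemma bnd_add: "bnd D u \<Longrightarrow> bnd E v \<Longrightarrow> bnd (max D E) (u + v)"
  by (simp add: bnd_def ep_coeff_add)

lemma bnd_sc: "bnd D u \<Longrightarrow> bnd D (sc c * u)"
  by (simp add: bnd_def ep_coeff_sc)

lemma bnd_mult: "bnd D u \<Longrightarrow> bnd E v \<Longrightarrow> bnd (D + E) (u * v)"
  unfolding bnd_def ep_coeff_mult
proof (intro allI impI sum.neutral ballI)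
  fix i b k assume *: "\<forall>i b. D < b \<longrightarrow> ep i b u = 0" "\<forall>i b. E < b \<longrightarrow> ep i b v = 0" "D + E < b"
  have "D < k \<or> E < b - k" using *(3) by auto
  then show "ep i k u * ep i (b - k) v = 0" using * by auto
qed

lemma bnd_one: "bnd 0 1"
  unfolding bnd_def ep_coeff_eq by (auto intro!: ep.expo_const simp: ader_one)

text \<open>Only the annihilator of index \<open>n\<close> acts nontrivially on the variable; the
  result is a constant, which E_+ kills in positive order.\<close>

lemma bnd_avar: "n > 0 \<Longrightarrow> bnd n (avar j n)"
  unfolding bnd_def
proof (intro allI impI)
  fix i b assume n: "n > 0" "n < b"
  have one: "ep i k (sc c) = 0" if "k > 0" for k c
    using bnd_sc[OF bnd_one, of c] that by (simp add: bnd_def)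
  have "sc (of_nat b) * ep i b (avar j n) =
     (\<Sum>m=1..b. sc (of_nat m) * (sc (- sq_coeff q sq sg m) * ader A q i m (ep i (b - m) (avar j n))))"
    unfolding ep_coeff_eq by (rule ep.expo_rec)
  also have "\<dots> = (\<Sum>m=1..b. sc (of_nat m) * ep i (b - m) (sc (- sq_coeff q sq sg m) * ader A q i m (avar j n)))"
    unfolding ep_coeff_eq
    by (intro sum.cong refl arg_cong2[where f = "(*)"] ep.G_expo)
  also have "\<dots> = 0"
    using n by (intro sum.neutral ballI)
      (auto simp: ader_avar one ep_coeff_zero simp flip: sc_mult)
  finally have "sc (of_nat b) * ep i b (avar j n) = sc (of_nat b) * 0" by simp
  then show "ep i b (avar j n) = 0" using n by (subst (asm) sc_cancel) auto
qed

text \<open>Bounds add under multiplication, so generators suffice. This makes the index set in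
  \<open>X_basis\<close> finite; a sum over an infinite set would be 0 by convention.\<close>

lemma bnd_exists: "\<exists>D. bnd D u"
proof (induction u rule: poly_mapping_single_induct)
  case (single \<mu> c)
  have "\<exists>D. bnd D (Poly_Mapping.single \<mu> 1)"
  proof (induction \<mu> rule: poly_mapping_single_induct)
    case (single x n)
    show ?case
    proof (induction n)
      case 0
      show ?case using bnd_one by auto
    next
      case (Suc n)
      then obtain D where D: "bnd D (Poly_Mapping.single (Poly_Mapping.single x n) 1)" by blast
      have "Poly_Mapping.single (Poly_Mapping.single x (Suc n)) (1::complex) =
          avar (fst x) (Suc (snd x)) * Poly_Mapping.single (Poly_Mapping.single x n) 1"
        by (simp add: avar_def mult_single flip: single_add)
      then show ?case using bnd_mult[OF bnd_avar D, of "Suc (snd x)" "fst x"] by auto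
    qed
  next
    case (add f g)
    have "Poly_Mapping.single (f + g) (1::complex) = Poly_Mapping.single f 1 * Poly_Mapping.single g 1"
      by (simp add: mult_single)
    then show ?case using add bnd_mult by metis
  qed
  moreover have "Poly_Mapping.single \<mu> c = sc c * Poly_Mapping.single \<mu> 1"
    by (simp add: sc_def mult_single)
  ultimately show ?case using bnd_sc by metis
next
  case (add f g)
  then show ?case using bnd_add by blast
qed

end

section \<open>Normally ordered products\<close>

type_synonym laurent = "(nat \<Rightarrow> int) \<Rightarrow>\<^sub>0 complex"

text \<open>Multiplication of a formal series by a Laurent polynomial, where \<open>M f\<close> is
  the coefficient at the exponent vector \<open>f\<close>. The series form only a module over the
  ring \<open>laurent\<close>; the determinant identity is applied in the ring.\<close>

definition act :: "laurent \<Rightarrow> ((nat \<Rightarrow> int) \<Rightarrow> 'n poly) \<Rightarrow> (nat \<Rightarrow> int) \<Rightarrow> 'n poly" where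
  "act P M f = (\<Sum>x\<in>Poly_Mapping.keys P. sc (Poly_Mapping.lookup P x) * M (f - x))"

lemma act_superset:
  assumes "finite F" "Poly_Mapping.keys P \<subseteq> F"
  shows "act P M f = (\<Sum>x\<in>F. sc (Poly_Mapping.lookup P x) * M (f - x))"
  unfolding act_def using assms by (intro sum.mono_neutral_left) (auto simp: in_keys_iff)

lemma act_single: "act (Poly_Mapping.single x c) M f = sc c * M (f - x)"
  by (subst act_superset[of "{x}"]) auto

lemma act_0: "act 0 M f = 0"
  by (simp add: act_def)

lemma act_1: "act 1 M f = M f"
  using act_single[of 0 1 M f] by (simp add: fun_eq_iff)

lemma act_add: "act (P + R) M f = act P M f + act R M f"
proof -
  let ?F = "Poly_Mapping.keys P \<union> Poly_Mapping.keys R"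
  show ?thesis using keys_add[of P R]
    by (simp add: act_superset[of ?F] lookup_add sc_add distrib_right sum.distrib)
qed

lemma act_sum: "act (sum g X) M f = (\<Sum>x\<in>X. act (g x) M f)"
  by (induction X rule: infinite_finite_induct) (simp_all add: act_0 act_add)

lemma act_mult: "act (P * R) M f = act P (act R M) f"
proof (induction P arbitrary: f rule: poly_mapping_single_induct)
  case (single x c)
  show ?case
  proof (induction R arbitrary: f rule: poly_mapping_single_induct)
    case (single y d)
    show ?case by (simp add: mult_single act_single sc_mult mult.assoc diff_diff_eq)
  next
    case (add R R')
    then show ?case by (simp add: distrib_left act_add act_single)
  qed
qed (simp add: distrib_right act_add)

lemma act_eq_0: "(\<And>x. x \<in> Poly_Mapping.keys P \<Longrightarrow> M (f - x) = 0) \<Longrightarrow> act P M f = 0"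
  by (simp add: act_def)

lemma keys_mult_subset:
  assumes "Poly_Mapping.keys P \<subseteq> X" "Poly_Mapping.keys R \<subseteq> Y" "\<And>x y. x \<in> X \<Longrightarrow> y \<in> Y \<Longrightarrow> x + y \<in> Z"
  shows "Poly_Mapping.keys (P * R) \<subseteq> Z"
  using keys_mult[of P R] assms by blast

lemma keys_prod_list_subset:
  assumes "\<And>p. p \<in> set ps \<Longrightarrow> Poly_Mapping.keys p \<subseteq> X" "0 \<in> X" "\<And>x y. x \<in> X \<Longrightarrow> y \<in> X \<Longrightarrow> x + y \<in> X"
  shows "Poly_Mapping.keys (prod_list ps) \<subseteq> X"
  using assms(1)
proof (induction ps)
  case Nil
  show ?case using assms(2) by simp
next
  case (Cons p ps)
  then show ?case
    using keys_mult_subset[of p X "prod_list ps" X X] assms(3) by simp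
qed

definition vr :: "nat \<Rightarrow> int \<Rightarrow> nat \<Rightarrow> int" where
  "vr y e = (\<lambda>v. if v = y then e else 0)"

lemma vr_add: "vr y (a + b) = vr y a + vr y b"
  by (auto simp: vr_def)

lemma vr_0: "vr y 0 = 0"
  by (auto simp: vr_def)

context vertex_setup
begin

definition emi :: "'n \<Rightarrow> int \<Rightarrow> 'n poly" where
  "emi i a = (if a < 0 then 0 else em i (nat a))"

lemma ep_emi: "ep i k (emi j a) = sc (cc (A i j) k) * emi j (a - int k)"
  by (auto simp: emi_def ep_em ep_coeff_zero nat_diff_distrib) 

text \<open>The coefficient at \<open>f\<close> of the product with all E_- to the left of all E_+,
  without the lattice part. Cutting E_+ off at order \<open>D\<close> loses nothing if
  \<open>bnd D u\<close>, as the annihilation parts commute.\<close>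

fun nord :: "nat \<Rightarrow> ('n \<times> nat) list \<Rightarrow> 'n poly \<Rightarrow> (nat \<Rightarrow> int) \<Rightarrow> 'n poly" where
  "nord D [] u f = u"
| "nord D ((i, y) # ops) u f = (\<Sum>b\<le>D. emi i (f y + int b) * nord D ops (ep i b u) f)"

lemma nord_cong: "(\<And>y. y \<in> snd ` set ops \<Longrightarrow> f y = g y) \<Longrightarrow> nord D ops u f = nord D ops u g"
proof (induction ops arbitrary: u)
  case (Cons o' ops)
  then show ?case by (cases o') auto
qed simp

text \<open>An E_+ cut off at \<open>D\<close> lowers the exponent of its variable by at most
  \<open>D\<close>, and E_- only raises it. All truncation arguments rest on this support
  bound.\<close>

lemma nord_eq_0: "y \<in> snd ` set ops \<Longrightarrow> f y < - int D \<Longrightarrow> nord D ops u f = 0"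
proof (induction ops arbitrary: u)
  case (Cons o' ops)
  show ?case
  proof (cases "snd o' = y")
    case True
    then show ?thesis using Cons.prems by (cases o') (auto simp: emi_def intro!: sum.neutral)
  next
    case False
    then show ?thesis using Cons by (cases o') auto
  qed
qed simp

lemma nord_0: "nord D ops 0 f = 0"
proof (induction ops)
  case Nil then show ?case by simp
next
  case (Cons o' ops)
  then show ?case by (cases o') (simp add: ep_coeff_zero)
qed

lemma nord_swap: "nord D (a # b # ops) u f = nord D (b # a # ops) u f"
proof -
  obtain i y j t where [simp]: "a = (i, y)" "b = (j, t)" by (cases a, cases b)
  have "nord D (a # b # ops) u f = (\<Sum>k\<le>D. \<Sum>l\<le>D. emi i (f y + int k) * (emi j (f t + int l) * nord D ops (ep j l (ep i k u)) f))"
    by (simp add: sum_distrib_left)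
  also have "\<dots> = (\<Sum>l\<le>D. \<Sum>k\<le>D. emi j (f t + int l) * (emi i (f y + int k) * nord D ops (ep i k (ep j l u)) f))"
    by (subst sum.swap) (simp add: ep_coeff_commute[of A q sq sg i] mult.left_commute)
  also have "\<dots> = nord D (b # a # ops) u f" by (simp add: sum_distrib_left)
  finally show ?thesis .
qed

lemma nord_move: "nord D (xs @ a # ys) u f = nord D (a # xs @ ys) u f"
proof (induction xs arbitrary: u)
  case (Cons x xs)
  have "nord D (x # xs @ a # ys) u f = nord D (x # a # xs @ ys) u f"
    by (cases x) (simp only: nord.simps(2) Cons)
  then show ?case by (simp only: append_Cons nord_swap)
qed simp

text \<open>Creation parts commute as polynomials, annihilation parts by
  \<open>ep_coeff_commute\<close>. Hence all words of the Serre relation share one normally ordered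
  product.\<close>

lemma nord_mset: "mset ops = mset ops' \<Longrightarrow> nord D ops u f = nord D ops' u f"
proof (induction ops arbitrary: ops' u)
  case (Cons a ops)
  then have "a \<in> set ops'" by (metis list.set_intros(1) set_mset_mset)
  then obtain xs ys where ops': "ops' = xs @ a # ys" by (meson split_list)
  with Cons.prems have "mset ops = mset (xs @ ys)" by simp
  then have "nord D ops u f = nord D (xs @ ys) u f" for u by (rule Cons.IH)
  then show ?case unfolding ops' nord_move by (cases a) simp
qed simp

section \<open>Truncated contractions and their action on normally ordered products\<close>

definition kapz :: "nat \<Rightarrow> int \<Rightarrow> nat \<Rightarrow> nat \<Rightarrow> laurent" where
  "kapz K a y t = (\<Sum>k\<le>K. Poly_Mapping.single (vr y (- int k) + vr t (int k)) (cc a k))"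

text \<open>Compared with \<open>kapz\<close> this includes the power \<open>y^a\<close> that the
  zero mode of the left operator produces on the lattice part of the right one.\<close>

definition kap :: "nat \<Rightarrow> int \<Rightarrow> nat \<Rightarrow> nat \<Rightarrow> laurent" where
  "kap K a y t = (\<Sum>k\<le>K. Poly_Mapping.single (vr y (a - int k) + vr t (int k)) (cc a k))"

lemma kap_kapz: "kap K a y t = Poly_Mapping.single (vr y a) 1 * kapz K a y t"
  by (simp add: kap_def kapz_def sum_distrib_left mult_single vr_add[of y a] add.assoc flip: vr_add)
     (simp add: vr_add[symmetric] add.assoc[symmetric])

lemma keys_kapz: "Poly_Mapping.keys (kapz K a y t) \<subseteq> {vr y (- int k) + vr t (int k) | k. True}"
  unfolding kapz_def by (rule order.trans[OF keys_sum]) auto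

lemma keys_kap: "Poly_Mapping.keys (kap K a y t) \<subseteq> {vr y (a - int k) + vr t (int k) | k. True}"
  unfolding kap_def by (rule order.trans[OF keys_sum]) auto

lemma act_kapz: "act (kapz K a y t) M f = (\<Sum>k\<le>K. sc (cc a k) * M (f + vr y (int k) - vr t (int k)))"
proof -
  have "f - (vr y (- int k) + vr t (int k)) = f + vr y (int k) - vr t (int k)" for k
    by (auto simp: vr_def fun_eq_iff)
  then show ?thesis by (simp only: kapz_def act_sum act_single)
qed

definition lkapz :: "nat \<Rightarrow> 'n \<Rightarrow> nat \<Rightarrow> ('n \<times> nat) list \<Rightarrow> laurent" where
  "lkapz K i y ops = prod_list (map (\<lambda>(j, t). kapz K (A i j) y t) ops)"

lemma keys_lkapz:
  assumes "y \<notin> snd ` set ops"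
  shows "Poly_Mapping.keys (lkapz K i y ops) \<subseteq>
    {x. x y \<le> 0 \<and> (\<forall>v. v \<noteq> y \<longrightarrow> 0 \<le> x v) \<and> (\<forall>v. v \<noteq> y \<longrightarrow> v \<notin> snd ` set ops \<longrightarrow> x v = 0)}"
  unfolding lkapz_def
proof (rule keys_prod_list_subset, goal_cases)
  case (1 p)
  then obtain j t where jt: "(j, t) \<in> set ops" "p = kapz K (A i j) y t" by auto
  then have "t \<noteq> y" using assms by force
  then show ?case unfolding jt(2) using jt(1)
    by (intro order.trans[OF keys_kapz]) (force simp: vr_def)
qed auto

text \<open>The value of \<open>E\<^sub>+(i, y)\<close> on a normally ordered product, with the coefficient index of
  \<open>E\<^sub>+(i, y)\<close> stored as minus the exponent of the variable \<open>y\<close>.\<close>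
definition ep_nord :: "nat \<Rightarrow> 'n \<Rightarrow> nat \<Rightarrow> ('n \<times> nat) list \<Rightarrow> 'n poly \<Rightarrow> (nat \<Rightarrow> int) \<Rightarrow> 'n poly" where
  "ep_nord D i y ops u f = (if f y \<le> 0 then nord D ops (ep i (nat (- f y)) u) f else 0)"

lemma ep_nord_eq_0: "t \<in> snd ` set ops \<Longrightarrow> f t < - int D \<Longrightarrow> ep_nord D i y ops u f = 0"
  by (auto simp: ep_nord_def nord_eq_0)

text \<open>Induction on the word: E_+ is multiplicative, its action on the first creation part is a
  contraction, and the rest is left to the induction hypothesis. Truncation at \<open>K\<close> is
  harmless because a contraction of order above \<open>K\<close> moves the exponent of
  \<open>t\<close> below \<open>-D\<close>.\<close>

lemma ep_nord_contract:
  assumes "y \<notin> snd ` set ops" "distinct (map snd ops)"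
    and "\<And>t. t \<in> snd ` set ops \<Longrightarrow> f t + int D \<le> int K"
  shows "(if f y \<le> 0 then ep i (nat (- f y)) (nord D ops u f) else 0) =
    act (lkapz K i y ops) (ep_nord D i y ops u) f"
  using assms
proof (induction ops arbitrary: u f)
  case Nil
  show ?case by (simp add: lkapz_def act_1 ep_nord_def)
next
  case (Cons o' ops)
  obtain j t where o': "o' = (j, t)" by (cases o')
  let ?P = "lkapz K i y ops" and ?R = "ep_nord D i y (o' # ops) u"
  have yt: "y \<noteq> t" and y: "y \<notin> snd ` set ops" and t: "t \<notin> snd ` set ops" and dist: "distinct (map snd ops)"
    using Cons.prems by (auto simp: o')
  define fk where "fk = (\<lambda>k. f + vr y (int k) - vr t (int k))"
  have fk: "fk k y = f y + int k" "fk k t = f t - int k" "\<And>v. v \<in> snd ` set ops \<Longrightarrow> fk k v = f v" for k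
    using yt y t by (auto simp: fk_def vr_def)
  \<comment> \<open>The part of order \<open>k\<close> in the contraction with \<open>t\<close>. It
    vanishes both for \<open>k > K\<close> and for \<open>k > - f y\<close>, so sums up to either
    bound agree.\<close>
  define h where "h = (\<lambda>k. sc (cc (A i j) k) * act ?P ?R (fk k))"
  have keysP: "x y \<le> 0" "x t = 0" if "x \<in> Poly_Mapping.keys ?P" for x
    using keys_lkapz[OF y, of K i] that yt t by auto
  have R1: "act (lkapz K i y (o' # ops)) ?R f = (\<Sum>k\<le>K. h k)"
    by (simp add: lkapz_def o' act_mult act_kapz h_def fk_def)
  have h0: "h k = 0" if "f y + int k > 0" for k
  proof -
    have "act ?P ?R (fk k) = 0"
    proof (rule act_eq_0)
      fix x assume "x \<in> Poly_Mapping.keys ?P"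
      then have "\<not> (fk k - x) y \<le> 0" using keysP(1)[of x] that by (simp add: fk)
      then show "?R (fk k - x) = 0" by (simp only: ep_nord_def if_False)
    qed
    then show ?thesis by (simp add: h_def)
  qed
  have hK: "h k = 0" if "k > K" for k
  proof -
    have "f t + int D \<le> int K" using Cons.prems(3)[of t] by (simp add: o')
    then have "act ?P ?R (fk k) = 0"
      using that by (intro act_eq_0 ep_nord_eq_0[of t]) (auto simp: fk o' keysP(2))
    then show ?thesis by (simp add: h_def)
  qed
  show ?case
  proof (cases "f y \<le> 0")
    case False
    then have "(\<Sum>k\<le>K. h k) = 0" by (intro sum.neutral) (auto intro: h0)
    then show ?thesis using False by (simp add: R1)
  next
    case True
    define b where "b = nat (- f y)"
    have hk: "(\<Sum>b'\<le>D. ep i k (emi j (f t + int b')) * ep i (b - k) (nord D ops (ep j b' u) f)) = h k" if k: "k \<le> b" for k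
    proof -
      have le: "fk k y \<le> 0" and nb: "nat (- fk k y) = b - k" using k True by (auto simp: fk b_def)
      have IH: "ep i (b - k) (nord D ops (ep j b' u) f) = act ?P (ep_nord D i y ops (ep j b' u)) (fk k)" for b'
      proof -
        have "ep i (b - k) (nord D ops (ep j b' u) (fk k)) = act ?P (ep_nord D i y ops (ep j b' u)) (fk k)"
          using Cons.IH[OF y dist, of "fk k" "ep j b' u"] Cons.prems(3) le nb by (simp add: fk)
        moreover have "nord D ops (ep j b' u) (fk k) = nord D ops (ep j b' u) f"
          by (rule nord_cong) (rule fk)
        ultimately show ?thesis by simp
      qed
      have "(\<Sum>b'\<le>D. ep i k (emi j (f t + int b')) * ep i (b - k) (nord D ops (ep j b' u) f))
        = sc (cc (A i j) k) * (\<Sum>b'\<le>D. emi j (f t - int k + int b') * act ?P (ep_nord D i y ops (ep j b' u)) (fk k))"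
        by (simp add: IH ep_emi sum_distrib_left mult.assoc algebra_simps)
      also have "(\<Sum>b'\<le>D. emi j (f t - int k + int b') * act ?P (ep_nord D i y ops (ep j b' u)) (fk k)) =
          (\<Sum>x\<in>Poly_Mapping.keys ?P. sc (Poly_Mapping.lookup ?P x) *
            (\<Sum>b'\<le>D. emi j (f t - int k + int b') * ep_nord D i y ops (ep j b' u) (fk k - x)))"
        unfolding act_def sum_distrib_left by (subst sum.swap) (simp add: mult.left_commute)
      also have "\<dots> = act ?P ?R (fk k)"
        unfolding act_def
      proof (intro sum.cong refl arg_cong2[where f = "(*)"])
        fix x assume x: "x \<in> Poly_Mapping.keys ?P"
        show "(\<Sum>b'\<le>D. emi j (f t - int k + int b') * ep_nord D i y ops (ep j b' u) (fk k - x)) = ?R (fk k - x)"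
          using keysP[OF x] by (simp add: ep_nord_def o' fk ep_coeff_commute[of A q sq sg i])
      qed
      finally show ?thesis by (simp add: h_def)
    qed
    have "ep i b (nord D (o' # ops) u f) = (\<Sum>b'\<le>D. \<Sum>k\<le>b. ep i k (emi j (f t + int b')) * ep i (b - k) (nord D ops (ep j b' u) f))"
      by (simp add: o' ep_coeff_sum ep_coeff_mult)
    also have "\<dots> = (\<Sum>k\<le>b. h k)"
      by (subst sum.swap) (simp add: hk)
    also have "\<dots> = (\<Sum>k\<le>max b K. h k)"
    proof (rule sum.mono_neutral_left)
      show "\<forall>k\<in>{..max b K} - {..b}. h k = 0" using True by (auto simp: b_def intro!: h0)
    qed auto
    also have "\<dots> = (\<Sum>k\<le>K. h k)"
      using hK by (intro sum.mono_neutral_right) auto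
    finally show ?thesis using True by (simp add: R1 b_def)
  qed
qed

text \<open>If some exponent already lies below \<open>-D\<close>, both sides vanish: the
  contractions have nonnegative exponents in the variables of \<open>ops\<close>, and these are
  subtracted from \<open>f\<close>.\<close>

lemma ep_nord_contract':
  assumes "y \<notin> snd ` set ops" "distinct (map snd ops)"
    and "(\<forall>t\<in>snd ` set ops. f t + int D \<le> int K) \<or> (\<exists>t\<in>snd ` set ops. f t < - int D)"
  shows "(if f y \<le> 0 then ep i (nat (- f y)) (nord D ops u f) else 0) =
    act (lkapz K i y ops) (ep_nord D i y ops u) f"
  using assms(3)
proof
  assume "\<exists>t\<in>snd ` set ops. f t < - int D"
  then obtain t where t: "t \<in> snd ` set ops" "f t < - int D" by blast
  have "t \<noteq> y" using t assms(1) by blast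
  then have "x t \<ge> 0" if "x \<in> Poly_Mapping.keys (lkapz K i y ops)" for x
    using keys_lkapz[OF assms(1), of K i] that by blast
  then have "(f - x) t < - int D" if "x \<in> Poly_Mapping.keys (lkapz K i y ops)" for x
    using that t(2) by fastforce
  then have "act (lkapz K i y ops) (ep_nord D i y ops u) f = 0"
    by (intro act_eq_0 ep_nord_eq_0[OF t(1)])
  moreover have "nord D ops u f = 0" using t by (rule nord_eq_0)
  ultimately show ?thesis by (simp add: ep_coeff_zero)
next
  assume "\<forall>t\<in>snd ` set ops. f t + int D \<le> int K"
  then show ?thesis by (intro ep_nord_contract assms(1,2)) blast
qed

text \<open>The coefficient of \<open>z^a\<close> in E_-(i,z) E_+(i,z), the vertex operator without
  its lattice part.\<close>

definition yop :: "'n \<Rightarrow> int \<Rightarrow> 'n poly \<Rightarrow> 'n poly" where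
  "yop i a g = (\<Sum>b\<in>{b. ep i b g \<noteq> 0 \<and> int b + a \<ge> 0}. em i (nat (int b + a)) * ep i b g)"

lemma yop_eq:
  assumes "\<And>b. b > B \<Longrightarrow> ep i b g = 0"
  shows "yop i a g = (\<Sum>b\<le>B. emi i (a + int b) * ep i b g)"
proof -
  have "b \<le> B" if "ep i b g \<noteq> 0" for b using assms that not_le by blast
  then have "(\<Sum>b\<le>B. emi i (a + int b) * ep i b g) = 
     (\<Sum>b\<in>{b. ep i b g \<noteq> 0 \<and> int b + a \<ge> 0}. emi i (a + int b) * ep i b g)"
    by (intro sum.mono_neutral_right) (auto simp: emi_def split: if_splits)
  also have "\<dots> = yop i a g" unfolding yop_def by (intro sum.cong) (auto simp: emi_def add.commute)
  finally show ?thesis by simp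
qed

lemma yop_eq_bnd: "bnd B g \<Longrightarrow> yop i a g = (\<Sum>b\<le>B. emi i (a + int b) * ep i b g)"
  by (rule yop_eq) (simp add: bnd_def)

lemma bnd_mono: "bnd D g \<Longrightarrow> D \<le> E \<Longrightarrow> bnd E g"
  by (auto simp: bnd_def)

lemma yop_add: "yop i a (g + h) = yop i a g + yop i a h"
proof -
  obtain D E where "bnd D g" "bnd E h" using bnd_exists by blast
  then have "bnd (max D E) g" "bnd (max D E) h" "bnd (max D E) (g + h)"
    by (auto intro: bnd_add bnd_mono)
  then show ?thesis by (simp add: yop_eq_bnd ep_coeff_add distrib_left sum.distrib)
qed

lemma yop_sc: "yop i a (sc c * g) = sc c * yop i a g"
proof -
  obtain D where "bnd D g" using bnd_exists by blast
  then show ?thesis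
    using bnd_sc[of D g c] by (simp add: yop_eq_bnd[of D] ep_coeff_sc sum_distrib_left mult.left_commute)
qed

lemma yop_0: "yop i a 0 = 0"
  by (simp add: yop_def ep_coeff_zero)

lemma yop_sum: "yop i a (sum g X) = (\<Sum>x\<in>X. yop i a (g x))"
  by (induction X rule: infinite_finite_induct) (simp_all add: yop_add yop_0)

text \<open>E_+ is moved through the product and then joined with its own E_-. A monomial
  \<open>x\<close> of the contractions uses up \<open>kx x\<close> of the annihilation order
  \<open>b\<close>, so only the orders from \<open>kx x\<close> to \<open>kx x + D\<close> matter;
  \<open>B\<close> exceeds all of these.\<close>

lemma yop_nord:
  assumes y: "y \<notin> snd ` set ops" and dist: "distinct (map snd ops)" and u: "bnd D u"
    and f: "(\<forall>t\<in>snd ` set ops. f t + int D \<le> int K) \<or> (\<exists>t\<in>snd ` set ops. f t < - int D)"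
  shows "yop i (f y) (nord D ops u f) = act (lkapz K i y ops) (nord D ((i, y) # ops) u) f"
proof -
  let ?P = "lkapz K i y ops"
  define kx where "kx = (\<lambda>x::nat \<Rightarrow> int. nat (- x y))"
  obtain B0 where B0: "bnd B0 (nord D ops u f)" using bnd_exists by blast
  define B where "B = B0 + D + (\<Sum>x\<in>Poly_Mapping.keys ?P. kx x)"
  have B: "bnd B (nord D ops u f)" using B0 by (rule bnd_mono) (simp add: B_def)
  have kxB: "kx x + D \<le> B" if "x \<in> Poly_Mapping.keys ?P" for x
    using member_le_sum[OF that, of kx] by (simp add: B_def)
  have xy: "x y = - int (kx x)" if "x \<in> Poly_Mapping.keys ?P" for x
    using keys_lkapz[OF y, of K i] that by (auto simp: kx_def)
  have nord_y: "nord D ops w (f(y := c) - x) = nord D ops w (f - x)" for w c x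
    using y by (intro nord_cong) auto
  have ep: "ep i b (nord D ops u f) = (\<Sum>x\<in>Poly_Mapping.keys ?P. sc (Poly_Mapping.lookup ?P x) *
      (if kx x \<le> b then nord D ops (ep i (b - kx x) u) (f - x) else 0))" for b
  proof -
    \<comment> \<open>The variable \<open>y\<close> does not occur in \<open>ops\<close>, so its
      exponent is free to encode the order \<open>b\<close>, as \<open>ep_nord\<close>
      expects.\<close>
    let ?f = "f(y := - int b)"
    have "nord D ops u f = nord D ops u ?f" using nord_y[of u "- int b" 0] by simp
    moreover have "(\<forall>t\<in>snd ` set ops. ?f t + int D \<le> int K) \<or> (\<exists>t\<in>snd ` set ops. ?f t < - int D)"
    proof -
      have "?f t = f t" if "t \<in> snd ` set ops" for t using that y by auto
      then show ?thesis using f by (metis (no_types, lifting))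
    qed
    ultimately have "ep i b (nord D ops u f) = act ?P (ep_nord D i y ops u) ?f"
      using ep_nord_contract'[OF y dist, of ?f D K i u] by simp
    also have "\<dots> = (\<Sum>x\<in>Poly_Mapping.keys ?P. sc (Poly_Mapping.lookup ?P x) *
      (if kx x \<le> b then nord D ops (ep i (b - kx x) u) (f - x) else 0))"
      unfolding act_def
    proof (intro sum.cong refl arg_cong2[where f = "(*)"])
      fix x assume x: "x \<in> Poly_Mapping.keys ?P"
      have 1: "(?f - x) y = int (kx x) - int b" using xy[OF x] by simp
      then have "nat (- (?f - x) y) = b - kx x" by simp
      then show "ep_nord D i y ops u (?f - x) = (if kx x \<le> b then nord D ops (ep i (b - kx x) u) (f - x) else 0)"
        unfolding ep_nord_def nord_y 1 by simp
    qed
    finally show ?thesis .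
  qed
  have "yop i (f y) (nord D ops u f) = (\<Sum>b\<le>B. \<Sum>x\<in>Poly_Mapping.keys ?P. sc (Poly_Mapping.lookup ?P x) *
      (emi i (f y + int b) * (if kx x \<le> b then nord D ops (ep i (b - kx x) u) (f - x) else 0)))"
    unfolding yop_eq_bnd[OF B] ep sum_distrib_left by (simp add: mult.left_commute)
  also have "\<dots> = (\<Sum>x\<in>Poly_Mapping.keys ?P. sc (Poly_Mapping.lookup ?P x) *
      (\<Sum>b\<le>B. emi i (f y + int b) * (if kx x \<le> b then nord D ops (ep i (b - kx x) u) (f - x) else 0)))"
    by (subst sum.swap) (simp add: sum_distrib_left)
  also have "\<dots> = act ?P (nord D ((i, y) # ops) u) f"
    unfolding act_def
  proof (intro sum.cong refl arg_cong2[where f = "(*)"])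
    fix x assume x: "x \<in> Poly_Mapping.keys ?P"
    have "(\<Sum>b\<le>B. emi i (f y + int b) * (if kx x \<le> b then nord D ops (ep i (b - kx x) u) (f - x) else 0)) =
        (\<Sum>b\<in>{kx x..kx x + D}. emi i (f y + int b) * nord D ops (ep i (b - kx x) u) (f - x))"
    proof (rule sum.mono_neutral_cong_right)
      show "{kx x..kx x + D} \<subseteq> {..B}" using kxB[OF x] by auto
      show "\<forall>b\<in>{..B} - {kx x..kx x + D}. emi i (f y + int b) * (if kx x \<le> b then nord D ops (ep i (b - kx x) u) (f - x) else 0) = 0"
      proof
        fix b assume "b \<in> {..B} - {kx x..kx x + D}"
        then have "ep i (b - kx x) u = 0" if "kx x \<le> b" using that u by (auto simp: bnd_def)
        then show "emi i (f y + int b) * (if kx x \<le> b then nord D ops (ep i (b - kx x) u) (f - x) else 0) = 0"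
          by (simp add: nord_0)
      qed
    qed auto
    also have "\<dots> = (\<Sum>b\<le>D. emi i (f y + int (b + kx x)) * nord D ops (ep i b u) (f - x))"
      by (rule sum.reindex_bij_witness[of _ "\<lambda>b. b + kx x" "\<lambda>b. b - kx x"]) auto
    also have "\<dots> = nord D ((i, y) # ops) u (f - x)"
      using xy[OF x] by (simp add: algebra_simps)
    finally show "(\<Sum>b\<le>B. emi i (f y + int b) * (if kx x \<le> b then nord D ops (ep i (b - kx x) u) (f - x) else 0)) =
       nord D ((i, y) # ops) u (f - x)" .
  qed
  finally show ?thesis .
qed

section \<open>The product of all contractions and its total degree\<close>

fun kern :: "nat \<Rightarrow> ('n \<times> nat) list \<Rightarrow> laurent" where
  "kern K [] = 1"
| "kern K ((i, y) # ops) = prod_list (map (\<lambda>(j, t). kap K (A i j) y t) ops) * kern K ops"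

lemma keys_kern_vars: "x \<in> Poly_Mapping.keys (kern K ops) \<Longrightarrow> v \<notin> snd ` set ops \<Longrightarrow> x v = 0"
proof -
  have "Poly_Mapping.keys (kern K ops) \<subseteq> {x. x v = 0}" if "v \<notin> snd ` set ops" for v
    using that
  proof (induction ops)
    case (Cons o' ops)
    obtain i y where o': "o' = (i, y)" by (cases o')
    have "Poly_Mapping.keys (prod_list (map (\<lambda>(j, t). kap K (A i j) y t) ops)) \<subseteq> {x. x v = 0}"
    proof (rule keys_prod_list_subset, goal_cases)
      case (1 p)
      then obtain j t where jt: "(j, t) \<in> set ops" "p = kap K (A i j) y t" by auto
      then have "v \<noteq> t" "v \<noteq> y" using Cons.prems by (force simp: o')+
      then show ?case unfolding jt(2) by (intro order.trans[OF keys_kap]) (auto simp: vr_def)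
    qed auto
    from keys_mult_subset[OF this Cons.IH] Cons.prems show ?case by (auto simp: o')
  qed auto
  then show "x \<in> Poly_Mapping.keys (kern K ops) \<Longrightarrow> v \<notin> snd ` set ops \<Longrightarrow> x v = 0" by blast
qed

definition tot :: "nat set \<Rightarrow> (nat \<Rightarrow> int) \<Rightarrow> int" where
  "tot V x = (\<Sum>v\<in>V. x v)"

lemma tot_add: "tot V (x + y) = tot V x + tot V y"
  by (simp add: tot_def sum.distrib)

lemma tot_vr: "finite V \<Longrightarrow> y \<in> V \<Longrightarrow> tot V (vr y e) = e"
  by (simp add: tot_def vr_def)

text \<open>Every contraction is homogeneous of degree \<open>A i j\<close>, whatever
  \<open>K\<close> is. Independence of \<open>K\<close> is essential, since \<open>K\<close> is
  later chosen in terms of \<open>B\<close>.\<close>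

lemma tot_kern:
  assumes V: "finite V" "snd ` set ops \<subseteq> V"
  shows "\<exists>B. \<forall>K. \<forall>x\<in>Poly_Mapping.keys (kern K ops). tot V x \<ge> - int B"
  using V(2)
proof (induction ops)
  case Nil
  show ?case by (auto simp: tot_def)
next
  case (Cons o' ops)
  obtain i y where o': "o' = (i, y)" by (cases o')
  obtain B where B: "\<forall>K. \<forall>x\<in>Poly_Mapping.keys (kern K ops). tot V x \<ge> - int B" using Cons by auto
  have y: "y \<in> V" using Cons.prems by (simp add: o')
  have "\<exists>C. \<forall>K. \<forall>x\<in>Poly_Mapping.keys (prod_list (map (\<lambda>(j, t). kap K (A i j) y t) ops)). tot V x \<ge> - int C"
    if "snd ` set ops \<subseteq> V" using that
  proof (induction ops)
    case Nil
    show ?case by (auto simp: tot_def)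
  next
    case (Cons o'' ops)
    obtain j t where o'': "o'' = (j, t)" by (cases o'')
    obtain C where C: "\<forall>K. \<forall>x\<in>Poly_Mapping.keys (prod_list (map (\<lambda>(j, t). kap K (A i j) y t) ops)). tot V x \<ge> - int C"
      using Cons by auto
    have t: "t \<in> V" using Cons.prems by (simp add: o'')
    have "Poly_Mapping.keys (kap K (A i j) y t) \<subseteq> {x. tot V x = A i j}" for K
      using y t V(1) by (intro order.trans[OF keys_kap]) (auto simp: tot_add tot_vr)
    then have "Poly_Mapping.keys (kap K (A i j) y t * prod_list (map (\<lambda>(j, t). kap K (A i j) y t) ops)) \<subseteq>
       {x. tot V x \<ge> - int (nat \<bar>A i j\<bar> + C)}" for K
      by (rule keys_mult_subset[of _ _ _ "{x. tot V x \<ge> - int C}"]) (use C in \<open>auto simp: tot_add\<close>)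
    then show ?case by (intro exI[of _ "nat \<bar>A i j\<bar> + C"]) (auto simp: o'')
  qed
  then obtain C where C: "\<forall>K. \<forall>x\<in>Poly_Mapping.keys (prod_list (map (\<lambda>(j, t). kap K (A i j) y t) ops)). tot V x \<ge> - int C"
    using Cons.prems by auto
  have "Poly_Mapping.keys (kern K (o' # ops)) \<subseteq> {x. tot V x \<ge> - int (C + B)}" for K
    unfolding o' kern.simps
    by (rule keys_mult_subset[of _ "{x. tot V x \<ge> - int C}" _ "{x. tot V x \<ge> - int B}"]) (use B C in \<open>auto simp: tot_add\<close>)
  then show ?case by blast
qed

lemma prod_list_kap:
  "prod_list (map (\<lambda>(j, t). kap K (A i j) y t) ops) =
    Poly_Mapping.single (vr y (\<Sum>(j, t)\<leftarrow>ops. A i j)) 1 * lkapz K i y ops"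
proof (induction ops)
  case Nil
  show ?case by (simp only: lkapz_def list.map sum_list.Nil prod_list.Nil vr_0 single_one mult_1_left)
next
  case (Cons o' ops)
  obtain j t where o': "o' = (j, t)" by (cases o')
  have "Poly_Mapping.single (vr y (a + b)) (1::complex) = Poly_Mapping.single (vr y a) 1 * Poly_Mapping.single (vr y b) 1" for a b
    by (simp add: mult_single vr_add)
  then show ?case using Cons by (simp add: o' kap_kapz lkapz_def mult_ac)
qed

end

section \<open>Products of vertex operators\<close>

lemma (in vertex_setup) X_basis_eq:
  "X_basis A \<epsilon> q sq sg i n \<beta> u =
    Poly_Mapping.single (\<lambda>k. \<beta> k + sg * sroot i k)
      (sc (\<epsilon> (\<lambda>k. sg * sroot i k) \<beta>) * yop i (- (sg * bform A (sroot i) \<beta>) - n - 1) u)"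
  by (simp add: X_basis_def Let_def yop_def sum_distrib_left mult.assoc algebra_simps)

lemma (in vertex_setup) X_basis_0: "X_basis A \<epsilon> q sq sg i n \<beta> 0 = 0"
  by (simp add: X_basis_eq yop_0)

lemma (in vertex_setup) X_mode_single:
  "X_mode A \<epsilon> q sq sg i n (Poly_Mapping.single \<beta> u) = X_basis A \<epsilon> q sq sg i n \<beta> u"
  by (cases "u = 0") (simp_all add: X_mode_def X_basis_0)

lemma (in vertex_setup) X_mode_add:
  "X_mode A \<epsilon> q sq sg i n (v + w) = X_mode A \<epsilon> q sq sg i n v + X_mode A \<epsilon> q sq sg i n w"
proof -
  let ?F = "Poly_Mapping.keys v \<union> Poly_Mapping.keys w"
  have X: "X_mode A \<epsilon> q sq sg i n x = (\<Sum>\<beta>\<in>?F. X_basis A \<epsilon> q sq sg i n \<beta> (Poly_Mapping.lookup x \<beta>))"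
    if "Poly_Mapping.keys x \<subseteq> ?F" for x
    unfolding X_mode_def using that by (intro sum.mono_neutral_left) (auto simp: X_basis_0 in_keys_iff)
  show ?thesis using keys_add[of v w]
    by (simp add: X lookup_add X_basis_eq yop_add distrib_left single_add sum.distrib)
qed

primrec lat_sum :: "int \<Rightarrow> 'n lat \<Rightarrow> 'n list \<Rightarrow> 'n lat" where
  "lat_sum sg \<beta> [] = \<beta>"
| "lat_sum sg \<beta> (i # is) = (\<lambda>k. lat_sum sg \<beta> is k + sg * sroot i k)"

primrec cocycle :: "('n lat \<Rightarrow> 'n lat \<Rightarrow> complex) \<Rightarrow> int \<Rightarrow> 'n lat \<Rightarrow> 'n list \<Rightarrow> complex" where
  "cocycle \<epsilon> sg \<beta> [] = 1"
| "cocycle \<epsilon> sg \<beta> (i # is) = \<epsilon> (\<lambda>k. sg * sroot i k) (lat_sum sg \<beta> is) * cocycle \<epsilon> sg \<beta> is"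

lemma bform_sroot: "bform A (sroot i) \<gamma> = (\<Sum>b\<in>UNIV. A i b * \<gamma> b)"
proof -
  have "bform A (sroot i) \<gamma> = (\<Sum>a\<in>UNIV. if a = i then (\<Sum>b\<in>UNIV. A a b * \<gamma> b) else 0)"
    unfolding bform_def by (intro sum.cong refl) (auto simp: sroot_def)
  then show ?thesis by simp
qed

lemma bform_lat_sum: "bform A (sroot i) (lat_sum sg \<beta> is) = bform A (sroot i) \<beta> + sg * (\<Sum>j\<leftarrow>is. A i j)"
proof (induction "is")
  case (Cons j "is")
  have "(\<Sum>b\<in>UNIV. A i b * (sg * sroot j b)) = (\<Sum>b\<in>UNIV. if b = j then sg * A i j else 0)"
    by (intro sum.cong refl) (auto simp: sroot_def)
  then have "(\<Sum>b\<in>UNIV. A i b * (sg * sroot j b)) = sg * A i j" by simp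
  then show ?case using Cons by (simp add: bform_sroot distrib_left sum.distrib)
qed simp

context vertex_setup
begin

text \<open>Induction on the word with \<open>yop_nord\<close> as the step. The shift
  \<open>d0\<close> accounts for the power of each variable caused by \<open>\<beta>\<close>; the
  powers caused by the other operators sit in \<open>kern\<close>. How large \<open>K\<close> must
  be depends on \<open>d\<close>.\<close>

theorem vertex_product:
  fixes d d0 :: "nat \<Rightarrow> int"
  assumes u: "bnd D u" and dist: "distinct (map snd ops)"
    and d0: "\<And>i y. (i, y) \<in> set ops \<Longrightarrow> d0 y = sg * bform A (sroot i) \<beta>"
  shows "\<forall>\<^sub>F K in sequentially.
    foldr (\<lambda>(i, y) f. X_mode A \<epsilon> q sq sg i (- d y - 1) \<circ> f) ops id (Poly_Mapping.single \<beta> u) =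
    Poly_Mapping.single (lat_sum sg \<beta> (map fst ops))
      (sc (cocycle \<epsilon> sg \<beta> (map fst ops)) * act (kern K ops) (nord D ops u) (d - d0))"
  using dist d0
proof (induction ops)
  case Nil
  show ?case by (simp add: act_1)
next
  case (Cons o' ops)
  obtain i y where o': "o' = (i, y)" by (cases o')
  let ?V = "snd ` set ops"
  have y: "y \<notin> ?V" and dist: "distinct (map snd ops)" and fin: "finite ?V"
    using Cons.prems(1) by (auto simp: o')
  define f where "f = d - d0"
  define S where "S = (\<Sum>(j, t)\<leftarrow>ops. A i j)"
  obtain B where B: "\<And>K x. x \<in> Poly_Mapping.keys (kern K ops) \<Longrightarrow> tot ?V x \<ge> - int B"
    using tot_kern[OF fin order.refl] by blast
  have IH: "\<forall>\<^sub>F K in sequentially.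
    foldr (\<lambda>(i, y) f. X_mode A \<epsilon> q sq sg i (- d y - 1) \<circ> f) ops id (Poly_Mapping.single \<beta> u) =
    Poly_Mapping.single (lat_sum sg \<beta> (map fst ops))
      (sc (cocycle \<epsilon> sg \<beta> (map fst ops)) * act (kern K ops) (nord D ops u) f)"
    unfolding f_def using Cons.prems by (intro Cons.IH) auto
  \<comment> \<open>If no exponent lies below \<open>-D\<close>, the upper bound
    \<open>tot V f + B\<close> for their sum bounds each of them from above; this gives the
    threshold.\<close>
  let ?K0 = "nat (tot ?V f + int B + int D * int (card ?V) + int D)"
  have step: "yop i (f y - S) (act (kern K ops) (nord D ops u) f) = act (kern K (o' # ops)) (nord D (o' # ops) u) f"
    if K: "K \<ge> ?K0" for K
  proof -
    let ?P = "kern K ops" and ?R = "lkapz K i y ops" and ?N = "nord D (o' # ops) u"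
    have "yop i (f y - S) (nord D ops u (f - x)) = act ?R ?N (f - x - vr y S)" if x: "x \<in> Poly_Mapping.keys ?P" for x
    proof -
      let ?f = "f - x - vr y S"
      have xy: "x y = 0" by (rule keys_kern_vars[OF x y])
      have fV: "?f t = f t - x t" if "t \<in> ?V" for t using that y by (auto simp: vr_def)
      have "(\<forall>t\<in>?V. ?f t + int D \<le> int K) \<or> (\<exists>t\<in>?V. ?f t < - int D)"
      proof (rule disjCI)
        assume "\<not> (\<exists>t\<in>?V. ?f t < - int D)"
        then have ge: "?f t \<ge> - int D" if "t \<in> ?V" for t using that by (meson not_le)
        show "\<forall>t\<in>?V. ?f t + int D \<le> int K"
        proof
          fix t assume t: "t \<in> ?V"
          have "- int D * int (card (?V - {t})) \<le> (\<Sum>v\<in>?V - {t}. ?f v)"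
            using sum_bounded_below[of "?V - {t}" "- int D" ?f] ge by (simp add: mult.commute)
          moreover have "(\<Sum>v\<in>?V. ?f v) = ?f t + (\<Sum>v\<in>?V - {t}. ?f v)" using t fin by (simp add: sum.remove)
          moreover have "(\<Sum>v\<in>?V. ?f v) = tot ?V f - tot ?V x"
            unfolding tot_def sum_subtractf[symmetric] by (rule sum.cong[OF refl]) (rule fV)
          moreover have "int D * int (card (?V - {t})) \<le> int D * int (card ?V)"
            using fin by (intro mult_left_mono) (auto intro: card_mono)
          ultimately have "?f t + int D \<le> tot ?V f + int B + int D * int (card ?V) + int D"
            using B[OF x] by simp
          then show "?f t + int D \<le> int K" using K by linarith
        qed
      qed
      then have "yop i (?f y) (nord D ops u ?f) = act ?R ?N ?f"
        unfolding o' by (rule yop_nord[OF y dist u])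
      moreover have "?f y = f y - S" using xy by (simp add: vr_def)
      moreover have "nord D ops u ?f = nord D ops u (f - x)" by (rule nord_cong) (use fV in auto)
      ultimately show ?thesis by (simp only:)
    qed
    then have "yop i (f y - S) (act ?P (nord D ops u) f) = act ?P (\<lambda>g. act ?R ?N (g - vr y S)) f"
      unfolding act_def[of ?P] yop_sum yop_sc by simp
    also have "\<dots> = act ?P (act (Poly_Mapping.single (vr y S) 1) (act ?R ?N)) f"
      by (simp add: act_def[of ?P] act_single)
    also have "\<dots> = act (kern K (o' # ops)) ?N f"
    proof -
      have "kern K (o' # ops) = ?P * (Poly_Mapping.single (vr y S) 1 * ?R)"
        unfolding o' kern.simps prod_list_kap S_def by (simp only: mult_ac)
      moreover have "act (P * R) M = act P (act R M)" for P R and M :: "(nat \<Rightarrow> int) \<Rightarrow> 'n poly"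
        by (rule ext) (rule act_mult)
      ultimately show ?thesis by (simp only:)
    qed
    finally show ?thesis .
  qed
  have s2: "sg * sg = 1" using sg by auto
  have S: "(\<Sum>j\<leftarrow>map fst ops. A i j) = S" unfolding S_def by (induction ops) auto
  have "d0 y = sg * bform A (sroot i) \<beta>" using Cons.prems by (simp add: o')
  \<comment> \<open>The leftmost operator sees \<open>\<beta>\<close> plus the signed roots to its
    right. Since \<open>sg * sg = 1\<close>, the latter contribute \<open>S\<close>, which
    \<open>prod_list_kap\<close> supplies as the monomial \<open>y^S\<close>.\<close>
  then have ex: "- (sg * bform A (sroot i) (lat_sum sg \<beta> (map fst ops))) - (- d y - 1) - 1 = f y - S"
    unfolding bform_lat_sum S by (simp add: f_def distrib_left s2 flip: mult.assoc)
  show ?case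
    using IH eventually_ge_at_top[of ?K0]
  proof eventually_elim
    case (elim K)
    show ?case
    proof -
      have "foldr (\<lambda>(i, y) f. X_mode A \<epsilon> q sq sg i (- d y - 1) \<circ> f) (o' # ops) id (Poly_Mapping.single \<beta> u) =
        X_mode A \<epsilon> q sq sg i (- d y - 1)
          (foldr (\<lambda>(i, y) f. X_mode A \<epsilon> q sq sg i (- d y - 1) \<circ> f) ops id (Poly_Mapping.single \<beta> u))"
        by (simp add: o')
      then show ?thesis
        unfolding f_def[symmetric]
        by (simp only: o' elim(1) X_mode_single X_basis_eq ex yop_sc step[OF elim(2), unfolded o']
            list.map fst_conv lat_sum.simps cocycle.simps sc_mult mult.assoc)
    qed
  qed
qed

end

section \<open>The contraction kernel\<close>

definition cst :: "complex \<Rightarrow> laurent" where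
  "cst c = Poly_Mapping.single 0 c"

lemma cst_add: "cst (a + b) = cst a + cst b" and cst_mult: "cst (a * b) = cst a * cst b"
  and cst_uminus: "cst (- a) = - cst a" and cst_0: "cst 0 = 0" and cst_1: "cst 1 = 1"
  by (simp_all add: cst_def single_add mult_single single_uminus)

lemma cst_power: "cst (a ^ n) = cst a ^ n"
  by (induction n) (simp_all add: cst_1 cst_mult)

lemma cst_qb: "cst (qb x y m r) = qb (cst x) (cst y) m r"
proof (induction m arbitrary: r)
  case 0
  then show ?case by (cases r) (simp_all add: cst_0 cst_1)
next
  case (Suc m)
  then show ?case
    by (cases r) (simp_all add: cst_1 cst_add cst_mult cst_power del: power_Suc)
qed

lemma act_cst_mult: "act (cst c * P) M f = sc c * act P M f"
  by (simp add: act_mult cst_def act_single)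

definition var :: "nat \<Rightarrow> laurent" where
  "var t = Poly_Mapping.single (vr t 1) 1"

lemma var_power: "var t ^ n = Poly_Mapping.single (vr t (int n)) 1"
proof (induction n)
  case 0
  show ?case by (simp only: power_0 of_nat_0 vr_0 single_one)
next
  case (Suc n)
  then show ?case by (simp add: var_def mult_single flip: vr_add)
qed

lemma cst_mult_single: "cst c * Poly_Mapping.single x d = Poly_Mapping.single x (c * d)"
  by (simp add: cst_def mult_single)

lemma single_sum: "Poly_Mapping.single x (sum g X) = (\<Sum>y\<in>X. Poly_Mapping.single x (g y))"
  by (induction X rule: infinite_finite_induct) (simp_all add: single_add)

lemma prod_list_map_upt: "prod_list (map g [a..<b]) = (\<Prod>t\<in>{a..<b}. g t)"
  by (simp flip: prod.distinct_set_conv_list[OF distinct_upt])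

context vertex_setup
begin

lemma kern_append:
  "kern K (xs @ ys) = kern K xs * kern K ys *
    prod_list (map (\<lambda>(i, y). prod_list (map (\<lambda>(j, t). kap K (A i j) y t) ys)) xs)"
proof (induction xs)
  case (Cons x xs)
  then show ?case by (cases x) (simp add: mult_ac)
qed simp

lemma kern_snoc: "kern K (xs @ [(j, t)]) = kern K xs * prod_list (map (\<lambda>(i, y). kap K (A i j) y t) xs)"
  by (simp add: kern_append)

lemma prod_list_mult: "prod_list (map (\<lambda>x. g x * h x) xs) = prod_list (map g xs) * (prod_list (map h xs) :: 'b::comm_monoid_mult)"
  by (induction xs) (simp_all add: mult_ac)

lemma kern_insert:
  "kern K (xs @ (j, t) # ys) = kern K (xs @ ys) *
    prod_list (map (\<lambda>(i, y). kap K (A i j) y t) xs) * prod_list (map (\<lambda>(i, y). kap K (A j i) t y) ys)"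
  by (simp add: kern_append case_prod_unfold prod_list_mult mult_ac)

lemma kern_same: "kern K (map (\<lambda>t. (i, \<sigma> t)) [0..<m]) = pairprod (\<lambda>s t. kap K (A i i) (\<sigma> s) (\<sigma> t)) m"
proof (induction m)
  case 0
  show ?case by (simp add: pairprod_def)
next
  case (Suc m)
  have "kern K (map (\<lambda>t. (i, \<sigma> t)) [0..<Suc m]) =
      kern K (map (\<lambda>t. (i, \<sigma> t)) [0..<m]) * prod_list (map (\<lambda>s. kap K (A i i) (\<sigma> s) (\<sigma> m)) [0..<m])"
    by (simp add: kern_snoc comp_def)
  then show ?case by (simp add: Suc pairprod_Suc prod_list_map_upt atLeast0LessThan mult.commute)
qed

text \<open>Variable \<open>m\<close> plays the part of \<open>w\<close>, the variables below
  \<open>m\<close> that of the \<open>z\<close>.\<close>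

definition word :: "'n \<Rightarrow> 'n \<Rightarrow> nat \<Rightarrow> (nat \<Rightarrow> nat) \<Rightarrow> nat \<Rightarrow> ('n \<times> nat) list" where
  "word i j m \<sigma> r = map (\<lambda>t. (i, \<sigma> t)) [0..<r] @ [(j, m)] @ map (\<lambda>t. (i, \<sigma> t)) [r..<m]"

lemma kern_word:
  assumes "r \<le> m"
  shows "kern K (word i j m \<sigma> r) = pairprod (\<lambda>s t. kap K (A i i) (\<sigma> s) (\<sigma> t)) m *
    (\<Prod>s<r. kap K (A i j) (\<sigma> s) m) * (\<Prod>s\<in>{r..<m}. kap K (A j i) m (\<sigma> s))"
proof -
  have "map (\<lambda>t. (i, \<sigma> t)) [0..<r] @ map (\<lambda>t. (i, \<sigma> t)) [r..<m] = map (\<lambda>t. (i, \<sigma> t)) [0..<m]"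
    using assms upt_add_eq_append[of 0 r "m - r"] by (simp flip: map_append)
  then show ?thesis
    by (simp add: word_def kern_insert kern_same comp_def prod_list_map_upt atLeast0LessThan)
qed

lemma set_word: "\<sigma> permutes {..<m} \<Longrightarrow> r \<le> m \<Longrightarrow> set (word i j m \<sigma> r) = insert (j, m) (Pair i ` {..<m})"
proof -
  assume "\<sigma> permutes {..<m}" "r \<le> m"
  then have "\<sigma> ` {..<m} = {..<m}" "{..<m} = {0..<r} \<union> {r..<m}" by (auto simp: permutes_image)
  then have "\<sigma> ` {0..<r} \<union> \<sigma> ` {r..<m} = {..<m}" by (metis image_Un)
  moreover have "set (word i j m \<sigma> r) = insert (j, m) (Pair i ` (\<sigma> ` {0..<r} \<union> \<sigma> ` {r..<m}))"
    by (auto simp: word_def)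
  ultimately show ?thesis by simp
qed

lemma distinct_word: "\<sigma> permutes {..<m} \<Longrightarrow> r \<le> m \<Longrightarrow> distinct (map snd (word i j m \<sigma> r))"
proof -
  assume *: "\<sigma> permutes {..<m}" "r \<le> m"
  have "set (map snd (word i j m \<sigma> r)) = {..m}"
    using set_word[OF *, of i j] by (auto simp: image_iff)
  then have "card (set (map snd (word i j m \<sigma> r))) = length (map snd (word i j m \<sigma> r))"
    using * by (simp add: word_def)
  then show ?thesis by (rule card_distinct)
qed

lemma mset_word:
  assumes "\<sigma> permutes {..<m}" "r \<le> m"
  shows "mset (word i j m \<sigma> r) = mset (word i j m id 0)"
proof -
  have "distinct (word i j m \<sigma> r)" "distinct (word i j m id 0)"
    using distinct_word[OF assms, of i j] distinct_word[of id m 0 i j] by (simp_all add: distinct_map permutes_id)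
  moreover have "set (word i j m \<sigma> r) = set (word i j m id 0)"
    using set_word[OF assms, of i j] set_word[of id m 0 i j] by (simp add: permutes_id)
  ultimately show ?thesis by (simp add: set_eq_iff_mset_eq_distinct)
qed

lemma kap_2:
  assumes "K \<ge> 2"
  shows "kap K 2 y t = (var y - var t) * (var y - (cst (inverse Q))\<^sup>2 * var t)"
proof -
  let ?g = "\<lambda>k. Poly_Mapping.single (vr y (2 - int k) + vr t (int k)) (cc 2 k)"
  note cc = contr_2_nth[OF Q0 Q_nonroot]
  have "kap K 2 y t = (\<Sum>k\<in>{0, 1, 2}. ?g k)"
    unfolding kap_def using assms by (intro sum.mono_neutral_right) (auto simp: cc)
  also have "\<dots> = Poly_Mapping.single (vr y 2) 1 - Poly_Mapping.single (vr y 1 + vr t 1) (1 + (inverse Q)\<^sup>2)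
      + Poly_Mapping.single (vr t 2) ((inverse Q)\<^sup>2)"
    by (simp add: cc vr_0 single_uminus[symmetric] del: power_inverse single_uminus)
  also have "\<dots> = var y ^ 2 - cst (1 + (inverse Q)\<^sup>2) * (var y * var t) + cst ((inverse Q)\<^sup>2) * var t ^ 2"
    unfolding var_power by (simp add: var_def mult_single cst_mult_single)
  also have "\<dots> = (var y - var t) * (var y - (cst (inverse Q))\<^sup>2 * var t)"
    unfolding cst_add cst_1 cst_power by (simp add: algebra_simps power2_eq_square)
  finally show ?thesis .
qed

text \<open>Coefficients of the polynomial inverse to \<open>contr Q (- int a)\<close>, by the
  q-binomial theorem.\<close>

definition rbin :: "nat \<Rightarrow> nat \<Rightarrow> complex" where
  "rbin a l = (- 1) ^ l * qb Q (inverse Q) a l * inverse Q ^ l"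

lemma contr_rbin: "(\<Sum>k=0..n. cc (- int a) k * rbin a (n - k)) = (if n = 0 then 1 else 0)"
proof -
  have "fps_nth (contr Q (- int a) * Abs_fps (rbin a)) n = (if n = 0 then 1 else 0)"
    using contr_neg_qb[OF Q0 Q_nonroot, of a] by (simp add: rbin_def[abs_def])
  then show ?thesis by (simp add: fps_mult_nth)
qed

text \<open>Truncating the contraction series at order \<open>K\<close> leaves only error terms of order above \<open>K\<close>.\<close>
lemma keys_kap_rbin:
  assumes "y \<noteq> t"
  shows "Poly_Mapping.keys (kap K (- int a) y t *
      (\<Sum>l\<le>a. Poly_Mapping.single (vr t (int l) + vr y (int a - int l)) (rbin a l)) - 1) \<subseteq>
    {vr t (int n) + vr y (- int n) | n. n > K}"
proof -
  define c where "c = cc (- int a)"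
  let ?X = "\<lambda>n. vr t (int n) + vr y (- int n)"
  \<comment> \<open>Cauchy coefficients of the product with truncated first factor; up to
    \<open>n = K\<close> the truncation is not felt.\<close>
  define e where "e = (\<lambda>n. \<Sum>k\<le>K. \<Sum>l\<le>a. if k + l = n then c k * rbin a l else 0)"
  have mono: "(vr y (- int a - int k) + vr t (int k)) + (vr t (int l) + vr y (int a - int l)) = ?X (k + l)" for k l
    by (auto simp: vr_def fun_eq_iff)
  have "kap K (- int a) y t * (\<Sum>l\<le>a. Poly_Mapping.single (vr t (int l) + vr y (int a - int l)) (rbin a l)) =
      (\<Sum>k\<le>K. \<Sum>l\<le>a. Poly_Mapping.single (?X (k + l)) (c k * rbin a l))"
    unfolding kap_def sum_product mult_single mono c_def ..
  also have "\<dots> = (\<Sum>k\<le>K. \<Sum>l\<le>a. \<Sum>n\<le>K + a. Poly_Mapping.single (?X n) (if k + l = n then c k * rbin a l else 0))"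
  proof (intro sum.cong refl)
    fix k l assume "k \<in> {..K}" "l \<in> {..a}"
    then have "k + l \<in> {..K + a}" by simp
    then show "Poly_Mapping.single (?X (k + l)) (c k * rbin a l) =
        (\<Sum>n\<le>K + a. Poly_Mapping.single (?X n) (if k + l = n then c k * rbin a l else 0))"
      by (subst sum.remove[of _ "k + l"]) (auto intro!: sum.neutral)
  qed
  also have "\<dots> = (\<Sum>k\<le>K. \<Sum>n\<le>K + a. \<Sum>l\<le>a. Poly_Mapping.single (?X n) (if k + l = n then c k * rbin a l else 0))"
    by (intro sum.cong refl sum.swap)
  also have "\<dots> = (\<Sum>n\<le>K + a. Poly_Mapping.single (?X n) (e n))"
    unfolding e_def single_sum by (rule sum.swap)
  also have "\<dots> = Poly_Mapping.single (?X 0) (e 0) + (\<Sum>n=Suc 0..K + a. Poly_Mapping.single (?X n) (e n))"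
    by (simp add: atMost_atLeast0 sum.atLeast_Suc_atMost)
  finally have prod: "kap K (- int a) y t * (\<Sum>l\<le>a. Poly_Mapping.single (vr t (int l) + vr y (int a - int l)) (rbin a l)) = \<dots>" .
  have e: "e n = (if n = 0 then 1 else 0)" if n: "n \<le> K" for n
  proof -
    have "e n = (\<Sum>k\<le>K. if k \<le> n then c k * rbin a (n - k) else 0)"
      unfolding e_def
    proof (rule sum.cong[OF refl])
      fix k
      show "(\<Sum>l\<le>a. if k + l = n then c k * rbin a l else 0) = (if k \<le> n then c k * rbin a (n - k) else 0)"
      proof (cases "k \<le> n")
        case True
        then have "(\<Sum>l\<le>a. if k + l = n then c k * rbin a l else 0) = (\<Sum>l\<le>a. if l = n - k then c k * rbin a (n - k) else 0)"
          by (intro sum.cong) auto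
        then show ?thesis using True by (auto simp: rbin_def qb_eq_0)
      qed auto
    qed
    also have "\<dots> = (\<Sum>k=0..n. c k * rbin a (n - k))"
      using n by (intro sum.mono_neutral_cong_right) auto
    finally show ?thesis by (simp add: contr_rbin c_def)
  qed
  have "?X 0 = 0" by (simp add: vr_0)
  then have "kap K (- int a) y t * (\<Sum>l\<le>a. Poly_Mapping.single (vr t (int l) + vr y (int a - int l)) (rbin a l)) - 1 =
      (\<Sum>n=Suc 0..K + a. Poly_Mapping.single (?X n) (e n))"
    unfolding prod by (simp only: e[of 0] le0 if_True refl single_one add_diff_cancel_left')
  moreover have "Poly_Mapping.keys (Poly_Mapping.single (?X n) (e n)) \<subseteq> {?X n | n. n > K}" if "n \<in> {Suc 0..K + a}" for n
  proof (cases "n \<le> K")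
    case True
    then have "e n = 0" using e[of n] that by simp
    then show ?thesis by simp
  qed (auto split: if_splits)
  ultimately show ?thesis using order.trans[OF keys_sum UN_least] by (metis (no_types, lifting))
qed

lemma rbin_symmetric: "l \<le> a \<Longrightarrow> qb Q (inverse Q) a (a - l) = qb Q (inverse Q) a l"
  using qbinom_eq_qb[OF Q0 Q_nonroot, of "a - l" a] qbinom_eq_qb[OF Q0 Q_nonroot, of l a]
  by (simp add: qbinom_def mult.commute)

end

section \<open>Vanishing of the kernel\<close>

text \<open>What \<open>act_far_eq_0\<close> requires of the factor beside an error term of row
  \<open>i\<close>. Exponents of the other variables may be unbounded, so truncated series in them
  are tame with a bound independent of \<open>K\<close>.\<close>

definition tame :: "nat \<Rightarrow> nat \<Rightarrow> nat \<Rightarrow> laurent \<Rightarrow> bool" where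
  "tame m i B P \<longleftrightarrow>
    Poly_Mapping.keys P \<subseteq> {x. 0 \<le> x i \<and> x i \<le> int B \<and> - int B \<le> (\<Sum>v\<le>m. x v)}"

lemma tame_mult: "tame m i B P \<Longrightarrow> tame m i C R \<Longrightarrow> tame m i (B + C) (P * R)"
  unfolding tame_def by (erule keys_mult_subset) (assumption, auto simp: sum.distrib)

lemma tame_mono: "tame m i B P \<Longrightarrow> B \<le> C \<Longrightarrow> tame m i C P"
  unfolding tame_def by fastforce

lemma tame_single: "0 \<le> x i \<Longrightarrow> x i \<le> int B \<Longrightarrow> - int B \<le> (\<Sum>v\<le>m. x v) \<Longrightarrow> tame m i B (Poly_Mapping.single x c)"
  by (auto simp: tame_def)

lemma tame_cst: "tame m i 0 (cst c)"
  unfolding cst_def by (rule tame_single) auto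

lemma tame_1: "tame m i 0 1"
  using tame_cst[of m i 1] by (simp add: cst_1)

lemma tame_uminus: "tame m i B P \<Longrightarrow> tame m i B (- P)"
  by (simp add: tame_def)

lemma tame_diff: "tame m i B P \<Longrightarrow> tame m i B R \<Longrightarrow> tame m i B (P - R)"
  unfolding tame_def using keys_diff[of P R] by blast

lemma tame_sum: "(\<And>s. s \<in> S \<Longrightarrow> tame m i B (p s)) \<Longrightarrow> tame m i B (sum p S)"
  unfolding tame_def by (rule order.trans[OF keys_sum]) blast

lemma tame_prod:
  assumes "finite S" and "\<And>s. s \<in> S \<Longrightarrow> tame m i B (p s)"
  shows "tame m i (card S * B) (prod p S)"
  using assms
proof (induction S rule: finite_induct)
  case (insert s S)
  then show ?case using tame_mult[of m i B "p s" "card S * B" "prod p S"] by simp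
qed (simp add: tame_1)

lemma tame_det:
  assumes M: "M \<in> carrier_mat n n" and "\<And>s k. s < n \<Longrightarrow> k < n \<Longrightarrow> tame m i B (M $$ (s, k))"
  shows "tame m i (n * B) (det M)"
  unfolding det_def'[OF M]
proof (rule tame_sum)
  fix p assume "p \<in> {p. p permutes {0..<n}}"
  then have "p s < n" if "s < n" for s using that permutes_in_image[of p "{0..<n}" s] by simp
  then have "tame m i (card {0..<n} * B) (\<Prod>s = 0..<n. M $$ (s, p s))"
    using assms(2) by (intro tame_prod) auto
  moreover have "tame m i 0 (signof p)" by (simp add: sign_def tame_1 tame_uminus)
  ultimately show "tame m i (n * B) (signof p * (\<Prod>s = 0..<n. M $$ (s, p s)))"
    using tame_mult by fastforce
qed

lemma tame_var: "tame m i (Suc 0) (var t)"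
  unfolding var_def by (rule tame_single) (auto simp: vr_def)

lemma tame_var_power: "t \<noteq> i \<Longrightarrow> tame m i 0 (var t ^ n)"
  unfolding var_power by (rule tame_single) (auto simp: vr_def)

context vertex_setup
begin

text \<open>The contraction does not involve variable \<open>i\<close> and is homogeneous of degree
  \<open>-a\<close>.\<close>

lemma tame_kap:
  assumes "i \<le> m" "y \<le> m" "t \<le> m" "y \<noteq> i" "t \<noteq> i"
  shows "tame m i a (kap K (- int a) y t)"
  unfolding tame_def
proof (rule order.trans[OF keys_kap], clarify)
  fix k
  have "(\<Sum>v\<le>m. (vr y (- int a - int k) + vr t (int k)) v) = - int a"
    using assms by (simp add: sum.distrib vr_def)
  then show "0 \<le> (vr y (- int a - int k) + vr t (int k)) i \<and> (vr y (- int a - int k) + vr t (int k)) i \<le> int a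
     \<and> - int a \<le> (\<Sum>v\<le>m. (vr y (- int a - int k) + vr t (int k)) v)"
    using assms by (simp add: vr_def)
qed

text \<open>Terms whose \<open>i\<close>-th exponent is far from zero do not contribute: a large positive exponent violates
  the bound at \<open>i\<close>, and a large negative one forces, by the total degree, a violation elsewhere.\<close>
lemma act_far_eq_0:
  assumes N: "\<And>g y. y \<le> m \<Longrightarrow> g y < - int D \<Longrightarrow> N g = 0"
    and H: "Poly_Mapping.keys H \<subseteq> {vr i n + vr m (- n) | n. \<bar>n\<bar> > int K}"
    and G: "tame m i B G" and i: "i < m"
    and K: "int K \<ge> (\<Sum>y\<le>m. \<bar>f y\<bar> + int D) + 2 * int B"
  shows "act (H * G) N f = 0"
proof (rule act_eq_0)
  fix x assume "x \<in> Poly_Mapping.keys (H * G)"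
  then obtain h g where "x = h + g" "h \<in> Poly_Mapping.keys H" and g: "g \<in> Poly_Mapping.keys G"
    using keys_mult[of H G] by blast
  then obtain n where x: "x = vr i n + vr m (- n) + g" and n: "\<bar>n\<bar> > int K" using H by blast
  have xi: "x i = n + g i" using i by (simp add: x vr_def)
  have tot: "(\<Sum>v\<le>m. x v) = (\<Sum>v\<le>m. g v)" using i by (simp add: x sum.distrib vr_def)
  have gi: "0 \<le> g i" "g i \<le> int B" "- int B \<le> (\<Sum>v\<le>m. g v)"
    using g G by (auto simp: tame_def)
  have fi: "\<bar>f i\<bar> + int D \<le> (\<Sum>y\<le>m. \<bar>f y\<bar> + int D)"
    by (rule member_le_sum) (use i in auto)
  have "\<exists>y\<le>m. (f - x) y < - int D"
  proof (rule ccontr)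
    assume "\<not> ?thesis"
    then have le: "x y \<le> \<bar>f y\<bar> + int D" if "y \<le> m" for y
      using that by (force simp: not_less)
    show False
    proof (cases "n > 0")
      case True
      then show False using le[of i] i n xi gi fi K by auto
    next
      case False
      have "(\<Sum>v\<le>m. x v) = x i + (\<Sum>v\<in>{..m} - {i}. x v)" using i by (simp add: sum.remove)
      also have "(\<Sum>v\<in>{..m} - {i}. x v) \<le> (\<Sum>v\<in>{..m} - {i}. \<bar>f v\<bar> + int D)"
        by (rule sum_mono) (use le in auto)
      also have "\<dots> \<le> (\<Sum>v\<le>m. \<bar>f v\<bar> + int D)" by (rule sum_mono2) auto
      finally show False using False n xi gi K tot by linarith
    qed
  qed
  then show "N (f - x) = 0" using N by blast
qed

lemma qbinom_eq_qb_Q: "r \<le> m \<Longrightarrow> qbinom q m r = qb Q (inverse Q) m r"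
  using qbinom_eq_qb[OF Q0 Q_nonroot, of r m] Q_cases by (auto simp: qbinom_inverse)

lemma keys_cst_mult: "Poly_Mapping.keys (cst c * P) \<subseteq> Poly_Mapping.keys P"
  using keys_mult[of "cst c" P] by (auto simp: cst_def split: if_splits)

text \<open>The sign is the cost of moving \<open>X_j\<close> past one \<open>X_i\<close>, so
  \<open>r\<close> factors carry the cocycle sign of \<open>r\<close> transpositions. It also makes
  the two halves of the column relation agree.\<close>

definition useries :: "nat \<Rightarrow> nat \<Rightarrow> nat \<Rightarrow> nat \<Rightarrow> laurent" where
  "useries K a m t = cst ((- 1) ^ a) * kap K (- int a) t m"

definition vseries :: "nat \<Rightarrow> nat \<Rightarrow> nat \<Rightarrow> nat \<Rightarrow> laurent" where
  "vseries K a m t = kap K (- int a) m t"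

abbreviation smat :: "nat \<Rightarrow> nat \<Rightarrow> laurent mat" where
  "smat K a \<equiv> serre_mat (cst Q) (cst (inverse Q)) (Suc a) var (useries K a (Suc a)) (vseries K a (Suc a))"

lemma cst_Q: "cst Q * cst (inverse Q) = 1"
  using Q0 by (simp flip: cst_mult add: cst_1)

text \<open>Coefficients of the column relation: by the q-binomial theorem the two halves are the polynomials
  inverse to the two expansions of the contraction, so the combination is \<open>1 - 1\<close> up to truncation.\<close>
definition colrel :: "nat \<Rightarrow> nat \<Rightarrow> laurent" where
  "colrel a k = cst ((- 1) ^ k * qb Q (inverse Q) a k * Q ^ k * inverse Q ^ a) * var (Suc a) ^ k"

text \<open>In the \<open>v\<close> half, reversal of \<open>k\<close> and the symmetry of
  q-binomials give \<open>(-1)^a\<close> times the polynomial inverse to the expansion in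
  \<open>z/w\<close>. In the \<open>u\<close> half, the weight \<open>Q^(a-2k)\<close> of the matrix
  entries gives the polynomial inverse to the expansion in \<open>w/z\<close>, and
  \<open>useries\<close> brings the same sign. The two 1s cancel, leaving the truncation
  errors.\<close>

lemma keys_column_relation:
  assumes t: "t < Suc a"
  shows "Poly_Mapping.keys (\<Sum>k<Suc a. colrel a k * smat K a $$ (t, k)) \<subseteq>
    {vr t n + vr (Suc a) (- n) | n. \<bar>n\<bar> > int K}"
proof -
  let ?w = "Suc a" and ?E = "(- 1) ^ a :: complex"
  let ?X1 = "kap K (- int a) ?w t * (\<Sum>l\<le>a. Poly_Mapping.single (vr t (int l) + vr ?w (int a - int l)) (rbin a l))"
  let ?X2 = "kap K (- int a) t ?w * (\<Sum>l\<le>a. Poly_Mapping.single (vr ?w (int l) + vr t (int a - int l)) (rbin a l))"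
  have QQ: "Q ^ n * inverse Q ^ n = 1" for n using Q0 by (simp flip: power_mult_distrib)
  have mono: "cst c * var ?w ^ k * var t ^ l = Poly_Mapping.single (vr t (int l) + vr ?w (int k)) c" for c k l
    unfolding var_power cst_def by (simp add: mult_single add.commute)
  have 1: "(\<Sum>k\<le>a. colrel a k * var t ^ (a - k)) = cst ?E * (\<Sum>l\<le>a. Poly_Mapping.single (vr t (int l) + vr ?w (int a - int l)) (rbin a l))"
  proof -
    have "(\<Sum>k\<le>a. colrel a k * var t ^ (a - k)) = (\<Sum>l\<le>a. colrel a (a - l) * var t ^ l)"
      by (rule sum.reindex_bij_witness[of _ "\<lambda>k. a - k" "\<lambda>k. a - k"]) auto
    also have "\<dots> = (\<Sum>l\<le>a. cst ?E * Poly_Mapping.single (vr t (int l) + vr ?w (int a - int l)) (rbin a l))"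
    proof (intro sum.cong refl)
      fix l assume "l \<in> {..a}"
      then have l: "l \<le> a" by simp
      have s: "(- 1) ^ (a - l) = ?E * (- 1) ^ l"
      proof -
        have "?E = (- 1) ^ (a - l) * (- 1) ^ l" using l by (simp flip: power_add)
        then show ?thesis by (simp add: mult.assoc flip: power_mult_distrib)
      qed
      have p: "Q ^ (a - l) * inverse Q ^ a = inverse Q ^ l"
      proof -
        have "inverse Q ^ a = inverse Q ^ (a - l) * inverse Q ^ l" using l by (simp flip: power_add)
        then show ?thesis using QQ[of "a - l"] by (simp flip: mult.assoc)
      qed
      have "(- 1) ^ (a - l) * qb Q (inverse Q) a (a - l) * Q ^ (a - l) * inverse Q ^ a = ?E * rbin a l"
        unfolding s mult.assoc p rbin_symmetric[OF l] by (simp only: rbin_def mult.assoc)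
      then show "colrel a (a - l) * var t ^ l = cst ?E * Poly_Mapping.single (vr t (int l) + vr ?w (int a - int l)) (rbin a l)"
        unfolding colrel_def mono cst_mult_single using l by (simp only: of_nat_diff)
    qed
    finally show ?thesis by (simp only: sum_distrib_left)
  qed
  have 2: "(\<Sum>k\<le>a. colrel a k * var t ^ (a - k) * (cst Q ^ a * cst (inverse Q) ^ (2 * k))) =
      (\<Sum>l\<le>a. Poly_Mapping.single (vr ?w (int l) + vr t (int a - int l)) (rbin a l))"
  proof (intro sum.cong refl)
    fix k assume "k \<in> {..a}"
    then have k: "int (a - k) = int a - int k" by (simp add: of_nat_diff)
    have "(- 1) ^ k * qb Q (inverse Q) a k * Q ^ k * inverse Q ^ a * (Q ^ a * inverse Q ^ (2 * k)) =
       (- 1) ^ k * qb Q (inverse Q) a k * (Q ^ k * inverse Q ^ k) * (Q ^ a * inverse Q ^ a) * inverse Q ^ k"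
      unfolding mult_2 power_add by (simp only: mult_ac)
    then have c: "(- 1) ^ k * qb Q (inverse Q) a k * Q ^ k * inverse Q ^ a * (Q ^ a * inverse Q ^ (2 * k)) = rbin a k"
      by (simp add: QQ rbin_def)
    have "colrel a k * var t ^ (a - k) * (cst Q ^ a * cst (inverse Q) ^ (2 * k)) =
        cst ((- 1) ^ k * qb Q (inverse Q) a k * Q ^ k * inverse Q ^ a * (Q ^ a * inverse Q ^ (2 * k))) * var ?w ^ k * var t ^ (a - k)"
      unfolding colrel_def cst_mult cst_power by (simp only: mult_ac)
    then show "colrel a k * var t ^ (a - k) * (cst Q ^ a * cst (inverse Q) ^ (2 * k)) =
       Poly_Mapping.single (vr ?w (int k) + vr t (int a - int k)) (rbin a k)"
      unfolding c mono k by (simp only: add.commute)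
  qed
  have "(\<Sum>k<Suc a. colrel a k * smat K a $$ (t, k)) =
      (\<Sum>k\<le>a. colrel a k * var t ^ (a - k)) * vseries K a ?w t -
      (\<Sum>k\<le>a. colrel a k * var t ^ (a - k) * (cst Q ^ a * cst (inverse Q) ^ (2 * k))) * useries K a ?w t"
    unfolding sum_distrib_right sum_subtractf[symmetric] lessThan_Suc_atMost
    using t by (intro sum.cong refl) (simp add: serre_mat_def right_diff_distrib mult.assoc)
  also have "\<dots> = cst ?E * ((?X1 - 1) - (?X2 - 1))"
    unfolding 1 2 useries_def vseries_def by (simp add: algebra_simps)
  finally have eq: "(\<Sum>k<Suc a. colrel a k * smat K a $$ (t, k)) = cst ?E * ((?X1 - 1) - (?X2 - 1))" .
  have k1: "Poly_Mapping.keys (?X1 - 1) \<subseteq> {vr t n + vr ?w (- n) | n. \<bar>n\<bar> > int K}"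
    by (rule order.trans[OF keys_kap_rbin]) (use t in force)+
  have k2: "Poly_Mapping.keys (?X2 - 1) \<subseteq> {vr t n + vr ?w (- n) | n. \<bar>n\<bar> > int K}"
  proof (rule order.trans[OF keys_kap_rbin])
    show "t \<noteq> ?w" using t by simp
    show "{vr ?w (int n) + vr t (- int n) | n. n > K} \<subseteq> {vr t n + vr ?w (- n) | n. \<bar>n\<bar> > int K}"
    proof clarify
      fix n assume "n > K"
      then show "\<exists>n'. vr ?w (int n) + vr t (- int n) = vr t n' + vr ?w (- n') \<and> \<bar>n'\<bar> > int K"
        by (intro exI[of _ "- int n"]) (simp add: add.commute)
    qed
  qed
  show ?thesis unfolding eq
    using keys_cst_mult[of ?E "(?X1 - 1) - (?X2 - 1)"] keys_diff[of "?X1 - 1" "?X2 - 1"] k1 k2 by blast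
qed

definition serre_kernel :: "'n \<Rightarrow> 'n \<Rightarrow> nat \<Rightarrow> nat \<Rightarrow> laurent" where
  "serre_kernel i j a K = (\<Sum>\<sigma> | \<sigma> permutes {..<Suc a}. \<Sum>r\<le>Suc a.
     cst ((- 1) ^ r * qbinom q (Suc a) r * ((- 1) ^ a) ^ r) * kern K (word i j (Suc a) \<sigma> r))"

lemma serre_kernel_eq_det:
  assumes ii: "A i i = 2" and ij: "A i j = - int a" and ji: "A j i = - int a" and K: "K \<ge> 2"
  shows "serre_kernel i j a K = pairprod (\<lambda>s t. var s - var t) (Suc a) *
    (\<Prod>l<Suc a. \<Sum>n<Suc l. ((cst (inverse Q))\<^sup>2) ^ n) * det (smat K a)"
  unfolding serre_symmetrization_eq_det[OF cst_Q, symmetric] serre_kernel_def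
proof (intro sum.cong refl)
  fix \<sigma>
  let ?m = "Suc a"
  let ?PP = "pairprod (\<lambda>s t. (var (\<sigma> s) - var (\<sigma> t)) * (var (\<sigma> s) - (cst (inverse Q))\<^sup>2 * var (\<sigma> t))) ?m"
  let ?u = "\<lambda>s. useries K a ?m (\<sigma> s)" and ?v = "\<lambda>s. vseries K a ?m (\<sigma> s)"
  have "cst ((- 1) ^ r * qbinom q ?m r * ((- 1) ^ a) ^ r) * kern K (word i j ?m \<sigma> r) =
      ?PP * ((- 1) ^ r * qb (cst Q) (cst (inverse Q)) ?m r * (\<Prod>s<r. ?u s) * (\<Prod>s\<in>{r..<?m}. ?v s))"
    if r: "r \<le> ?m" for r
  proof -
    have "cst ((- 1) ^ r * qbinom q ?m r * ((- 1) ^ a) ^ r) =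
        (- 1) ^ r * qb (cst Q) (cst (inverse Q)) ?m r * cst ((- 1) ^ a) ^ r"
      unfolding qbinom_eq_qb_Q[OF r] cst_mult cst_qb cst_power cst_uminus cst_1 ..
    moreover have "(\<Prod>s<r. ?u s) = cst ((- 1) ^ a) ^ r * (\<Prod>s<r. kap K (- int a) (\<sigma> s) ?m)"
      by (simp only: useries_def prod.distrib prod_constant card_lessThan)
    ultimately show ?thesis
      unfolding kern_word[OF r] ii ij ji kap_2[OF K] vseries_def by (simp only: mult_ac)
  qed
  then show "(\<Sum>r\<le>?m. cst ((- 1) ^ r * qbinom q ?m r * ((- 1) ^ a) ^ r) * kern K (word i j ?m \<sigma> r)) =
      ?PP * serre_sum (cst Q) (cst (inverse Q)) ?m ?u ?v"
    unfolding serre_sum_def sum_distrib_left by (intro sum.cong refl) simp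
qed

text \<open>Only row \<open>t\<close> contains \<open>z_t\<close>, and this row is deleted.\<close>

lemma tame_cofactor:
  assumes t: "t < Suc a"
  shows "tame (Suc a) t (a * a) (cofactor (smat K a) t 0)"
proof -
  let ?m = "Suc a"
  have ins: "insert_index t s \<noteq> t" "s < a \<Longrightarrow> insert_index t s < ?m" for s
    by (auto simp: insert_index_def)
  have "tame ?m t (a * a) (det (mat_delete (smat K a) t 0))"
    unfolding serre_mat_delete[OF cst_Q t]
  proof (rule tame_det)
    fix s k assume sk: "s < a" "k < a"
    let ?s = "insert_index t s"
    have s: "?s \<le> ?m" "t \<le> ?m" "?s \<noteq> t" "?m \<noteq> t" using ins[of s] sk t by auto
    have 0: "tame ?m t 0 (cst x ^ n)" for x n by (simp flip: cst_power add: tame_cst)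
    have 1: "tame ?m t (0 + (0 + (0 + (0 + a)))) (cst Q ^ (a - 1) * (cst (inverse Q) ^ (2 * k) * (cst (inverse Q) * (cst ((- 1) ^ a) * kap K (- int a) ?s ?m))))"
      by (intro tame_mult 0 tame_cst tame_kap) (use s in auto)
    have 2: "tame ?m t a (kap K (- int a) ?m ?s)" by (intro tame_kap) (use s in auto)
    have "tame ?m t (0 + a) (var ?s ^ (a - 1 - k) * (vseries K a ?m ?s - cst Q ^ (a - 1) * cst (inverse Q) ^ (2 * k) * (cst (inverse Q) * useries K a ?m ?s)))"
      unfolding useries_def vseries_def using 1 2 s
      by (intro tame_mult tame_var_power tame_diff) (simp_all add: mult.assoc)
    then show "tame ?m t a (serre_mat (cst Q) (cst (inverse Q)) a (\<lambda>t'. var (insert_index t t'))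
        (\<lambda>t'. cst (inverse Q) * useries K a ?m (insert_index t t')) (\<lambda>t'. vseries K a ?m (insert_index t t')) $$ (s, k))"
      using sk by (simp add: serre_mat_def)
  qed (simp add: serre_mat_def)
  moreover have "tame ?m t 0 ((- 1) ^ (t + 0))"
    using tame_cst[of ?m t "(- 1) ^ (t + 0)"] by (simp add: cst_power cst_uminus cst_1)
  ultimately show ?thesis unfolding cofactor_def using tame_mult by fastforce
qed

lemma act_serre_kernel:
  assumes "A i i = 2" "A i j = - int a" "A j i = - int a"
    and N: "\<And>g y. y \<le> Suc a \<Longrightarrow> g y < - int D \<Longrightarrow> N g = 0"
  shows "\<forall>\<^sub>F K in sequentially. act (serre_kernel i j a K) N f = 0"
proof -
  let ?m = "Suc a"
  define Y where "Y = pairprod (\<lambda>s t. var s - var t) ?m * (\<Prod>l<?m. \<Sum>n<Suc l. ((cst (inverse Q))\<^sup>2) ^ n)"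
  have Y: "tame ?m t (?m * ?m + 0) Y" for t
    unfolding Y_def
  proof (rule tame_mult)
    have "tame ?m t (card {..<?m} * ?m) (\<Prod>s<?m. \<Prod>r<s. var r - var s)"
    proof (rule tame_prod)
      fix s assume s: "s \<in> {..<?m}"
      have "tame ?m t (card {..<s} * Suc 0) (\<Prod>r<s. var r - var s)"
        by (intro tame_prod tame_diff tame_var) auto
      then show "tame ?m t ?m (\<Prod>r<s. var r - var s)" by (rule tame_mono) (use s in auto)
    qed simp
    then show "tame ?m t (?m * ?m) (pairprod (\<lambda>s t. var s - var t) ?m)" by (simp add: pairprod_def)
    have "tame ?m t (card {..<?m} * 0) (\<Prod>l<?m. \<Sum>n<Suc l. ((cst (inverse Q))\<^sup>2) ^ n)"
      by (intro tame_prod tame_sum) (simp_all only: finite_lessThan flip: cst_power, rule tame_cst)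
    then show "tame ?m t 0 (\<Prod>l<?m. \<Sum>n<Suc l. ((cst (inverse Q))\<^sup>2) ^ n)" by simp
  qed
  \<comment> \<open>Independent of \<open>K\<close>, so that \<open>K\<close> can be taken beyond
    the threshold for the given coefficient \<open>f\<close>.\<close>
  define B' where "B' = a * a + (?m * ?m + 0 + 0)"
  let ?K0 = "nat ((\<Sum>y\<le>?m. \<bar>f y\<bar> + int D) + 2 * int B')"
  show ?thesis
    using eventually_ge_at_top[of 2] eventually_ge_at_top[of ?K0]
  proof eventually_elim
    case (elim K)
    let ?M = "smat K a"
    have M: "?M \<in> carrier_mat ?m ?m" by (simp add: serre_mat_def)
    define rel where "rel = (\<lambda>t. \<Sum>k<?m. colrel a k * ?M $$ (t, k))"
    \<comment> \<open>Pairing the column relation with the cofactors of the first column leaves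
      \<open>colrel a 0\<close> times the determinant, and \<open>colrel a 0\<close> is an
      invertible constant.\<close>
    have "(\<Sum>t<?m. rel t * cofactor ?M t 0) = (\<Sum>k<?m. colrel a k * (\<Sum>t<?m. ?M $$ (t, k) * cofactor ?M t 0))"
      unfolding rel_def sum_distrib_right sum_distrib_left by (subst sum.swap) (simp only: mult.assoc)
    also have "\<dots> = (\<Sum>k<?m. if k = 0 then colrel a 0 * det ?M else 0)"
      using cofactor_col_orthogonal[OF M] by (intro sum.cong refl) auto
    also have "\<dots> = colrel a 0 * det ?M" by simp
    also have "colrel a 0 = cst (inverse Q ^ a)" by (simp add: colrel_def)
    finally have "cst (Q ^ a) * (\<Sum>t<?m. rel t * cofactor ?M t 0) = cst (Q ^ a * inverse Q ^ a) * det ?M"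
      by (simp add: cst_mult mult.assoc)
    also have "Q ^ a * inverse Q ^ a = 1" using Q0 by (simp flip: power_mult_distrib)
    finally have det: "det ?M = cst (Q ^ a) * (\<Sum>t<?m. rel t * cofactor ?M t 0)" by (simp add: cst_1)
    have "serre_kernel i j a K = Y * det ?M"
      unfolding Y_def by (rule serre_kernel_eq_det[OF assms(1-3)]) (rule elim(1))
    also have "\<dots> = (\<Sum>t<?m. rel t * (cofactor ?M t 0 * (Y * cst (Q ^ a))))"
      unfolding det sum_distrib_left by (intro sum.cong refl) (simp only: mult_ac)
    finally have "act (serre_kernel i j a K) N f = (\<Sum>t<?m. act (rel t * (cofactor ?M t 0 * (Y * cst (Q ^ a)))) N f)"
      by (simp only: act_sum)
    also have "\<dots> = 0"
    proof (rule sum.neutral, rule ballI)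
      fix t assume "t \<in> {..<?m}"
      then have t: "t < ?m" by simp
      show "act (rel t * (cofactor ?M t 0 * (Y * cst (Q ^ a)))) N f = 0"
      proof (rule act_far_eq_0)
        show "Poly_Mapping.keys (rel t) \<subseteq> {vr t n + vr ?m (- n) | n. \<bar>n\<bar> > int K}"
          unfolding rel_def by (rule keys_column_relation[OF t])
        show "tame ?m t B' (cofactor ?M t 0 * (Y * cst (Q ^ a)))"
          unfolding B'_def by (intro tame_mult tame_cofactor[OF t] Y tame_cst)
        show "int K \<ge> (\<Sum>y\<le>?m. \<bar>f y\<bar> + int D) + 2 * int B'" using elim(2) by linarith
      qed (use N t in auto)
    qed
    finally show ?case .
  qed
qed

end

section \<open>The Serre relations\<close>

lemma lat_sum_swap: "lat_sum sg \<beta> (xs @ i # j # ys) = lat_sum sg \<beta> (xs @ j # i # ys)"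
  by (induction xs) (simp_all add: fun_eq_iff)

text \<open>The operators to the left see the same lattice vector in both orders. Multiplicativity
  in the second argument isolates the one factor in which the swapped operators see each
  other.\<close>

lemma cocycle_swap:
  assumes mult: "\<And>b b'. \<epsilon> (\<lambda>k. sg * sroot i k) (\<lambda>k. b k + b' k) = \<epsilon> (\<lambda>k. sg * sroot i k) b * \<epsilon> (\<lambda>k. sg * sroot i k) b'"
    "\<And>b b'. \<epsilon> (\<lambda>k. sg * sroot j k) (\<lambda>k. b k + b' k) = \<epsilon> (\<lambda>k. sg * sroot j k) b * \<epsilon> (\<lambda>k. sg * sroot j k) b'"
    and comm: "\<epsilon> (\<lambda>k. sg * sroot i k) (\<lambda>k. sg * sroot j k) = s * \<epsilon> (\<lambda>k. sg * sroot j k) (\<lambda>k. sg * sroot i k)"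
  shows "cocycle \<epsilon> sg \<beta> (xs @ i # j # ys) = s * cocycle \<epsilon> sg \<beta> (xs @ j # i # ys)"
proof (induction xs)
  case Nil
  show ?case by (simp add: mult comm)
next
  case (Cons a xs)
  then show ?case by (simp add: lat_sum_swap[of sg \<beta> xs i j ys])
qed

lemma bform_scaled_sroots: "bform A (\<lambda>k. c * sroot i k) (\<lambda>k. d * sroot j k) = c * A i j * d"
proof -
  have "(\<Sum>b\<in>UNIV. c * sroot i a * A a b * (d * sroot j b)) = (if a = i then c * A i j * d else 0)" for a
  proof -
    have "(\<Sum>b\<in>UNIV. c * sroot i a * A a b * (d * sroot j b)) =
        (\<Sum>b\<in>UNIV. if b = j then c * sroot i a * A a j * d else 0)"
      by (intro sum.cong) (auto simp: sroot_def)
    then show ?thesis by (simp add: sroot_def)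
  qed
  then show ?thesis unfolding bform_def by simp
qed

lemma scaleF_single: "scaleF c (Poly_Mapping.single \<gamma> x) = Poly_Mapping.single \<gamma> (sc c * x)"
  by (simp add: scaleF_def map_single)

lemma scaleF_0: "scaleF c 0 = 0"
  using scaleF_single[of c 0 0] by simp

lemma lookup_scaleF: "Poly_Mapping.lookup (scaleF c v) k = sc c * Poly_Mapping.lookup v k"
  unfolding scaleF_def by transfer (auto simp: when_def)

lemma scaleF_add: "scaleF c (v + w) = scaleF c v + scaleF c w"
  by (rule poly_mapping_eqI) (simp add: lookup_scaleF lookup_add distrib_left)

lemma scaleF_zero: "scaleF 0 v = 0"
  by (rule poly_mapping_eqI) (simp add: lookup_scaleF)

context vertex_setup
begin

lemma foldr_X_mode_add:
  "foldr (\<lambda>(i, y) f. X_mode A \<epsilon> q sq sg i (- d y - 1) \<circ> f) ops id (v + w) =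
   foldr (\<lambda>(i, y) f. X_mode A \<epsilon> q sq sg i (- d y - 1) \<circ> f) ops id v +
   foldr (\<lambda>(i, y) f. X_mode A \<epsilon> q sq sg i (- d y - 1) \<circ> f) ops id w"
  by (induction ops) (auto simp: X_mode_add)

lemma vo_series_add:
  "vo_series A \<epsilon> q sq sg ops d (v + w) = vo_series A \<epsilon> q sq sg ops d v + vo_series A \<epsilon> q sq sg ops d w"
  by (simp add: vo_series_def foldr_X_mode_add)

lemma map_fst_word: "map fst (word i j m \<sigma> r) = replicate r i @ j # replicate (m - r) i"
  by (simp add: word_def comp_def map_replicate_const)

lemma lat_cocycle_word:
  fixes \<epsilon> :: "'n lat \<Rightarrow> 'n lat \<Rightarrow> complex"
  assumes mult: "\<And>a b b'. \<epsilon> a (\<lambda>k. b k + b' k) = \<epsilon> a b * \<epsilon> a b'"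
    and comm: "\<epsilon> (\<lambda>k. sg * sroot i k) (\<lambda>k. sg * sroot j k) = s * \<epsilon> (\<lambda>k. sg * sroot j k) (\<lambda>k. sg * sroot i k)"
    and "r \<le> m"
  shows "lat_sum sg \<beta> (replicate r i @ j # replicate (m - r) i) = lat_sum sg \<beta> (j # replicate m i) \<and>
    cocycle \<epsilon> sg \<beta> (replicate r i @ j # replicate (m - r) i) = s ^ r * cocycle \<epsilon> sg \<beta> (j # replicate m i)"
  using assms(3)
proof (induction r)
  case (Suc r)
  have "replicate (m - r) i = i # replicate (m - Suc r) i"
    using Suc.prems by (simp add: Suc_diff_Suc flip: replicate_Suc)
  moreover have "replicate (Suc r) i @ j # replicate (m - Suc r) i = replicate r i @ i # j # replicate (m - Suc r) i"
    by (simp add: replicate_app_Cons_same)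
  ultimately show ?case
    using Suc lat_sum_swap[of sg \<beta> "replicate r i" i j "replicate (m - Suc r) i"]
      cocycle_swap[of \<epsilon> sg i j s \<beta> "replicate r i" "replicate (m - Suc r) i", OF mult mult comm]
    by (simp only: Suc_leD power_Suc mult.assoc)
qed simp

text \<open>Additivity reduces to one vector \<open>u\<close> at \<open>e^\<beta>\<close>. All words
  then have the same lattice vector and normally ordered product, and their cocycles differ by
  signs; as there are finitely many words, one \<open>K\<close> serves all of them and the
  kernel.\<close>

theorem serre_relation:
  fixes \<epsilon> :: "'n lat \<Rightarrow> 'n lat \<Rightarrow> complex"
  assumes A: "A i i = 2" "A i j = - int a" "A j i = - int a"
    and mult: "\<And>a b b'. \<epsilon> a (\<lambda>k. b k + b' k) = \<epsilon> a b * \<epsilon> a b'"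
    and comm: "\<epsilon> (\<lambda>k. sg * sroot i k) (\<lambda>k. sg * sroot j k) =
      (- 1) ^ a * \<epsilon> (\<lambda>k. sg * sroot j k) (\<lambda>k. sg * sroot i k)"
  shows "(\<Sum>\<sigma> | \<sigma> permutes {..<Suc a}. \<Sum>r\<le>Suc a.
    scaleF ((- 1) ^ r * qbinom q (Suc a) r) (vo_series A \<epsilon> q sq sg (word i j (Suc a) \<sigma> r) d v)) = 0"
proof (induction v rule: poly_mapping_single_induct)
  case (add v w)
  then show ?case by (simp only: vo_series_add scaleF_add sum.distrib add_0_right)
next
  case (single \<beta> u)
  let ?m = "Suc a" and ?\<Sigma> = "{\<sigma>. \<sigma> permutes {..<Suc a}}"
  have vars: "snd ` set (word i j ?m \<sigma> r) = {..?m}" if "\<sigma> \<in> ?\<Sigma>" "r \<le> ?m" for \<sigma> r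
    using that set_word[of \<sigma> ?m r i j] by (auto simp: image_iff)
  show ?case
  proof (cases "\<forall>y. y \<notin> {..?m} \<longrightarrow> d y = 0")
    case False
    then have "vo_series A \<epsilon> q sq sg (word i j ?m \<sigma> r) d x = 0" if "\<sigma> \<in> ?\<Sigma>" "r \<le> ?m" for \<sigma> r x
      using vars[OF that] by (simp only: vo_series_def if_False)
    then show ?thesis by (intro sum.neutral ballI) (simp add: scaleF_0)
  next
    case True
    obtain D where D: "bnd D u" using bnd_exists by blast
    define d0 where "d0 = (\<lambda>y. sg * bform A (sroot (if y < ?m then i else j)) \<beta>)"
    let ?N = "nord D (word i j ?m id 0) u" and ?f = "d - d0"
    let ?\<gamma> = "lat_sum sg \<beta> (j # replicate ?m i)" and ?C = "cocycle \<epsilon> sg \<beta> (j # replicate ?m i)"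
    let ?X = "\<lambda>\<sigma> r. foldr (\<lambda>(i, y) f. X_mode A \<epsilon> q sq sg i (- d y - 1) \<circ> f) (word i j ?m \<sigma> r) id (Poly_Mapping.single \<beta> u)"
    have "\<forall>\<^sub>F K in sequentially. ?X \<sigma> r = Poly_Mapping.single ?\<gamma> (sc (((- 1) ^ a) ^ r * ?C) * act (kern K (word i j ?m \<sigma> r)) ?N ?f)"
      if "\<sigma> \<in> ?\<Sigma>" "r \<in> {..?m}" for \<sigma> r
    proof -
      have \<sigma>: "\<sigma> permutes {..<?m}" and r: "r \<le> ?m" using that by auto
      have d0: "d0 y = sg * bform A (sroot k) \<beta>" if "(k, y) \<in> set (word i j ?m \<sigma> r)" for k y
        using that unfolding set_word[OF \<sigma> r] d0_def by auto
      have N: "nord D (word i j ?m \<sigma> r) u = ?N"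
        by (rule ext) (rule nord_mset[OF mset_word[OF \<sigma> r]])
      have "\<forall>\<^sub>F K in sequentially. ?X \<sigma> r = Poly_Mapping.single (lat_sum sg \<beta> (map fst (word i j ?m \<sigma> r)))
          (sc (cocycle \<epsilon> sg \<beta> (map fst (word i j ?m \<sigma> r))) *
            act (kern K (word i j ?m \<sigma> r)) (nord D (word i j ?m \<sigma> r) u) ?f)"
        by (rule vertex_product[OF D distinct_word[OF \<sigma> r]]) (rule d0)
      then show ?thesis
        unfolding N map_fst_word lat_cocycle_word[OF mult comm r, THEN conjunct1] lat_cocycle_word[OF mult comm r, THEN conjunct2] .
    qed
    then have "\<forall>\<^sub>F K in sequentially. \<forall>(\<sigma>, r)\<in>?\<Sigma> \<times> {..?m}.
        ?X \<sigma> r = Poly_Mapping.single ?\<gamma> (sc (((- 1) ^ a) ^ r * ?C) * act (kern K (word i j ?m \<sigma> r)) ?N ?f)"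
      by (intro eventually_ball_finite) (auto simp: finite_permutations)
    moreover have "?N g = 0" if "y \<le> ?m" "g y < - int D" for g y
      using that vars[of id 0] by (intro nord_eq_0[of y]) (auto simp: permutes_id)
    then have "\<forall>\<^sub>F K in sequentially. act (serre_kernel i j a K) ?N ?f = 0"
      by (rule act_serre_kernel[OF A])
    ultimately have "\<forall>\<^sub>F K in sequentially. (\<forall>(\<sigma>, r)\<in>?\<Sigma> \<times> {..?m}.
        ?X \<sigma> r = Poly_Mapping.single ?\<gamma> (sc (((- 1) ^ a) ^ r * ?C) * act (kern K (word i j ?m \<sigma> r)) ?N ?f)) \<and>
      act (serre_kernel i j a K) ?N ?f = 0"
      by (rule eventually_conj)
    from eventually_happens'[OF sequentially_bot this]
    obtain K where K: "act (serre_kernel i j a K) ?N ?f = 0" and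
      "\<forall>(\<sigma>, r)\<in>?\<Sigma> \<times> {..?m}.
        ?X \<sigma> r = Poly_Mapping.single ?\<gamma> (sc (((- 1) ^ a) ^ r * ?C) * act (kern K (word i j ?m \<sigma> r)) ?N ?f)"
      by blast
    then have X: "?X \<sigma> r = Poly_Mapping.single ?\<gamma> (sc (((- 1) ^ a) ^ r * ?C) * act (kern K (word i j ?m \<sigma> r)) ?N ?f)"
      if "\<sigma> \<in> ?\<Sigma>" "r \<le> ?m" for \<sigma> r
      using that by blast
    have "(\<Sum>\<sigma>\<in>?\<Sigma>. \<Sum>r\<le>?m. scaleF ((- 1) ^ r * qbinom q ?m r) (vo_series A \<epsilon> q sq sg (word i j ?m \<sigma> r) d (Poly_Mapping.single \<beta> u))) =
      (\<Sum>\<sigma>\<in>?\<Sigma>. \<Sum>r\<le>?m. Poly_Mapping.single ?\<gamma> (sc ?C *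
        act (cst ((- 1) ^ r * qbinom q ?m r * ((- 1) ^ a) ^ r) * kern K (word i j ?m \<sigma> r)) ?N ?f))"
    proof (intro sum.cong refl)
      fix \<sigma> r assume \<sigma>: "\<sigma> \<in> ?\<Sigma>" and "r \<in> {..?m}"
      then have r: "r \<le> ?m" by simp
      have "vo_series A \<epsilon> q sq sg (word i j ?m \<sigma> r) d (Poly_Mapping.single \<beta> u) = ?X \<sigma> r"
        unfolding vo_series_def vars[OF \<sigma> r] if_P[OF True] ..
      then show "scaleF ((- 1) ^ r * qbinom q ?m r) (vo_series A \<epsilon> q sq sg (word i j ?m \<sigma> r) d (Poly_Mapping.single \<beta> u)) =
        Poly_Mapping.single ?\<gamma> (sc ?C * act (cst ((- 1) ^ r * qbinom q ?m r * ((- 1) ^ a) ^ r) * kern K (word i j ?m \<sigma> r)) ?N ?f)"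
        unfolding X[OF \<sigma> r] by (simp only: scaleF_single act_cst_mult sc_mult mult.assoc mult.left_commute)
    qed
    also have "\<dots> = Poly_Mapping.single ?\<gamma> (sc ?C * act (serre_kernel i j a K) ?N ?f)"
      by (simp only: serre_kernel_def act_sum sum_distrib_left single_sum)
    also have "\<dots> = 0" by (simp add: K)
    finally show ?thesis .
  qed
qed

end

theorem theorem2:
  fixes A :: "'n::finite \<Rightarrow> 'n \<Rightarrow> int"
    and \<epsilon> :: "'n lat \<Rightarrow> 'n lat \<Rightarrow> complex"
    and q sq :: complex and sg :: int and i j :: 'n
  assumes A_diag: "\<forall>a. A a a = 2"
    and A_sym: "\<forall>a b. A a b = A b a"
    and A_off: "\<forall>a b. a \<noteq> b \<longrightarrow> A a b \<le> 0"
    and q_nonroot: "\<forall>n::nat. n > 0 \<longrightarrow> q ^ n \<noteq> 1"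
    and sq: "sq ^ 2 = q"
    and eps_val: "\<forall>a b. \<epsilon> a b \<in> {1, -1}"
    and eps_mult1: "\<forall>a a' b. \<epsilon> (\<lambda>k. a k + a' k) b = \<epsilon> a b * \<epsilon> a' b"
    and eps_mult2: "\<forall>a b b'. \<epsilon> a (\<lambda>k. b k + b' k) = \<epsilon> a b * \<epsilon> a b'"
    and eps_comm: "\<forall>a b. \<epsilon> a b / \<epsilon> b a = (-1) powi (bform A a b)"
    and sg: "sg \<in> {1, -1}"
    and ij: "i \<noteq> j"
  shows "let m = nat (1 - A i j) in
    \<forall>d v. (\<Sum>\<sigma>\<in>{\<sigma>. \<sigma> permutes {..<m}}. \<Sum>r\<le>m.
       scaleF ((-1) ^ r * qbinom q m r)
         (vo_series A \<epsilon> q sq sg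
            (map (\<lambda>t. (i, \<sigma> t)) [0..<r] @ [(j, m)] @ map (\<lambda>t. (i, \<sigma> t)) [r..<m]) d v)) = 0"
proof -
  define a where "a = nat (- A i j)"
  have Aij: "A i j = - int a" using A_off ij by (simp add: a_def)
  then have m: "nat (1 - A i j) = Suc a" by simp
  show ?thesis
  proof (cases "q = 0")
    case True
    \<comment> \<open>Junk value: for \<open>q = 0\<close> the division in \<open>qnum\<close> makes all quantum numbers vanish.\<close>
    then have "qfact q (Suc a) = 0" by (simp add: qfact_def qnum_def)
    then show ?thesis by (simp add: m qbinom_def scaleF_zero)
  next
    case False
    then interpret vertex_setup A q sq sg
      using q_nonroot sq sg by unfold_locales auto
    let ?i = "\<lambda>k. sg * sroot i k" and ?j = "\<lambda>k. sg * sroot j k"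
    \<comment> \<open>Both roots carry the same sign, so the commutation sign is that of
      \<open>\<alpha>_i\<close> and \<open>\<alpha>_j\<close> for either choice.\<close>
    have "sg * sg = 1" using sg by auto
    moreover have "bform A ?i ?j = (sg * sg) * A i j"
      unfolding bform_scaled_sroots by (simp only: mult_ac)
    ultimately have "bform A ?i ?j = - int a" by (simp add: Aij)
    then have "\<epsilon> ?i ?j / \<epsilon> ?j ?i = (- 1) powi (- int a)" using eps_comm by metis
    also have "\<dots> = (- 1) ^ a" by (simp add: power_int_minus flip: power_inverse)
    finally have comm: "\<epsilon> ?i ?j = (- 1) ^ a * \<epsilon> ?j ?i"
      using eps_val by (metis insertE nonzero_divide_eq_eq singletonD zero_neq_neg_one zero_neq_one)
    have "(\<Sum>\<sigma>\<in>{\<sigma>. \<sigma> permutes {..<Suc a}}. \<Sum>r\<le>Suc a. scaleF ((-1) ^ r * qbinom q (Suc a) r)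
        (vo_series A \<epsilon> q sq sg (word i j (Suc a) \<sigma> r) d v)) = 0" for d v
      by (rule serre_relation) (use A_diag A_sym Aij eps_mult2 comm in auto)
    then show ?thesis unfolding m Let_def word_def by blast
  qed
qed

end
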